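(* Let $j\ge 0$ be an integer and let $a(n)>0$, $b(n)\in\mathbb{R}$, $n\in\mathbb{Z}$, satisfy $\left|a(n)-\tfrac12\right|+|b(n)|\in\ell^1_{j+1}(\mathbb{Z})$. Let $T$ and $R_\pm$ be the transmission and reflection coefficients of the associated Jacobi operator $H$. Then, for $0\le l\le j$, $$\frac{d^l}{dz^l}T(z)\in\mathcal{A}\qquad\text{and}\qquad\frac{d^l}{dz^l}R_\pm(z)\in\mathcal{A}.$$
   Context: The condition $|a(n)-\tfrac12|+|b(n)|\in\ell^1_{\sigma}(\mathbb{Z})$ means $\sum_{n\in\mathbb{Z}}(1+|n|)^{\sigma}\left(|a(n)-\tfrac12|+|b(n)|\right)<\infty$. The Jacobi operator is $(Hu)(n)=a(n-1)u(n-1)+b(n)u(n)+a(n)u(n+1)$. Jost solutions: for $0<|z|\le1$, $\varphi_\pm(z,\cdot)$ denote the solutions of $H\varphi_\pm(z,n)=\frac{z+z^{-1}}{2}\varphi_\pm(z,n)$, $n\in\mathbb{Z}$, satisfying $\lim_{n\to\pm\infty}z^{\mp n}\varphi_\pm(z,n)=1$ (they exist and are unique under the assumption with $\sigma=1$). Scattering coefficients: for $|z|=1$, $z^2\ne1$, the transmission coefficient $T(z)$ and reflection coefficients $R_\pm(z)$ are the complex numbers determined by the scattering relations $$T(z)\varphi_\pm(z,n)=R_\mp(z)\varphi_\mp(z,n)+\varphi_\mp(z^{-1},n),\qquad n\in\mathbb{Z}.$$ At $z=\pm1$ they are defined by continuous extension. Wiener algebra: $\mathcal{A}$ is the set of functions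 $f(z)=\sum_{m\in\mathbb{Z}}\hat f(m)z^m$ on the unit circle $|z|=1$ with $\|f\|_{\mathcal{A}}=\sum_{m\in\mathbb{Z}}|\hat f(m)|<\infty$. Derivatives $\frac{d}{dz}$ are taken along the unit circle, i.e. $\frac{d}{dz}=-\mathrm{i}e^{-\mathrm{i}\theta}\frac{d}{d\theta}$ for $z=e^{\mathrm{i}\theta}$. The assertion includes that $T$, $R_\pm$ extend to the whole circle and possess the stated derivatives. *)

theory Defs
  imports "HOL-Analysis.Analysis"
begin

definition weighted_l1 :: "nat \<Rightarrow> (int \<Rightarrow> real) set" where
  "weighted_l1 \<sigma> = {f. (\<lambda>n. (1 + \<bar>real_of_int n\<bar>) ^ \<sigma> * \<bar>f n\<bar>) summable_on UNIV}"

definition jacobi_op ::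
  "(int \<Rightarrow> real) \<Rightarrow> (int \<Rightarrow> real) \<Rightarrow> (int \<Rightarrow> complex) \<Rightarrow> int \<Rightarrow> complex" where
  "jacobi_op a b u n =
     of_real (a (n - 1)) * u (n - 1) + of_real (b n) * u n + of_real (a n) * u (n + 1)"

definition jacobi_solution ::
  "(int \<Rightarrow> real) \<Rightarrow> (int \<Rightarrow> real) \<Rightarrow> complex \<Rightarrow> (int \<Rightarrow> complex) \<Rightarrow> bool" where
  "jacobi_solution a b z u \<longleftrightarrow> (\<forall>n. jacobi_op a b u n = (z + inverse z) / 2 * u n)"

text \<open>The Jost solutions are meaningful for $0 < |z| \le 1$ only.\<close>

definition jost_plus :: "(int \<Rightarrow> real) \<Rightarrow> (int \<Rightarrow> real) \<Rightarrow> complex \<Rightarrow> int \<Rightarrow> complex" where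
  "jost_plus a b z =
     (THE u. jacobi_solution a b z u \<and> ((\<lambda>n. z powi (- n) * u n) \<longlongrightarrow> 1) at_top)"

definition jost_minus :: "(int \<Rightarrow> real) \<Rightarrow> (int \<Rightarrow> real) \<Rightarrow> complex \<Rightarrow> int \<Rightarrow> complex" where
  "jost_minus a b z =
     (THE u. jacobi_solution a b z u \<and> ((\<lambda>n. z powi n * u n) \<longlongrightarrow> 1) at_bot)"

text \<open>The triple $(T(z), R_+(z), R_-(z))$, meaningful for $|z| = 1$, $z^2 \ne 1$.\<close>

definition scattering_coeffs ::
  "(int \<Rightarrow> real) \<Rightarrow> (int \<Rightarrow> real) \<Rightarrow> complex \<Rightarrow> complex \<times> complex \<times> complex" where
  "scattering_coeffs a b z =
     (THE (T, Rp, Rm). \<forall>n.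
        T * jost_plus a b z n = Rm * jost_minus a b z n + jost_minus a b (inverse z) n \<and>
        T * jost_minus a b z n = Rp * jost_plus a b z n + jost_plus a b (inverse z) n)"

text \<open>
  Extension to $z = \pm 1$ by the limit along the unit circle. If that limit does not
  exist, the value is arbitrary, and the resulting function is then not continuous there.
\<close>

definition circle_extend :: "(complex \<Rightarrow> complex) \<Rightarrow> complex \<Rightarrow> complex" where
  "circle_extend f z = (if z\<^sup>2 = 1 then Lim (at z within sphere 0 1) f else f z)"

definition transmission :: "(int \<Rightarrow> real) \<Rightarrow> (int \<Rightarrow> real) \<Rightarrow> complex \<Rightarrow> complex" where
  "transmission a b = circle_extend (\<lambda>z. fst (scattering_coeffs a b z))"

definition reflection_plus :: "(int \<Rightarrow> real) \<Rightarrow> (int \<Rightarrow> real) \<Rightarrow> complex \<Rightarrow> complex" where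
  "reflection_plus a b = circle_extend (\<lambda>z. fst (snd (scattering_coeffs a b z)))"

definition reflection_minus :: "(int \<Rightarrow> real) \<Rightarrow> (int \<Rightarrow> real) \<Rightarrow> complex \<Rightarrow> complex" where
  "reflection_minus a b = circle_extend (\<lambda>z. snd (snd (scattering_coeffs a b z)))"

text \<open>
  A function on the unit circle is represented by a total function; neither the Wiener
  algebra nor the circle derivative depends on its values off the circle.
\<close>

definition wiener_algebra :: "(complex \<Rightarrow> complex) set" where
  "wiener_algebra =
     {f. \<exists>c :: int \<Rightarrow> complex. (\<lambda>m. norm (c m)) summable_on UNIV \<and>
           (\<forall>z\<in>sphere 0 1. f z = (\<Sum>\<^sub>\<infinity>m. c m * z powi m))}"

definition circle_differentiable :: "(complex \<Rightarrow> complex) \<Rightarrow> bool" where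
  "circle_differentiable f \<longleftrightarrow> (\<forall>\<theta>::real. (\<lambda>t. f (cis t)) differentiable at \<theta>)"

text \<open>$\frac{d}{dz} = -\mathrm{i} e^{-\mathrm{i}\theta} \frac{d}{d\theta}$ at
  $z = e^{\mathrm{i}\theta}$, with $\theta$ the principal argument.\<close>

definition circle_deriv :: "(complex \<Rightarrow> complex) \<Rightarrow> complex \<Rightarrow> complex" where
  "circle_deriv f z =
     - \<i> * cis (- Arg z) * vector_derivative (\<lambda>t. f (cis t)) (at (Arg z))"

end

theory Submission
  imports Defs "HOL-Computational_Algebra.Fundamental_Theorem_Algebra" "HOL-Library.Nat_Bijection"
begin

text \<open>
For |z| = 1 let f and g be the Jost solutions normalised at +\<infinity> and -\<infinity>, write [u,v] for the
(constant) Wronskian of two solutions and let W = [g,f]. As H has real coefficients, f(1/z) and g(1/z) are the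
conjugates f* and g* of f and g, and Cramer's rule turns the scattering relations into

  T = (z - 1/z) / (2W),   R_+ = [f*,g] / W,   R_- = [f,g*] / W.

Let A_j be the algebra of Laurent series \<Sum> c_m z^m with \<Sum> (1 + |m|)^j |c_m| < \<infinity>. A
function in A_j has j derivatives along the circle, all in the Wiener algebra, so it suffices to prove that T
and R_\<plusminus> are in A_j. This rests on three facts.

First, f(z,n) and g(z,n) belong to A_j for every n. With f(z,n) = z^n h_n(z), the Jacobi equation becomes a
Volterra equation on a half line whose kernel 1 + z^2 + ... + z^(2k) has A_j-norm of order (k+1)^(j+1). This
is exactly what the moment of order j+1 pays for: far enough to the right the equation is a contraction in
A_j, and the recurrence carries the result to all n (jost_plus_weighted_wiener).

Second, Wiener's lemma holds in A_j: a nowhere vanishing element is invertible (weighted_wiener_inverse).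
The proof is Newman's: replace the function by a Laurent polynomial P and sum a geometric series in the error,
where the norms of the powers of 1/P are controlled by Cauchy's estimates on an annulus.

Third, W can vanish only at z = 1 and z = -1, since |W| \<ge> |z - 1/z| / 2. If W does vanish at such a point
e, then all three quotients have to be reduced by z - e, and a plain division by z - e would cost one more
moment. It does not, because f(e,.) and g(e,.) are then proportional: Wronskians such as [f(z),g(z)] are
combinations of the Wronskians [f(z),f(e)] and [g(z),g(e)] of the same solution at two energies. The energies
at z and e differ by (z - e)^2 / (2z), so that [f(z),f(e)] is formally (z - e)^2 / (2z) times a sum of f(z,k)
f(e,k); one factor z - e is used for a summation by parts, which replaces h_k by its differences, and these
are summable in A_j with the given moment (jost_plus_wronskian_quotient_far, regular_family_resonance).
After the cancellation the numerator of T does not vanish at e, hence by |W| \<ge> |z - 1/z| / 2 neither does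
the reduced W, and Wiener's lemma applies (scattering_data_weighted_wiener).
\<close>

section \<open>Weighted algebras of Laurent series\<close>

text \<open>
Keeping the weighted l1-norm as a relation instead of a function avoids the uniqueness of Laurent coefficients
altogether: every estimate below produces some expansion with a good bound. The weight and the set are
parameters because two instances are needed, polynomial weights on the circle and exponential weights on an
annulus.
\<close>
definition laurent_norm_le ::
  "(int \<Rightarrow> real) \<Rightarrow> complex set \<Rightarrow> (complex \<Rightarrow> complex) \<Rightarrow> real \<Rightarrow> bool" where
  "laurent_norm_le w K f B \<longleftrightarrow>
     (\<exists>c. (\<lambda>m. w m * norm (c m)) summable_on UNIV \<and> (\<Sum>\<^sub>\<infinity>m. w m * norm (c m)) \<le> B \<and>
          (\<forall>z\<in>K. f z = (\<Sum>\<^sub>\<infinity>m. c m * z powi m)))"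

locale laurent_weight =
  fixes w :: "int \<Rightarrow> real" and K :: "complex set"
  assumes powi_le_weight: "z \<in> K \<Longrightarrow> norm (z powi m) \<le> w m"
    and zero_notin: "0 \<notin> K"
    and weight_nonneg: "0 \<le> w m"
    and weight_add: "w (m + n) \<le> w m * w n"
begin

abbreviation bounded_by :: "(complex \<Rightarrow> complex) \<Rightarrow> real \<Rightarrow> bool" where
  "bounded_by \<equiv> laurent_norm_le w K"

lemma norm_term_le: "z \<in> K \<Longrightarrow> norm (c * z powi m) \<le> w m * norm c"
  using mult_left_mono[OF powi_le_weight[of z m] norm_ge_zero[of c]] by (simp add: norm_mult mult.commute)

lemma abs_summable_laurent:
  assumes "(\<lambda>m. w m * norm (c m)) summable_on A" "z \<in> K"
  shows "(\<lambda>m. norm (c m * z powi m)) summable_on A"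
  by (rule Infinite_Sum.abs_summable_on_comparison_test'[OF assms(1)]) (rule norm_term_le[OF assms(2)])

lemma bounded_by_cong: "bounded_by f B \<Longrightarrow> (\<And>z. z \<in> K \<Longrightarrow> f z = g z) \<Longrightarrow> bounded_by g B"
  unfolding laurent_norm_le_def by metis

lemma bounded_by_mono: "bounded_by f B \<Longrightarrow> B \<le> B' \<Longrightarrow> bounded_by f B'"
  unfolding laurent_norm_le_def by (meson order_trans)

lemma bounded_by_nonneg:
  assumes "bounded_by f B" shows "0 \<le> B"
proof -
  obtain c :: "int \<Rightarrow> complex" where c: "(\<Sum>\<^sub>\<infinity>m. w m * norm (c m)) \<le> B" using assms unfolding laurent_norm_le_def by blast
  have "0 \<le> (\<Sum>\<^sub>\<infinity>m. w m * norm (c m))" by (rule infsum_nonneg) (simp add: weight_nonneg)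
  with c show ?thesis by linarith
qed

lemma norm_le_bound:
  assumes "bounded_by f B" "z \<in> K" shows "norm (f z) \<le> B"
proof -
  obtain c where c: "(\<lambda>m. w m * norm (c m)) summable_on UNIV" "(\<Sum>\<^sub>\<infinity>m. w m * norm (c m)) \<le> B"
    "f z = (\<Sum>\<^sub>\<infinity>m. c m * z powi m)"
    using assms unfolding laurent_norm_le_def by blast
  have s: "(\<lambda>m. norm (c m * z powi m)) summable_on UNIV" by (rule abs_summable_laurent[OF c(1) assms(2)])
  have "norm (f z) \<le> (\<Sum>\<^sub>\<infinity>m. norm (c m * z powi m))" unfolding c(3) by (rule norm_infsum_bound[OF s])
  also have "\<dots> \<le> (\<Sum>\<^sub>\<infinity>m. w m * norm (c m))"
    by (rule infsum_mono[OF s c(1)]) (rule norm_term_le[OF assms(2)])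
  finally show ?thesis using c(2) by linarith
qed

lemma bounded_by_powi: "bounded_by (\<lambda>z. a * z powi k) (w k * norm a)"
proof -
  define c where "c m = (if m = k then a else 0)" for m :: int
  have "((\<lambda>m. w m * norm (c m)) has_sum (w k * norm a)) UNIV"
    by (rule has_sum_finite_neutralI[where B="{k}"]) (auto simp: c_def)
  moreover have "((\<lambda>m. c m * z powi m) has_sum (a * z powi k)) UNIV" for z :: complex
    by (rule has_sum_finite_neutralI[where B="{k}"]) (auto simp: c_def)
  ultimately show ?thesis unfolding laurent_norm_le_def
    by (intro exI[of _ c]) (auto simp: has_sum_iff)
qed

text \<open>
Fubini for the coefficients. The other closure properties, products included, and the completeness of the
algebra are instances of this statement, so that convolutions never appear.
\<close>
lemma bounded_by_series:
  assumes f: "\<And>i. i \<in> I \<Longrightarrow> bounded_by (f i) (B i)" and B: "B summable_on I"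
  shows "bounded_by (\<lambda>z. \<Sum>\<^sub>\<infinity>i\<in>I. f i z) (infsum B I)"
proof -
  have "\<forall>i\<in>I. \<exists>c. (\<lambda>m. w m * norm (c m)) summable_on UNIV \<and>
      (\<Sum>\<^sub>\<infinity>m. w m * norm (c m)) \<le> B i \<and> (\<forall>z\<in>K. f i z = (\<Sum>\<^sub>\<infinity>m. c m * z powi m))"
    using f unfolding laurent_norm_le_def by blast
  from bchoice[OF this] obtain c where c: "\<And>i. i \<in> I \<Longrightarrow> (\<lambda>m. w m * norm (c i m)) summable_on UNIV"
    "\<And>i. i \<in> I \<Longrightarrow> (\<Sum>\<^sub>\<infinity>m. w m * norm (c i m)) \<le> B i"
    "\<And>i z. i \<in> I \<Longrightarrow> z \<in> K \<Longrightarrow> f i z = (\<Sum>\<^sub>\<infinity>m. c i m * z powi m)"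
    by blast
  have nn: "0 \<le> (\<Sum>\<^sub>\<infinity>m. w m * norm (c i m))" for i by (rule infsum_nonneg) (simp add: weight_nonneg)
  have rows: "(\<lambda>i. \<Sum>\<^sub>\<infinity>m. w m * norm (c i m)) summable_on I"
    by (rule summable_on_comparison_test[OF B]) (use c(2) nn in auto)
  have tot: "(\<lambda>(i,m). w m * norm (c i m)) summable_on I \<times> UNIV"
  proof -
    have "(\<lambda>x. norm (case x of (i,m) \<Rightarrow> w m * norm (c i m))) summable_on (I \<times> UNIV)"
      using c(1) rows nn weight_nonneg by (subst Infinite_Sum.abs_summable_on_Sigma_iff) (auto simp: abs_mult)
    then show ?thesis by (rule abs_summable_summable)
  qed
  have tot': "(\<lambda>(m,i). w m * norm (c i m)) summable_on UNIV \<times> I"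
    using tot by (subst summable_on_swap) simp
  have cols: "(\<lambda>i. w m * norm (c i m)) summable_on I" for m
    using summable_on_SigmaD1[OF tot'] by (simp add: weight_nonneg)
  define d where "d m = (\<Sum>\<^sub>\<infinity>i\<in>I. c i m)" for m
  have dle: "w m * norm (d m) \<le> (\<Sum>\<^sub>\<infinity>i\<in>I. w m * norm (c i m))" for m
  proof (cases "w m = 0")
    case False
    then have "(\<lambda>i. norm (c i m)) summable_on I" using cols[of m] by (simp add: summable_on_cmult_right')
    then have "norm (d m) \<le> (\<Sum>\<^sub>\<infinity>i\<in>I. norm (c i m))" unfolding d_def by (rule norm_infsum_bound)
    then have "w m * norm (d m) \<le> w m * (\<Sum>\<^sub>\<infinity>i\<in>I. norm (c i m))" by (simp add: mult_left_mono weight_nonneg)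
    then show ?thesis by (simp add: infsum_cmult_right')
  qed simp
  have colsum: "(\<lambda>m. \<Sum>\<^sub>\<infinity>i\<in>I. w m * norm (c i m)) summable_on UNIV"
    using summable_on_Sigma_banach[OF tot'] .
  have dsum: "(\<lambda>m. w m * norm (d m)) summable_on UNIV"
    by (rule summable_on_comparison_test[OF colsum]) (use dle in \<open>auto simp: weight_nonneg\<close>)
  have "(\<Sum>\<^sub>\<infinity>m. w m * norm (d m)) \<le> (\<Sum>\<^sub>\<infinity>m. \<Sum>\<^sub>\<infinity>i\<in>I. w m * norm (c i m))"
    by (rule infsum_mono[OF dsum colsum dle])
  also have "\<dots> = (\<Sum>\<^sub>\<infinity>i\<in>I. \<Sum>\<^sub>\<infinity>m. w m * norm (c i m))"
    using infsum_swap_banach[OF tot] by simp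
  also have "\<dots> \<le> infsum B I" by (rule infsum_mono[OF rows B c(2)])
  finally have dB: "(\<Sum>\<^sub>\<infinity>m. w m * norm (d m)) \<le> infsum B I" .
  have "(\<Sum>\<^sub>\<infinity>i\<in>I. f i z) = (\<Sum>\<^sub>\<infinity>m. d m * z powi m)" if z: "z \<in> K" for z
  proof -
    have "(\<lambda>x. norm (case x of (i,m) \<Rightarrow> c i m * z powi m)) summable_on (I \<times> UNIV)"
      by (rule Infinite_Sum.abs_summable_on_comparison_test'[OF tot]) (use norm_term_le[OF z] in auto)
    then have S: "(\<lambda>(i,m). c i m * z powi m) summable_on (I \<times> UNIV)" by (rule abs_summable_summable)
    have "(\<Sum>\<^sub>\<infinity>i\<in>I. f i z) = (\<Sum>\<^sub>\<infinity>i\<in>I. \<Sum>\<^sub>\<infinity>m. c i m * z powi m)"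
      by (rule infsum_cong) (use c(3) z in auto)
    also have "\<dots> = (\<Sum>\<^sub>\<infinity>m. \<Sum>\<^sub>\<infinity>i\<in>I. c i m * z powi m)" by (rule infsum_swap_banach[OF S])
    also have "\<dots> = (\<Sum>\<^sub>\<infinity>m. d m * z powi m)" unfolding d_def by (simp add: infsum_cmult_left')
    finally show ?thesis .
  qed
  with dsum dB show ?thesis unfolding laurent_norm_le_def by blast
qed

lemma bounded_by_summable:
  assumes "\<And>i. i \<in> I \<Longrightarrow> bounded_by (f i) (B i)" "B summable_on I" "z \<in> K"
  shows "(\<lambda>i. norm (f i z)) summable_on I"
  by (rule Infinite_Sum.abs_summable_on_comparison_test'[OF assms(2)]) (use assms norm_le_bound in auto)

lemma bounded_by_sum:
  assumes "finite I" "\<And>i. i \<in> I \<Longrightarrow> bounded_by (f i) (B i)"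
  shows "bounded_by (\<lambda>z. \<Sum>i\<in>I. f i z) (\<Sum>i\<in>I. B i)"
  using bounded_by_series[of I f B] assms by simp

lemma bounded_by_add:
  assumes "bounded_by f A" "bounded_by g B" shows "bounded_by (\<lambda>z. f z + g z) (A + B)"
  using bounded_by_sum[of "UNIV :: bool set" "\<lambda>b. if b then f else g" "\<lambda>b. if b then A else B"] assms
  by (auto simp: UNIV_bool add.commute)

lemma bounded_by_powi_mult:
  assumes "bounded_by f B" shows "bounded_by (\<lambda>z. a * z powi k * f z) (w k * norm a * B)"
proof -
  obtain c where c: "(\<lambda>m. w m * norm (c m)) summable_on UNIV" "(\<Sum>\<^sub>\<infinity>m. w m * norm (c m)) \<le> B"
    "\<And>z. z \<in> K \<Longrightarrow> f z = (\<Sum>\<^sub>\<infinity>m. c m * z powi m)"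
    using assms unfolding laurent_norm_le_def by blast
  have le: "w (m + k) * norm (a * c m) \<le> w k * norm a * (w m * norm (c m))" for m
    using mult_right_mono[OF weight_add[of m k], of "norm (a * c m)"] by (simp add: norm_mult algebra_simps)
  have b: "bounded_by (\<lambda>z. \<Sum>\<^sub>\<infinity>m. a * c m * z powi (m + k)) (\<Sum>\<^sub>\<infinity>m. w k * norm a * (w m * norm (c m)))"
    by (rule bounded_by_series, rule bounded_by_mono, rule bounded_by_powi, rule le)
       (rule summable_on_cmult_right[OF c(1)])
  have "a * z powi k * f z = (\<Sum>\<^sub>\<infinity>m. a * c m * z powi (m + k))" if "z \<in> K" for z
  proof -
    have "z \<noteq> 0" using that zero_notin by auto
    then show ?thesis unfolding c(3)[OF that]
      by (subst infsum_cmult_right'[symmetric]) (simp add: power_int_add algebra_simps)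
  qed
  with bounded_by_cong[OF b] have "bounded_by (\<lambda>z. a * z powi k * f z) (w k * norm a * (\<Sum>\<^sub>\<infinity>m. w m * norm (c m)))"
    by (simp add: infsum_cmult_right')
  then show ?thesis
    by (rule bounded_by_mono) (use c(2) in \<open>simp add: mult_left_mono weight_nonneg\<close>)
qed

text \<open>
The product is the series of the shifted functions c_m z^m g, to which submultiplicativity of the weight
applies term by term.
\<close>
lemma bounded_by_mult:
  assumes "bounded_by f A" "bounded_by g B" shows "bounded_by (\<lambda>z. f z * g z) (A * B)"
proof -
  obtain c where c: "(\<lambda>m. w m * norm (c m)) summable_on UNIV" "(\<Sum>\<^sub>\<infinity>m. w m * norm (c m)) \<le> A"
    "\<And>z. z \<in> K \<Longrightarrow> f z = (\<Sum>\<^sub>\<infinity>m. c m * z powi m)"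
    using assms unfolding laurent_norm_le_def by blast
  have b: "bounded_by (\<lambda>z. \<Sum>\<^sub>\<infinity>m. c m * z powi m * g z) (\<Sum>\<^sub>\<infinity>m. w m * norm (c m) * B)"
    by (rule bounded_by_series, rule bounded_by_powi_mult[OF assms(2)])
       (rule summable_on_cmult_left[OF c(1)])
  have "bounded_by (\<lambda>z. f z * g z) ((\<Sum>\<^sub>\<infinity>m. w m * norm (c m)) * B)"
    using bounded_by_cong[OF b, of "\<lambda>z. f z * g z"] by (simp add: c(3) infsum_cmult_left')
  then show ?thesis
    by (rule bounded_by_mono) (use c(2) bounded_by_nonneg[OF assms(2)] in \<open>simp add: mult_right_mono\<close>)
qed

lemma bounded_by_const: "bounded_by (\<lambda>z. a) (w 0 * norm a)"
  using bounded_by_powi[of a 0] by simp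

lemma bounded_by_cmult:
  assumes "bounded_by f B" shows "bounded_by (\<lambda>z. a * f z) (w 0 * norm a * B)"
  using bounded_by_powi_mult[OF assms, of a 0] by simp

lemma bounded_by_suminf:
  assumes f: "\<And>i. bounded_by (f i) (B i)" and B: "summable B"
  shows "bounded_by (\<lambda>z. \<Sum>i::nat. f i z) (suminf B)"
    and "z \<in> K \<Longrightarrow> summable (\<lambda>i. norm (f i z))"
proof -
  have BS: "B summable_on UNIV"
    using B bounded_by_nonneg[OF f] by (simp add: summable_on_UNIV_nonneg_real_iff)
  have s: "(\<lambda>i. norm (f i z)) summable_on UNIV" if "z \<in> K" for z
    by (rule bounded_by_summable[OF f BS that])
  show "z \<in> K \<Longrightarrow> summable (\<lambda>i. norm (f i z))" using s[THEN summable_on_imp_summable] .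
  have "bounded_by (\<lambda>z. \<Sum>\<^sub>\<infinity>i. f i z) (infsum B UNIV)"
    by (rule bounded_by_series[OF f BS])
  moreover have "infsum B UNIV = suminf B" using has_sum_imp_sums[OF has_sum_infsum[OF BS]] by (simp add: sums_iff)
  moreover have "(\<Sum>\<^sub>\<infinity>i. f i z) = (\<Sum>i. f i z)" if "z \<in> K" for z
    using has_sum_imp_sums[OF has_sum_infsum[OF abs_summable_summable[OF s[OF that]]]] by (simp add: sums_iff)
  ultimately show "bounded_by (\<lambda>z. \<Sum>i. f i z) (suminf B)" using bounded_by_cong by simp
qed

end

section \<open>Wiener's lemma for polynomial weights\<close>

definition pweight :: "nat \<Rightarrow> int \<Rightarrow> real" where
  "pweight j m = (1 + \<bar>real_of_int m\<bar>) ^ j"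

lemma pweight_0 [simp]: "pweight j 0 = 1"
  by (simp add: pweight_def)

interpretation wn: laurent_weight "pweight j" "sphere 0 1" for j
proof
  fix m n :: int and z :: complex
  show "norm (z powi m) \<le> pweight j m" if "z \<in> sphere 0 1"
    using that by (simp add: pweight_def norm_power_int)
  show "0 \<notin> sphere (0::complex) 1" by simp
  show "0 \<le> pweight j m" by (simp add: pweight_def)
  have "1 + \<bar>real_of_int (m + n)\<bar> \<le> (1 + \<bar>real_of_int m\<bar>) * (1 + \<bar>real_of_int n\<bar>)"
  proof -
    have "(1 + \<bar>real_of_int m\<bar>) * (1 + \<bar>real_of_int n\<bar>)
        = 1 + \<bar>real_of_int m\<bar> + \<bar>real_of_int n\<bar> + \<bar>real_of_int m\<bar> * \<bar>real_of_int n\<bar>"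
      by (simp add: algebra_simps)
    moreover have "0 \<le> \<bar>real_of_int m\<bar> * \<bar>real_of_int n\<bar>" by (rule mult_nonneg_nonneg) auto
    ultimately show ?thesis using abs_triangle_ineq[of "real_of_int m" "real_of_int n"]
      by (simp only: of_int_add)
  qed
  then show "pweight j (m + n) \<le> pweight j m * pweight j n"
    unfolding pweight_def power_mult_distrib[symmetric] by (intro power_mono) auto
qed

abbreviation wiener_norm_le :: "nat \<Rightarrow> (complex \<Rightarrow> complex) \<Rightarrow> real \<Rightarrow> bool" where
  "wiener_norm_le j \<equiv> laurent_norm_le (pweight j) (sphere 0 1)"

definition weighted_wiener :: "nat \<Rightarrow> (complex \<Rightarrow> complex) \<Rightarrow> bool" where
  "weighted_wiener j f \<longleftrightarrow> (\<exists>B. wiener_norm_le j f B)"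

definition annulus :: "real \<Rightarrow> complex set" where
  "annulus r = {z. 1 / r \<le> norm z \<and> norm z \<le> r}"

lemma laurent_weight_annulus:
  assumes r: "1 < r" shows "laurent_weight (\<lambda>m. r ^ nat \<bar>m\<bar>) (annulus r)"
proof
  fix m n :: int and z :: complex
  show "norm (z powi m) \<le> r ^ nat \<bar>m\<bar>" if "z \<in> annulus r"
  proof -
    have "0 < 1 / r" using r by simp
    then have z0: "norm z > 0" using that unfolding annulus_def by (smt (verit) mem_Collect_eq)
    have z: "norm z \<le> r" "inverse (norm z) \<le> r"
      using that r z0 by (auto simp: annulus_def field_simps)
    show ?thesis
      using z by (auto simp: power_int_def norm_power norm_inverse power_inverse[symmetric] intro!: power_mono)
  qed
  show "0 \<notin> annulus r" using r by (auto simp: annulus_def)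
  show "0 \<le> r ^ nat \<bar>m\<bar>" using r by simp
  show "r ^ nat \<bar>m + n\<bar> \<le> r ^ nat \<bar>m\<bar> * r ^ nat \<bar>n\<bar>"
    unfolding power_add[symmetric] using r by (intro power_increasing) auto
qed

text \<open>
The pole a lies off the closed annulus, so the geometric series in a/z (pole inside) or in z/a (pole outside)
still converges with the exponential weight.
\<close>
lemma inverse_linear_factor_annulus:
  assumes r: "1 < r" and a: "a \<notin> annulus r"
  shows "\<exists>B. laurent_norm_le (\<lambda>m. r ^ nat \<bar>m\<bar>) (annulus r) (\<lambda>z. inverse (z - a)) B"
proof -
  interpret laurent_weight "\<lambda>m. r ^ nat \<bar>m\<bar>" "annulus r" by (rule laurent_weight_annulus[OF r])
  consider "norm a * r < 1" | "norm a > r" using a r by (auto simp: annulus_def field_simps not_le)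
  then show ?thesis
  proof cases
    case 1
    define f where "f k z = a ^ k * z powi (- int (Suc k))" for k :: nat and z
    have b: "bounded_by (f k) (r * (norm a * r) ^ k)" for k
      using bounded_by_powi[of "a ^ k" "- int (Suc k)"]
      unfolding f_def by (rule bounded_by_mono) (auto simp: norm_power power_mult_distrib nat_add_distrib)
    have s: "summable (\<lambda>k. r * (norm a * r) ^ k)"
      using 1 r by (intro summable_mult summable_geometric) auto
    have "(\<Sum>k. f k z) = inverse (z - a)" if z: "z \<in> annulus r" for z
    proof -
      have z1: "norm z * r \<ge> 1" "z \<noteq> 0" using z r zero_notin by (auto simp: annulus_def field_simps)
      then have "norm a * r < norm z * r" using 1 by linarith
      then have "norm (a / z) < 1" using r z1 by (simp add: norm_divide)
      then have "(\<lambda>k. inverse z * (a / z) ^ k) sums (inverse z * (1 / (1 - a / z)))"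
        by (intro sums_mult geometric_sums)
      moreover have "inverse z * (a / z) ^ k = f k z" for k
        using z1 unfolding f_def power_int_minus power_int_of_nat by (simp add: power_mult_distrib divide_inverse power_inverse)
      moreover have "inverse z * (1 / (1 - a / z)) = inverse (z - a)"
        using z1 by (simp add: field_simps)
      ultimately show ?thesis by (simp add: sums_iff)
    qed
    then show ?thesis by (intro exI) (rule bounded_by_cong[OF bounded_by_suminf(1)[OF b s]])
  next
    case 2
    define f where "f k z = - (inverse a ^ Suc k) * z powi int k" for k :: nat and z
    have a0: "norm a > 0" using 2 r by linarith
    have b: "bounded_by (f k) (inverse (norm a) * (r / norm a) ^ k)" for k
      using bounded_by_powi[of "- (inverse a ^ Suc k)" "int k"]
      unfolding f_def by (rule bounded_by_mono)
        (auto simp: norm_power norm_mult norm_inverse power_mult_distrib divide_inverse power_inverse)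
    have s: "summable (\<lambda>k. inverse (norm a) * (r / norm a) ^ k)"
      using 2 r a0 by (intro summable_mult summable_geometric) auto
    have "(\<Sum>k. f k z) = inverse (z - a)" if z: "z \<in> annulus r" for z
    proof -
      have "norm z < norm a" using z 2 by (auto simp: annulus_def)
      then have "norm (z / a) < 1" "z \<noteq> a" using a0 by (auto simp: norm_divide)
      then have "(\<lambda>k. - inverse a * (z / a) ^ k) sums (- inverse a * (1 / (1 - z / a)))"
        by (intro sums_mult geometric_sums)
      moreover have "- inverse a * (z / a) ^ k = f k z" for k
        using a0 by (simp add: f_def power_divide field_simps)
      moreover have "- inverse a * (1 / (1 - z / a)) = inverse (z - a)"
      proof -
        have "a - z \<noteq> 0" "z - a \<noteq> 0" "a \<noteq> 0" using \<open>z \<noteq> a\<close> a0 by auto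
        then show ?thesis by (simp add: field_simps)
      qed
      ultimately show ?thesis by (simp add: sums_iff)
    qed
    then show ?thesis by (intro exI) (rule bounded_by_cong[OF bounded_by_suminf(1)[OF b s]])
  qed
qed

lemma inverse_poly_annulus:
  assumes r: "1 < r" and Q: "\<And>z. z \<in> annulus r \<Longrightarrow> poly Q z \<noteq> 0"
  shows "\<exists>B. laurent_norm_le (\<lambda>m. r ^ nat \<bar>m\<bar>) (annulus r) (\<lambda>z. inverse (poly Q z)) B"
proof -
  interpret laurent_weight "\<lambda>m. r ^ nat \<bar>m\<bar>" "annulus r" by (rule laurent_weight_annulus[OF r])
  obtain root where root: "smult (lead_coeff Q) (\<Prod>i<degree Q. [:-root i, 1:]) = Q"
    by (rule complex_poly_decompose')
  have Qz: "poly Q z = lead_coeff Q * (\<Prod>i<degree Q. z - root i)" for z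
    by (subst root[symmetric]) (simp add: poly_prod)
  have off: "root i \<notin> annulus r" if "i < degree Q" for i
    using Q[of "root i"] Qz[of "root i"] that by auto
  have "\<exists>B. bounded_by (\<lambda>z. \<Prod>i<n. inverse (z - root i)) B" if "n \<le> degree Q" for n
    using that
  proof (induction n)
    case 0 show ?case using bounded_by_const[of 1] by auto
  next
    case (Suc n)
    then obtain B C where "bounded_by (\<lambda>z. \<Prod>i<n. inverse (z - root i)) B"
      "bounded_by (\<lambda>z. inverse (z - root n)) C"
      using inverse_linear_factor_annulus[OF r off[of n]] by auto
    from bounded_by_mult[OF this] show ?case by auto
  qed
  then obtain B where B: "bounded_by (\<lambda>z. \<Prod>i<degree Q. inverse (z - root i)) B" by blast
  have "bounded_by (\<lambda>z. inverse (poly Q z)) (r ^ nat \<bar>0\<bar> * norm (inverse (lead_coeff Q)) * B)"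
    by (rule bounded_by_cong[OF bounded_by_cmult[OF B, of "inverse (lead_coeff Q)"]])
       (simp only: Qz inverse_mult_distrib prod_inversef [symmetric] o_def)
  then show ?thesis by blast
qed

lemma sum_roots_of_unity_power:
  fixes d :: int and N :: nat
  assumes d: "d \<noteq> 0" "\<bar>d\<bar> < int N"
  shows "(\<Sum>k<N. cis (2 * pi * of_int d * real k / real N)) = 0"
proof -
  have N: "N > 0" using d by auto
  define x where "x = cis (2 * pi * of_int d / real N)"
  have "x \<noteq> 1"
  proof
    assume "x = 1"
    then have "exp (\<i> * complex_of_real (2 * pi * of_int d / real N)) = 1" by (simp add: x_def cis_conv_exp)
    then obtain n :: int where "2 * pi * of_int d / real N = of_int (2 * n) * pi"
      by (auto simp: exp_eq_1)
    then have "real_of_int d = real_of_int (n * int N)" using N by (simp add: field_simps)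
    then have eq: "d = n * int N" by (simp only: of_int_eq_iff)
    then have "n \<noteq> 0" using d by auto
    then have "1 * int N \<le> \<bar>n\<bar> * int N" by (intro mult_right_mono) auto
    then show False using d eq by (simp add: abs_mult)
  qed
  have "cis (2 * pi * of_int d * real k / real N) = x ^ k" for k
    unfolding x_def Complex.DeMoivre by (simp add: field_simps)
  then have "(\<Sum>k<N. cis (2 * pi * of_int d * real k / real N)) = (\<Sum>k<N. x ^ k)" by simp
  also have "\<dots> = (x ^ N - 1) / (x - 1)" by (rule geometric_sum[OF \<open>x \<noteq> 1\<close>])
  also have "x ^ N = 1" unfolding x_def Complex.DeMoivre using N cis_multiple_2pi[of "of_int d"] by simp
  finally show ?thesis by simp
qed

text \<open>
Cauchy's estimate, with the contour integral replaced by the average over N-th roots of unity: on a finite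
part F of the series the average picks out the m-th coefficient as soon as N exceeds all distances |l - m|
with l in F, and the rest of the series is small.
\<close>
lemma laurent_coeff_bound:
  fixes c :: "int \<Rightarrow> complex"
  assumes s: "s > 0" and summ: "(\<lambda>m. norm (c m) * s powi m) summable_on UNIV"
    and M: "\<And>z. norm z = s \<Longrightarrow> norm (\<Sum>\<^sub>\<infinity>m. c m * z powi m) \<le> M"
  shows "norm (c m) * s powi m \<le> M"
proof (rule field_le_epsilon)
  fix e :: real assume e: "e > 0"
  define g where "g = (\<lambda>l. norm (c l) * s powi l)"
  have g0: "0 \<le> g l" for l using s by (simp add: g_def)
  obtain F0 where F0: "finite F0" "dist (sum g F0) (infsum g UNIV) \<le> e"
    using infsum_finite_approximation[of g UNIV e] summ e unfolding g_def by auto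
  define F where "F = insert m F0"
  have F: "finite F" "m \<in> F" using F0 by (auto simp: F_def)
  have gU: "g summable_on UNIV" using summ by (simp add: g_def)
  have gF: "g summable_on (UNIV - F)" by (rule summable_on_cofin_subset[OF gU F(1)])
  have "infsum g (UNIV - F) = infsum g UNIV - sum g F"
    using F gU by (subst infsum_Diff) auto
  moreover have "sum g F0 \<le> sum g F" by (rule sum_mono2) (use F g0 in \<open>auto simp: F_def\<close>)
  ultimately have tail: "infsum g (UNIV - F) \<le> e" using F0(2) by (auto simp: dist_real_def)
  define N where "N = nat (Max ((\<lambda>l. \<bar>l - m\<bar>) ` F)) + 1"
  have N: "\<bar>l - m\<bar> < int N" if "l \<in> F" for l
  proof -
    have "\<bar>l - m\<bar> \<le> Max ((\<lambda>l. \<bar>l - m\<bar>) ` F)" using that F by (intro Max_ge) auto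
    then show ?thesis unfolding N_def by linarith
  qed
  have N0: "N > 0" by (simp add: N_def)
  define w where "w k = of_real s * cis (2 * pi * real k / real N)" for k :: nat
  have nw: "norm (w k) = s" for k using s by (simp add: w_def norm_mult)
  have wp: "w k powi l = of_real (s powi l) * cis (2 * pi * of_int l * real k / real N)" for k l
    unfolding w_def by (simp add: power_int_mult_distrib cis_power_int of_real_power_int algebra_simps)
  have abs: "(\<lambda>l. norm (c l * w k powi l)) summable_on A" if "g summable_on A" for k A
    using that by (simp add: norm_mult norm_power_int nw g_def)
  have split: "(\<Sum>\<^sub>\<infinity>l. c l * w k powi l) = (\<Sum>l\<in>F. c l * w k powi l) + (\<Sum>\<^sub>\<infinity>l\<in>UNIV-F. c l * w k powi l)" for k
    using F abs_summable_summable[OF abs[OF gU, of k]] by (subst infsum_Diff) auto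
  have rest: "norm (\<Sum>\<^sub>\<infinity>l\<in>UNIV-F. c l * w k powi l) \<le> e" for k
  proof -
    have "norm (\<Sum>\<^sub>\<infinity>l\<in>UNIV-F. c l * w k powi l) \<le> (\<Sum>\<^sub>\<infinity>l\<in>UNIV-F. norm (c l * w k powi l))"
      by (rule norm_infsum_bound[OF abs[OF gF]])
    also have "\<dots> = infsum g (UNIV - F)" by (simp add: norm_mult norm_power_int nw g_def)
    finally show ?thesis using tail by linarith
  qed
  have head: "norm (\<Sum>l\<in>F. c l * w k powi l) \<le> M + e" for k
  proof -
    have "(\<Sum>l\<in>F. c l * w k powi l) = (\<Sum>\<^sub>\<infinity>l. c l * w k powi l) - (\<Sum>\<^sub>\<infinity>l\<in>UNIV-F. c l * w k powi l)"
      using split[of k] by simp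
    also have "norm \<dots> \<le> M + e" using M[OF nw, of k] rest[of k] norm_triangle_ineq4 by (smt (verit))
    finally show ?thesis .
  qed
  have "(\<Sum>k<N. cis (- (2 * pi * of_int m * real k / real N)) * (\<Sum>l\<in>F. c l * w k powi l))
      = (\<Sum>l\<in>F. c l * of_real (s powi l) * (\<Sum>k<N. cis (2 * pi * of_int (l - m) * real k / real N)))"
    unfolding sum_distrib_left
    by (subst sum.swap, intro sum.cong refl)
       (simp add: wp algebra_simps cis_mult diff_divide_distrib add_divide_distrib)
  also have "\<dots> = (\<Sum>l\<in>F. if l = m then c m * of_real (s powi m) * of_nat N else 0)"
  proof (intro sum.cong refl)
    fix l assume l: "l \<in> F"
    show "c l * of_real (s powi l) * (\<Sum>k<N. cis (2 * pi * of_int (l - m) * real k / real N)) =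
        (if l = m then c m * of_real (s powi m) * of_nat N else 0)"
    proof (cases "l = m")
      case False
      then show ?thesis using sum_roots_of_unity_power[of "l - m" N] N[OF l] by simp
    qed simp
  qed
  also have "\<dots> = c m * of_real (s powi m) * of_nat N" using F by simp
  finally have avg: "(\<Sum>k<N. cis (- (2 * pi * of_int m * real k / real N)) * (\<Sum>l\<in>F. c l * w k powi l))
      = c m * of_real (s powi m) * of_nat N" .
  have "norm (c m * of_real (s powi m) * of_nat N) \<le>
      (\<Sum>k<N. norm (cis (- (2 * pi * of_int m * real k / real N)) * (\<Sum>l\<in>F. c l * w k powi l)))"
    unfolding avg[symmetric] by (rule norm_sum)
  also have "\<dots> \<le> (\<Sum>k<N. M + e)" by (intro sum_mono) (simp add: norm_mult head)
  finally have "norm (c m) * s powi m * real N \<le> (M + e) * real N"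
    using s by (simp add: norm_mult norm_power_int mult.commute)
  then show "norm (c m) * s powi m \<le> M + e" using N0 by simp
qed

lemma summable_poly_geometric:
  fixes x :: real assumes x: "0 < x" "x < 1"
  shows "summable (\<lambda>n. (1 + real n) ^ j * x ^ n)"
proof -
  have "(\<lambda>n. ((real n + 2) / (real n + 1)) ^ j * x) \<longlonglongrightarrow> 1 ^ j * x"
  proof (intro tendsto_intros)
    have eq: "(real n + 2) / (real n + 1) = 1 + inverse (real (Suc n))" for n
      by (simp add: field_simps)
    show "(\<lambda>n. (real n + 2) / (real n + 1)) \<longlonglongrightarrow> 1"
      unfolding eq using tendsto_add[OF tendsto_const LIMSEQ_inverse_real_of_nat, of 1] by simp
  qed
  then have "eventually (\<lambda>n. ((real n + 2) / (real n + 1)) ^ j * x < (1 + x) / 2) sequentially"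
    using x by (intro order_tendstoD(2)) auto
  then obtain n0 where n0: "((real n + 2) / (real n + 1)) ^ j * x < (1 + x) / 2" if "n \<ge> n0" for n
    unfolding eventually_sequentially by blast
  show ?thesis
  proof (rule summable_ratio_test[of "(1 + x) / 2" n0])
    fix n assume "n \<ge> n0"
    have "(1 + real (Suc n)) ^ j * x ^ Suc n
        = ((real n + 2) / (real n + 1)) ^ j * x * ((1 + real n) ^ j * x ^ n)"
      by (simp add: power_divide add_ac)
    also have "\<dots> \<le> (1 + x) / 2 * ((1 + real n) ^ j * x ^ n)"
      using n0[OF \<open>n \<ge> n0\<close>] x by (intro mult_right_mono) auto
    finally show "norm ((1 + real (Suc n)) ^ j * x ^ Suc n) \<le> (1 + x) / 2 * norm ((1 + real n) ^ j * x ^ n)"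
      using x by (simp add: norm_mult norm_power)
  qed (use x in auto)
qed

lemma int_summable_on_if_halves:
  fixes f :: "int \<Rightarrow> real"
  assumes f: "\<And>m. 0 \<le> f m" and "summable (\<lambda>n. f (int n))" "summable (\<lambda>n. f (- int n))"
  shows "f summable_on UNIV"
proof -
  have "(f \<circ> int) summable_on UNIV" "(f \<circ> (\<lambda>n. - int n)) summable_on UNIV"
    using assms by (simp_all add: o_def summable_on_UNIV_nonneg_real_iff)
  then have "f summable_on range int" "f summable_on range (\<lambda>n. - int n)"
    by (simp_all add: summable_on_reindex inj_on_def)
  then have "f summable_on (range int \<union> range (\<lambda>n. - int n))" by (rule summable_on_union)
  moreover have "range int \<union> range (\<lambda>n. - int n) = UNIV"
    using int_cases2 by (auto simp: image_iff) metis
  ultimately show ?thesis by simp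
qed

text \<open>
The norm of 1/P in the algebra may be much larger than the bound 1/\<mu> for |1/P| on the circle, but the
norms of its powers grow at most like those of any number larger than 1/\<mu>. The reason is that 1/P is
analytic on an annulus around the circle on which |P| \<ge> \<nu> still holds if the annulus is thin; Cauchy's
estimates on its two boundary circles bound the coefficients of P^(-n) by \<nu>^(-n) r^(-|m|), which is
summable against any polynomial weight.
\<close>
lemma inverse_laurent_poly_power_bound:
  fixes c :: "int \<Rightarrow> complex" and M :: nat
  defines "P \<equiv> \<lambda>z. \<Sum>m\<in>{-int M..int M}. c m * z powi m"
  assumes P: "\<And>z. norm z = 1 \<Longrightarrow> norm (P z) \<ge> \<mu>" and nu: "0 < \<nu>" "\<nu> < \<mu>"
  shows "\<exists>C. \<forall>n. wiener_norm_le j (\<lambda>z. inverse (P z) ^ n) (C * inverse \<nu> ^ n)"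
proof -
  have contP: "continuous_on (annulus 2) P"
    unfolding P_def by (intro continuous_intros) (auto simp: annulus_def)
  have "closed (annulus 2)"
    unfolding annulus_def by (intro closed_Collect_conj closed_Collect_le continuous_intros)
  moreover have "bounded (annulus 2)" by (rule boundedI[of _ 2]) (auto simp: annulus_def)
  ultimately have "uniformly_continuous_on (annulus 2) P"
    using contP by (intro compact_uniformly_continuous) (auto simp: compact_eq_bounded_closed)
  then obtain d where d: "d > 0"
    "\<And>z z'. z \<in> annulus 2 \<Longrightarrow> z' \<in> annulus 2 \<Longrightarrow> dist z' z < d \<Longrightarrow> dist (P z') (P z) < \<mu> - \<nu>"
    unfolding uniformly_continuous_on_def using nu by (metis diff_gt_0_iff_gt)
  (* The radius is so close to 1 that radial projection to the circle moves points by less than d. *)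
  define r where "r = min 2 (1 + d / 2)"
  have r: "1 < r" "r \<le> 2" "r - 1 < d" using d(1) by (auto simp: r_def min_def)
  interpret E: laurent_weight "\<lambda>m. r ^ nat \<bar>m\<bar>" "annulus r" by (rule laurent_weight_annulus[OF r(1)])
  have Pge: "norm (P z) \<ge> \<nu>" if z: "z \<in> annulus r" for z
  proof -
    have z0: "z \<noteq> 0" using z E.zero_notin by auto
    have zz: "1 / r \<le> norm z" "norm z \<le> r" using z by (auto simp: annulus_def)
    define u where "u = z / of_real (norm z)"
    have u: "norm u = 1" using z0 by (simp add: u_def norm_divide)
    have "1 / 2 \<le> 1 / r" using r by (simp add: field_simps)
    with zz have "1 / 2 \<le> norm z" by linarith
    then have "z \<in> annulus 2" "u \<in> annulus 2" using zz r u by (auto simp: annulus_def)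
    moreover have "dist z u < d"
    proof -
      have "z - u = of_real (norm z - 1) * u" using z0 by (simp add: u_def field_simps)
      then have "dist z u = \<bar>norm z - 1\<bar>" by (simp add: dist_norm norm_mult u del: of_real_diff)
      also have "\<dots> \<le> r - 1"
      proof -
        have "(r - 1) * (r - 1) \<ge> 0" by simp
        then have "2 - r \<le> 1 / r" using r by (simp add: field_simps)
        then show ?thesis using zz by linarith
      qed
      finally show ?thesis using r by linarith
    qed
    ultimately have "dist (P z) (P u) < \<mu> - \<nu>" using d(2) by blast
    moreover have "norm (P u) \<le> norm (P z) + dist (P z) (P u)"
      by (metis dist_commute dist_norm norm_triangle_sub)
    ultimately show ?thesis using P[OF u] by linarith
  qed
  (* Q is z^M P, an ordinary polynomial, which can be factored. *)
  define Q where "Q = (\<Sum>i\<le>2*M. monom (c (int i - int M)) i)"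
  have QP: "poly Q z = z powi int M * P z" if "z \<noteq> 0" for z
  proof -
    have "P z = (\<Sum>i\<le>2*M. c (int i - int M) * z powi (int i - int M))"
      unfolding P_def
      by (rule sum.reindex_bij_witness[of _ "\<lambda>i. int i - int M" "\<lambda>m. nat (m + int M)"]) auto
    then show ?thesis
      by (simp add: Q_def poly_sum poly_monom sum_distrib_left)
         (intro sum.cong refl, use that in \<open>simp add: power_int_diff\<close>)
  qed
  have "poly Q z \<noteq> 0" if "z \<in> annulus r" for z
    using QP[of z] Pge[OF that] that E.zero_notin nu by (cases "z = 0") auto
  from inverse_poly_annulus[OF r(1) this] obtain B0 where B0: "E.bounded_by (\<lambda>z. inverse (poly Q z)) B0"
    by blast
  have "E.bounded_by (\<lambda>z. inverse (P z)) (r ^ nat \<bar>int M\<bar> * norm (1::complex) * B0)"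
  proof (rule E.bounded_by_cong[OF E.bounded_by_powi_mult[OF B0, of 1 "int M"]])
    fix z assume z: "z \<in> annulus r"
    then have "z \<noteq> 0" using E.zero_notin by auto
    then show "1 * z powi int M * inverse (poly Q z) = inverse (P z)" by (simp add: QP)
  qed
  then obtain B where B: "E.bounded_by (\<lambda>z. inverse (P z)) B" by blast
  have Bn: "\<exists>B'. E.bounded_by (\<lambda>z. inverse (P z) ^ n) B'" for n
  proof (induction n)
    case 0 show ?case using E.bounded_by_const[of 1] by auto
  next
    case (Suc n) then show ?case using E.bounded_by_mult[OF B] by auto
  qed
  define C where "C = (\<Sum>\<^sub>\<infinity>m. pweight j m * inverse r ^ nat \<bar>m\<bar>)"
  have Csum: "(\<lambda>m. pweight j m * inverse r ^ nat \<bar>m\<bar>) summable_on UNIV"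
    using r summable_poly_geometric[of "inverse r" j]
    by (intro int_summable_on_if_halves) (auto simp: pweight_def field_simps)
  have "wiener_norm_le j (\<lambda>z. inverse (P z) ^ n) (C * inverse \<nu> ^ n)" for n
  proof -
    obtain b where b: "(\<lambda>m. r ^ nat \<bar>m\<bar> * norm (b m)) summable_on UNIV"
      "\<And>z. z \<in> annulus r \<Longrightarrow> inverse (P z) ^ n = (\<Sum>\<^sub>\<infinity>m. b m * z powi m)"
      using Bn[of n] unfolding laurent_norm_le_def by blast
    have bs: "norm (b m) * s powi m \<le> inverse \<nu> ^ n" if s: "1 / r \<le> s" "s \<le> r" for s m
    proof (rule laurent_coeff_bound)
      have "1 / r > 0" using r by simp
      then show s0: "s > 0" using s by linarith
      then have "complex_of_real s \<in> annulus r" using s by (auto simp: annulus_def)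
      from E.abs_summable_laurent[OF b(1) this] show "(\<lambda>m. norm (b m) * s powi m) summable_on UNIV"
        using s0 by (simp add: norm_mult norm_power_int)
      fix z :: complex assume "norm z = s"
      then have z: "z \<in> annulus r" using s by (auto simp: annulus_def)
      show "norm (\<Sum>\<^sub>\<infinity>m. b m * z powi m) \<le> inverse \<nu> ^ n"
        unfolding b(2)[OF z, symmetric] norm_power norm_inverse
        using Pge[OF z] nu by (intro power_mono le_imp_inverse_le) auto
    qed
    have bm: "norm (b m) \<le> inverse \<nu> ^ n * inverse r ^ nat \<bar>m\<bar>" for m
    proof -
      have r1: "1 / r \<le> 1" using r by simp
      have "norm (b m) * r ^ nat \<bar>m\<bar> \<le> inverse \<nu> ^ n"
      proof (cases "m \<ge> 0")
        case True then show ?thesis using bs[of r m] r r1 by (simp add: power_int_def)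
      next
        case False
        then show ?thesis using bs[of "1 / r" m] r r1 by (simp add: power_int_def divide_inverse)
      qed
      then have "norm (b m) * r ^ nat \<bar>m\<bar> * inverse r ^ nat \<bar>m\<bar> \<le> inverse \<nu> ^ n * inverse r ^ nat \<bar>m\<bar>"
        using r by (intro mult_right_mono) auto
      then show ?thesis using r by (simp add: mult.assoc power_mult_distrib[symmetric])
    qed
    have le: "pweight j m * norm (b m) \<le> pweight j m * inverse r ^ nat \<bar>m\<bar> * inverse \<nu> ^ n" for m
      using mult_left_mono[OF bm wn.weight_nonneg] by (simp add: algebra_simps)
    have S: "(\<lambda>m. pweight j m * inverse r ^ nat \<bar>m\<bar> * inverse \<nu> ^ n) summable_on UNIV"
      by (rule summable_on_cmult_left[OF Csum])
    have bsum: "(\<lambda>m. pweight j m * norm (b m)) summable_on UNIV"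
      by (rule summable_on_comparison_test[OF S le]) (simp add: wn.weight_nonneg)
    have "(\<Sum>\<^sub>\<infinity>m. pweight j m * norm (b m)) \<le> C * inverse \<nu> ^ n"
      using infsum_mono[OF bsum S le] by (simp add: infsum_cmult_left' C_def)
    moreover have "sphere 0 1 \<subseteq> annulus r" using r by (auto simp: annulus_def)
    ultimately show ?thesis using bsum b(2) unfolding laurent_norm_le_def by blast
  qed
  then show ?thesis by blast
qed

lemma laurent_poly_approx:
  assumes f: "weighted_wiener j f" and e: "e > 0"
  obtains M :: nat and c :: "int \<Rightarrow> complex" where
    "wiener_norm_le j (\<lambda>z. f z - (\<Sum>m\<in>{-int M..int M}. c m * z powi m)) e"
proof -
  obtain c where c: "(\<lambda>m. pweight j m * norm (c m)) summable_on UNIV"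
    "\<And>z. z \<in> sphere 0 1 \<Longrightarrow> f z = (\<Sum>\<^sub>\<infinity>m. c m * z powi m)"
    using f unfolding weighted_wiener_def laurent_norm_le_def by blast
  define g where "g = (\<lambda>m. pweight j m * norm (c m))"
  have g0: "0 \<le> g m" for m by (simp add: g_def wn.weight_nonneg)
  have gU: "g summable_on UNIV" using c by (simp add: g_def)
  obtain F where F: "finite F" "dist (sum g F) (infsum g UNIV) \<le> e"
    using infsum_finite_approximation[OF gU e] by auto
  define M where "M = nat (Max (insert 0 (abs ` F)))"
  have FM: "F \<subseteq> {-int M..int M}"
  proof
    fix m assume "m \<in> F"
    then have "\<bar>m\<bar> \<le> Max (insert 0 (abs ` F))" using F(1) by (intro Max_ge) auto
    then show "m \<in> {-int M..int M}" by (auto simp: M_def)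
  qed
  let ?J = "UNIV - {-int M..int M}"
  have gJ: "g summable_on ?J" by (rule summable_on_cofin_subset[OF gU]) simp
  have "sum g F \<le> sum g {-int M..int M}" by (rule sum_mono2) (use FM g0 in auto)
  moreover have "infsum g ?J = infsum g UNIV - sum g {-int M..int M}"
    using gU by (subst infsum_Diff) auto
  ultimately have le: "infsum g ?J \<le> e" using F(2) by (auto simp: dist_real_def)
  have b: "wiener_norm_le j (\<lambda>z. \<Sum>\<^sub>\<infinity>m\<in>?J. c m * z powi m) (infsum g ?J)"
    by (rule wn.bounded_by_series[OF _ gJ]) (simp add: g_def wn.bounded_by_powi)
  have "wiener_norm_le j (\<lambda>z. f z - (\<Sum>m\<in>{-int M..int M}. c m * z powi m)) (infsum g ?J)"
  proof (rule wn.bounded_by_cong[OF b])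
    fix z :: complex assume z: "z \<in> sphere 0 1"
    have "(\<lambda>m. c m * z powi m) summable_on UNIV"
      by (rule abs_summable_summable[OF wn.abs_summable_laurent[OF c(1) z]])
    then show "(\<Sum>\<^sub>\<infinity>m\<in>?J. c m * z powi m) = f z - (\<Sum>m\<in>{-int M..int M}. c m * z powi m)"
      unfolding c(2)[OF z] by (subst infsum_Diff) auto
  qed
  from wn.bounded_by_mono[OF this le] show thesis by (rule that)
qed

lemma weighted_wiener_continuous:
  assumes f: "weighted_wiener j f" shows "continuous_on (sphere 0 1) f"
proof -
  define P where "P = (\<lambda>(M::nat, c) z::complex. \<Sum>m\<in>{-int M..int M}. c m * z powi m)"
  have "\<exists>p. wiener_norm_le j (\<lambda>z. f z - P p z) (inverse (real (Suc n)))" for n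
  proof -
    have "inverse (real (Suc n)) > 0" by simp
    from laurent_poly_approx[OF f this] obtain M c where
      "wiener_norm_le j (\<lambda>z. f z - (\<Sum>m\<in>{-int M..int M}. c m * z powi m)) (inverse (real (Suc n)))" .
    then show ?thesis by (intro exI[of _ "(M, c)"]) (simp add: P_def)
  qed
  then obtain p where p: "\<And>n. wiener_norm_le j (\<lambda>z. f z - P (p n) z) (inverse (real (Suc n)))"
    by metis
  show ?thesis
  proof (rule uniform_limit_theorem)
  show "\<forall>\<^sub>F n in sequentially. continuous_on (sphere 0 1) (P (p n))"
    unfolding P_def by (intro always_eventually allI) (auto split: prod.split intro!: continuous_intros)
  show "uniform_limit (sphere 0 1) (\<lambda>n. P (p n)) f sequentially"
  proof (rule uniform_limitI)
    fix e :: real assume "e > 0"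
    have "eventually (\<lambda>n. inverse (real (Suc n)) < e) sequentially"
      using LIMSEQ_inverse_real_of_nat \<open>e > 0\<close> by (rule order_tendstoD)
    then show "\<forall>\<^sub>F n in sequentially. \<forall>z\<in>sphere 0 1. dist (P (p n) z) (f z) < e"
    proof eventually_elim
      case (elim n)
      then show ?case using wn.norm_le_bound[OF p[of n]] by (fastforce simp: dist_norm norm_minus_commute)
    qed
  qed
qed simp
qed

text \<open>
Newman's proof. With a Laurent polynomial P that is \<mu>/4-close to f in norm, where \<mu> is the minimum of
|f|, the geometric series for 1/f = 1/(P - R) has terms R^n / P^(n+1). The factor R^n is at most (\<mu>/4)^n
in norm, and the norm of 1/P^(n+1) is at most a multiple of (2/\<mu>)^(n+1) by
inverse_laurent_poly_power_bound, because |P| is at least 3\<mu>/4 on the circle.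
\<close>
theorem weighted_wiener_inverse:
  assumes f: "weighted_wiener j f" and nz: "\<And>z. z \<in> sphere 0 1 \<Longrightarrow> f z \<noteq> 0"
  shows "weighted_wiener j (\<lambda>z. inverse (f z))"
proof -
  have "continuous_on (sphere 0 1) (\<lambda>z. norm (f z))"
    using weighted_wiener_continuous[OF f] by (intro continuous_intros)
  from continuous_attains_inf[OF _ _ this] obtain z0 where z0: "z0 \<in> sphere 0 1"
    "\<And>z. z \<in> sphere 0 1 \<Longrightarrow> norm (f z0) \<le> norm (f z)" by auto
  define \<mu> where "\<mu> = norm (f z0)"
  have mu: "\<mu> > 0" using nz[OF z0(1)] by (simp add: \<mu>_def)
  have "\<mu> / 4 > 0" using mu by simp
  from laurent_poly_approx[OF f this] obtain M c where b: "wiener_norm_le j (\<lambda>z. f z - (\<Sum>m\<in>{-int M..int M}. c m * z powi m)) (\<mu> / 4)" .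
  define P where "P = (\<lambda>z. \<Sum>m\<in>{-int M..int M}. c m * z powi m)"
  define R where "R z = P z - f z" for z
  have bR: "wiener_norm_le j R (\<mu> / 4)"
    using wn.bounded_by_cong[OF wn.bounded_by_cmult[OF b, of "-1"]] by (simp add: R_def P_def)
  have R: "norm (R z) \<le> \<mu> / 4" if "z \<in> sphere 0 1" for z by (rule wn.norm_le_bound[OF bR that])
  have P: "norm (P z) \<ge> 3 * \<mu> / 4" if z: "norm z = 1" for z
  proof -
    have "norm (P z - R z) \<le> norm (P z) + norm (R z)" by (rule norm_triangle_ineq4)
    then have "norm (f z) \<le> norm (P z) + norm (R z)" by (simp add: R_def)
    then show ?thesis using R[of z] z0(2)[of z] z unfolding \<mu>_def by auto
  qed
  obtain C where C: "\<And>n. wiener_norm_le j (\<lambda>z. inverse (P z) ^ n) (C * inverse (\<mu> / 2) ^ n)"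
    using inverse_laurent_poly_power_bound[of "3 * \<mu> / 4" c M "\<mu> / 2" j] P mu unfolding P_def by auto
  have bRn: "wiener_norm_le j (\<lambda>z. R z ^ n) ((\<mu> / 4) ^ n)" for n
  proof (induction n)
    case 0 show ?case using wn.bounded_by_const[of j 1] by simp
  next
    case (Suc n) then show ?case using wn.bounded_by_mult[OF bR] by simp
  qed
  have scal: "(\<mu> / 4) ^ n * (C * inverse (\<mu> / 2) ^ Suc n) = C * inverse (\<mu> / 2) * (1 / 2) ^ n" for n
  proof -
    have "\<mu> / 4 * inverse (\<mu> / 2) = 1 / 2" using mu by (simp add: field_simps)
    then have "(\<mu> / 4) ^ n * inverse (\<mu> / 2) ^ n = (1 / 2) ^ n" by (metis power_mult_distrib)
    then show ?thesis by (simp add: mult.assoc mult.left_commute)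
  qed
  have bt: "wiener_norm_le j (\<lambda>z. R z ^ n * inverse (P z) ^ Suc n) (C * inverse (\<mu> / 2) * (1 / 2) ^ n)" for n
    by (rule wn.bounded_by_mono[OF wn.bounded_by_mult[OF bRn C]]) (simp only: scal order_refl)
  have s: "summable (\<lambda>n. C * inverse (\<mu> / 2) * (1 / 2) ^ n)"
    by (intro summable_mult summable_geometric) simp
  have "(\<Sum>n. R z ^ n * inverse (P z) ^ Suc n) = inverse (f z)" if z: "z \<in> sphere 0 1" for z
  proof -
    have Pz: "norm (P z) \<ge> 3 * \<mu> / 4" "P z \<noteq> 0" using P[of z] z mu by auto
    have "norm (R z) < norm (P z)" using R[OF z] Pz mu by linarith
    then have "norm (R z / P z) < 1" using Pz by (simp add: norm_divide)
    then have "(\<lambda>n. inverse (P z) * (R z / P z) ^ n) sums (inverse (P z) * (1 / (1 - R z / P z)))"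
      by (intro sums_mult geometric_sums)
    moreover have "inverse (P z) * (1 / (1 - R z / P z)) = inverse (f z)"
      using Pz nz[OF z] unfolding R_def by (simp add: field_simps)
    moreover have "inverse (P z) * (R z / P z) ^ n = R z ^ n * inverse (P z) ^ Suc n" for n
      by (simp add: power_divide divide_inverse power_inverse power_mult_distrib)
    ultimately show ?thesis by (simp add: sums_iff)
  qed
  then show ?thesis unfolding weighted_wiener_def
    by (intro exI) (rule wn.bounded_by_cong[OF wn.bounded_by_suminf(1)[OF bt s]])
qed

section \<open>Derivatives along the unit circle\<close>

lemma weighted_wiener_cong:
  "weighted_wiener j f \<Longrightarrow> (\<And>z. z \<in> sphere 0 1 \<Longrightarrow> f z = g z) \<Longrightarrow> weighted_wiener j g"
  unfolding weighted_wiener_def using wn.bounded_by_cong by blast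

lemma weighted_wiener_imp_wiener_algebra:
  assumes "weighted_wiener j f" shows "f \<in> wiener_algebra"
proof -
  obtain c where c: "(\<lambda>m. pweight j m * norm (c m)) summable_on UNIV"
    "\<And>z. z \<in> sphere 0 1 \<Longrightarrow> f z = (\<Sum>\<^sub>\<infinity>m. c m * z powi m)"
    using assms unfolding weighted_wiener_def laurent_norm_le_def by blast
  have "(\<lambda>m. norm (c m)) summable_on UNIV"
    using wn.abs_summable_laurent[OF c(1), of 1] by simp
  with c(2) show ?thesis unfolding wiener_algebra_def by blast
qed

text \<open>
One power of the weight pays for the factor m of termwise differentiation. The factor \<i> z in front of F is
the derivative of \<theta> \<mapsto> exp(\<i>\<theta>), so that F is the derivative with respect to z.
\<close>
lemma weighted_wiener_circle_derivative:
  assumes "weighted_wiener (Suc j) f"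
  obtains F where "weighted_wiener j F"
    and "\<And>t. ((\<lambda>t. f (cis t)) has_vector_derivative (\<i> * cis t * F (cis t))) (at t)"
proof -
  obtain c where c: "(\<lambda>m. pweight (Suc j) m * norm (c m)) summable_on UNIV"
    "\<And>z. z \<in> sphere 0 1 \<Longrightarrow> f z = (\<Sum>\<^sub>\<infinity>m. c m * z powi m)"
    using assms unfolding weighted_wiener_def laurent_norm_le_def by blast
  define F where "F z = (\<Sum>\<^sub>\<infinity>m. of_int m * c m * z powi (m - 1))" for z
  have S: "(\<lambda>m. pweight j (- 1) * (pweight (Suc j) m * norm (c m))) summable_on UNIV"
    by (rule summable_on_cmult_right[OF c(1)])
  have le: "pweight j (m - 1) * norm (of_int m * c m) \<le> pweight j (- 1) * (pweight (Suc j) m * norm (c m))" for m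
  proof -
    have "pweight j (m - 1) \<le> pweight j (-1) * pweight j m"
      using wn.weight_add[of j "-1" m] by simp
    moreover have "norm (of_int m :: complex) \<le> 1 + \<bar>real_of_int m\<bar>" by simp
    ultimately have "pweight j (m - 1) * norm (of_int m :: complex) \<le> pweight j (-1) * pweight j m * (1 + \<bar>real_of_int m\<bar>)"
      by (intro mult_mono) (auto simp: wn.weight_nonneg)
    then have "pweight j (m - 1) * norm (of_int m :: complex) * norm (c m) \<le> pweight j (-1) * pweight j m * (1 + \<bar>real_of_int m\<bar>) * norm (c m)"
      by (rule mult_right_mono) simp
    then show ?thesis by (simp add: pweight_def norm_mult mult_ac)
  qed
  have bt: "wiener_norm_le j (\<lambda>z. of_int m * c m * z powi (m - 1)) (pweight j (- 1) * (pweight (Suc j) m * norm (c m)))" for m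
    by (rule wn.bounded_by_mono[OF wn.bounded_by_powi le])
  have FW: "weighted_wiener j F"
    unfolding weighted_wiener_def F_def using wn.bounded_by_series[OF bt S] by blast
  (* Theorems on termwise differentiation are about sequences, hence an enumeration of the integers. *)
  define e where "e = int_decode"
  have bij: "bij_betw e UNIV UNIV" unfolding e_def by (rule bij_int_decode)
  define g where "g n t = c (e n) * cis (of_int (e n) * t)" for n t
  define g' where "g' n t = \<i> * of_int (e n) * c (e n) * cis (of_int (e n) * t)" for n t
  have fsum: "(\<lambda>n. g n t) sums f (cis t)" for t
  proof -
    have "((\<lambda>m. c m * cis t powi m) has_sum f (cis t)) UNIV"
      unfolding c(2)[of "cis t", simplified]
      by (rule has_sum_infsum, rule abs_summable_summable, rule wn.abs_summable_laurent[OF c(1)]) simp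
    then have "((\<lambda>n. c (e n) * cis t powi e n) has_sum f (cis t)) UNIV"
      by (subst has_sum_reindex_bij_betw[OF bij, where f = "\<lambda>m. c m * cis t powi m"])
    then show ?thesis unfolding g_def by (simp add: has_sum_imp_sums cis_power_int)
  qed
  have g'sum: "(\<lambda>n. g' n t) sums (\<i> * cis t * F (cis t))" for t
  proof -
    have "((\<lambda>m. of_int m * c m * cis t powi (m - 1)) has_sum F (cis t)) UNIV"
      unfolding F_def by (rule has_sum_infsum, rule abs_summable_summable, rule wn.bounded_by_summable[OF bt S]) simp
    then have "((\<lambda>m. \<i> * cis t * (of_int m * c m * cis t powi (m - 1))) has_sum (\<i> * cis t * F (cis t))) UNIV"
      by (rule has_sum_cmult_right)
    then have "((\<lambda>n. \<i> * cis t * (of_int (e n) * c (e n) * cis t powi (e n - 1))) has_sum (\<i> * cis t * F (cis t))) UNIV"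
      by (subst has_sum_reindex_bij_betw[OF bij, where f = "\<lambda>m. \<i> * cis t * (of_int m * c m * cis t powi (m - 1))"])
    moreover have "\<i> * cis t * (of_int (e n) * c (e n) * cis t powi (e n - 1)) = g' n t" for n
    proof -
      have "cis t * cis t powi (e n - 1) = cis (of_int (e n) * t)"
        by (simp add: cis_power_int cis_mult algebra_simps)
      then show ?thesis unfolding g'_def by (metis mult.assoc mult.commute)
    qed
    ultimately show ?thesis by (simp add: has_sum_imp_sums)
  qed
  have mtest: "summable (\<lambda>n. pweight j (- 1) * (pweight (Suc j) (e n) * norm (c (e n))))"
  proof -
    have "(\<lambda>n. pweight j (- 1) * (pweight (Suc j) (e n) * norm (c (e n)))) summable_on UNIV"
      using S by (subst summable_on_reindex_bij_betw[OF bij, where f = "\<lambda>m. pweight j (- 1) * (pweight (Suc j) m * norm (c m))"])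
    then show ?thesis by (rule summable_on_imp_summable)
  qed
  have ul: "uniform_limit UNIV (\<lambda>n t. \<Sum>i<n. g' i t) (\<lambda>t. \<Sum>i. g' i t) sequentially"
  proof (rule Weierstrass_m_test[OF _ mtest])
    fix n t
    have "norm (g' n t) = norm (of_int (e n) * c (e n) * cis t powi (e n - 1))"
      by (simp add: g'_def norm_mult norm_power_int)
    also have "\<dots> \<le> pweight j (- 1) * (pweight (Suc j) (e n) * norm (c (e n)))"
      by (rule wn.norm_le_bound[OF bt]) simp
    finally show "norm (g' n t) \<le> pweight j (- 1) * (pweight (Suc j) (e n) * norm (c (e n)))" .
  qed
  have "((\<lambda>t. f (cis t)) has_vector_derivative (\<i> * cis t * F (cis t))) (at t)" for t
  proof -
    have "\<exists>G. \<forall>x\<in>UNIV. (\<lambda>n. g n x) sums G x \<and> (G has_derivative (\<lambda>h. h *\<^sub>R (\<i> * cis x * F (cis x)))) (at x within UNIV)"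
    proof (rule has_derivative_series[where f' = "\<lambda>n x h. h *\<^sub>R g' n x" and x = 0])
      show "(g n has_derivative (\<lambda>h. h *\<^sub>R g' n x)) (at x within UNIV)" for n x
        unfolding g_def g'_def
        by (auto intro!: derivative_eq_intros simp: scaleR_conv_of_real algebra_simps)
      fix \<epsilon> :: real assume "\<epsilon> > 0"
      with ul have "\<forall>\<^sub>F n in sequentially. \<forall>x\<in>UNIV. dist (\<Sum>i<n. g' i x) (\<Sum>i. g' i x) < \<epsilon>"
        by (rule uniform_limitD)
      then show "\<forall>\<^sub>F n in sequentially. \<forall>x\<in>UNIV. \<forall>h. norm ((\<Sum>i<n. h *\<^sub>R g' i x) - h *\<^sub>R (\<i> * cis x * F (cis x))) \<le> \<epsilon> * norm h"
      proof eventually_elim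
        case (elim n)
        show ?case
        proof (intro ballI allI)
          fix x h :: real
          have "(\<Sum>i. g' i x) = \<i> * cis x * F (cis x)" using g'sum[of x] by (simp add: sums_iff)
          then have "norm ((\<Sum>i<n. g' i x) - \<i> * cis x * F (cis x)) \<le> \<epsilon>"
            using elim[rule_format, of x] by (simp add: dist_norm)
          then have "\<bar>h\<bar> * norm ((\<Sum>i<n. g' i x) - \<i> * cis x * F (cis x)) \<le> \<bar>h\<bar> * \<epsilon>" by (rule mult_left_mono) simp
          then show "norm ((\<Sum>i<n. h *\<^sub>R g' i x) - h *\<^sub>R (\<i> * cis x * F (cis x))) \<le> \<epsilon> * norm h"
            by (simp add: scaleR_sum_right[symmetric] scaleR_diff_right[symmetric] mult.commute)
        qed
      qed
    qed (use fsum[of 0] in auto)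
    then obtain G where G: "\<And>x. (\<lambda>n. g n x) sums G x" "\<And>x. (G has_derivative (\<lambda>h. h *\<^sub>R (\<i> * cis x * F (cis x)))) (at x)"
      by auto
    have "G = (\<lambda>t. f (cis t))" using sums_unique2[OF G(1) fsum] by auto
    with G(2)[of t] show ?thesis by (simp add: has_vector_derivative_def)
  qed
  with FW show thesis by (rule that)
qed

lemma weighted_wiener_circle_deriv:
  assumes "weighted_wiener (Suc j) f"
  shows "circle_differentiable f" "weighted_wiener j (circle_deriv f)"
proof -
  obtain F where F: "weighted_wiener j F"
    "\<And>t. ((\<lambda>t. f (cis t)) has_vector_derivative (\<i> * cis t * F (cis t))) (at t)"
    using weighted_wiener_circle_derivative[OF assms] by blast
  show "circle_differentiable f" unfolding circle_differentiable_def
    using F(2) differentiableI_vector by blast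
  have "F z = circle_deriv f z" if z: "z \<in> sphere 0 1" for z
  proof -
    have "z \<noteq> 0" "sgn z = z" using z by (auto simp: sgn_div_norm)
    then have "cis (Arg z) = z" by (simp add: cis_Arg)
    moreover have "- \<i> * cis (- Arg z) * (\<i> * cis (Arg z) * F (cis (Arg z))) = F (cis (Arg z))"
      using cis_mult[of "- Arg z" "Arg z"] by (simp add: algebra_simps)
    ultimately show ?thesis unfolding circle_deriv_def vector_derivative_at[OF F(2)] by simp
  qed
  with F(1) show "weighted_wiener j (circle_deriv f)" by (rule weighted_wiener_cong)
qed

lemma weighted_wiener_derivatives:
  assumes f: "weighted_wiener j f"
  shows "continuous_on (sphere 0 1) f \<and>
         (\<forall>l<j. circle_differentiable ((circle_deriv ^^ l) f)) \<and>
         (\<forall>l\<le>j. (circle_deriv ^^ l) f \<in> wiener_algebra)"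
proof -
  have *: "weighted_wiener (j - l) ((circle_deriv ^^ l) f)" if "l \<le> j" for l
    using that
  proof (induction l)
    case (Suc l)
    then have "j - l = Suc (j - Suc l)" by simp
    with Suc weighted_wiener_circle_deriv(2)[of "j - Suc l" "(circle_deriv ^^ l) f"] show ?case by simp
  qed (use f in simp)
  have "circle_differentiable ((circle_deriv ^^ l) f)" if "l < j" for l
    using *[of l] that weighted_wiener_circle_deriv(1)[of "j - Suc l" "(circle_deriv ^^ l) f"]
    by (simp add: Suc_diff_Suc)
  then show ?thesis
    using weighted_wiener_continuous[OF f] * weighted_wiener_imp_wiener_algebra by blast
qed

section \<open>The Volterra equation on a half line\<close>

lemma suminf_tail_tendsto_0:
  fixes f :: "nat \<Rightarrow> 'a::real_normed_vector" assumes "summable f"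
  shows "(\<lambda>n. \<Sum>k. f (k + n)) \<longlonglongrightarrow> 0"
proof -
  have "(\<lambda>n. suminf f - (\<Sum>i<n. f i)) \<longlonglongrightarrow> suminf f - suminf f"
    by (intro tendsto_diff tendsto_const summable_LIMSEQ assms)
  then show ?thesis by (simp add: suminf_minus_initial_segment[OF assms])
qed

lemma suminf_tail_le:
  fixes f :: "nat \<Rightarrow> real" assumes "summable f" "\<And>n. 0 \<le> f n"
  shows "(\<Sum>k. f (k + n)) \<le> suminf f"
  unfolding suminf_minus_initial_segment[OF assms(1)] using assms(2) by (simp add: sum_nonneg)

text \<open>
Summing the tails of v counts the term v m exactly m + 1 times.
\<close>
lemma summable_tails:
  fixes v :: "nat \<Rightarrow> real"
  assumes v: "\<And>m. 0 \<le> v m" and s: "summable (\<lambda>m. (real m + 1) * v m)"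
  shows "summable v" "summable (\<lambda>n. \<Sum>k. v (k + n))"
proof -
  show sv: "summable v"
  proof (rule summable_comparison_test'[OF s, of 0])
    show "norm (v n) \<le> (real n + 1) * v n" for n
      using mult_right_mono[of 1 "real n + 1" "v n"] v[of n] by simp
  qed
  define g where "g = (\<lambda>n m. if n \<le> m then v m else 0)"
  have sg: "summable (g n)" for n
    by (rule summable_comparison_test'[OF sv, of 0]) (use v in \<open>auto simp: g_def\<close>)
  have tail: "(\<Sum>k. v (k + n)) = suminf (g n)" for n
    using suminf_minus_initial_segment[OF sg, of n n] by (simp add: g_def)
  show "summable (\<lambda>n. \<Sum>k. v (k + n))"
  proof (rule summableI_nonneg_bounded)
    show "0 \<le> (\<Sum>k. v (k + n))" for n
      unfolding tail by (rule suminf_nonneg[OF sg]) (use v in \<open>auto simp: g_def\<close>)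
    fix N
    have "(\<Sum>n<N. \<Sum>k. v (k + n)) = (\<Sum>m. \<Sum>n<N. g n m)"
      unfolding tail by (rule suminf_sum[symmetric]) (rule sg)
    also have "\<dots> \<le> (\<Sum>m. (real m + 1) * v m)"
    proof (rule suminf_le[OF _ _ s])
      show "summable (\<lambda>m. \<Sum>n<N. g n m)" by (rule summable_sum) (rule sg)
      fix m
      have "(\<Sum>n<N. g n m) = (\<Sum>n\<in>{..<N} \<inter> {..m}. v m)"
        unfolding g_def by (rule sum.mono_neutral_cong_right) auto
      also have "\<dots> = real (card ({..<N} \<inter> {..m})) * v m" by simp
      also have "\<dots> \<le> (real m + 1) * v m"
      proof (rule mult_right_mono[OF _ v])
        have "card ({..<N} \<inter> {..m}) \<le> card {..m}" by (rule card_mono) auto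
        then show "real (card ({..<N} \<inter> {..m})) \<le> real m + 1" by simp
      qed
      finally show "(\<Sum>n<N. g n m) \<le> (real m + 1) * v m" .
    qed
    finally show "(\<Sum>n<N. \<Sum>k. v (k + n)) \<le> (\<Sum>m. (real m + 1) * v m)" .
  qed
qed

lemma wiener_norm_le_power_mult:
  assumes "wiener_norm_le j f B"
  shows "wiener_norm_le j (\<lambda>z. z ^ k * f z) ((1 + real k) ^ j * B)"
  using wn.bounded_by_powi_mult[OF assms, of 1 "int k"] by (simp add: pweight_def power_int_of_nat)

text \<open>
With \<alpha> n = 2 a(N+n) - 1, \<beta> n = b(N+n+1) and u(N+n) = z^(N+n) h_n, the Jacobi equation at the site
N+n+1 reads

  h_n - h_(n+1) = z^2 (h_(n+1) - h_(n+2)) - source_n,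

where the source collects everything that vanishes for the free operator a = 1/2, b = 0. Solving this first
for the differences, which vanish at infinity, and then summing them with h_n \<rightarrow> 1 gives the
Volterra equation

  h_n = 1 - \<Sum>_k (1 + z^2 + ... + z^(2k)) source_(n+k).

The term with h_n itself on the right-hand side is harmless because the equation is solved by contraction.
\<close>
definition volterra_source ::
  "(nat \<Rightarrow> real) \<Rightarrow> (nat \<Rightarrow> real) \<Rightarrow> (nat \<Rightarrow> complex \<Rightarrow> complex) \<Rightarrow> nat \<Rightarrow> complex \<Rightarrow> complex" where
  "volterra_source \<alpha> \<beta> f n z =
     of_real (\<alpha> n) * f n z + 2 * of_real (\<beta> n) * z * f (Suc n) z
       + of_real (\<alpha> (Suc n)) * z ^ 2 * f (Suc (Suc n)) z"

definition perturbation :: "(nat \<Rightarrow> real) \<Rightarrow> (nat \<Rightarrow> real) \<Rightarrow> nat \<Rightarrow> real" where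
  "perturbation \<alpha> \<beta> n = \<bar>\<alpha> n\<bar> + 2 * \<bar>\<beta> n\<bar> + \<bar>\<alpha> (Suc n)\<bar>"

text \<open>
The factors are the ones that occur in the estimates below: 3^j is the norm of the largest power z^2 in the
source, and 1 + 2n bounds the weight of the powers of z in the kernel and in the differences h_n - h_(n+1).
\<close>
definition weighted_perturbation :: "nat \<Rightarrow> (nat \<Rightarrow> real) \<Rightarrow> (nat \<Rightarrow> real) \<Rightarrow> nat \<Rightarrow> real" where
  "weighted_perturbation j \<alpha> \<beta> n = (1 + 2 * real n) ^ j * (3 ^ j * perturbation \<alpha> \<beta> n)"

text \<open>
The bound 1/2 makes the Volterra operator a contraction; it is reached by starting the half line far enough to
the right.
\<close>
locale half_line =
  fixes \<alpha> \<beta> :: "nat \<Rightarrow> real" and j :: nat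
  assumes moment: "summable (\<lambda>n. (real n + 1) * weighted_perturbation j \<alpha> \<beta> n)"
    and small: "(\<Sum>n. (real n + 1) * weighted_perturbation j \<alpha> \<beta> n) \<le> 1 / 2"
begin

abbreviation \<kappa> where "\<kappa> \<equiv> perturbation \<alpha> \<beta>"

abbreviation v where "v \<equiv> weighted_perturbation j \<alpha> \<beta>"

abbreviation source where "source \<equiv> volterra_source \<alpha> \<beta>"

text \<open>
W (n + k) bounds the norm of the k-th term of the Volterra operator at n, and its tails bound the operator.
\<close>
definition W where "W n = (real n + 1) * v n" for n

lemma kappa_nonneg: "0 \<le> \<kappa> n" by (simp add: perturbation_def)
lemma v_nonneg: "0 \<le> v n" by (simp add: weighted_perturbation_def kappa_nonneg)
lemma W_nonneg: "0 \<le> W n" by (simp add: W_def v_nonneg)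
lemma W_summable: "summable W" using moment unfolding W_def .

definition tail where "tail n = (\<Sum>k. W (k + n))" for n

lemma tail_le_half: "tail n \<le> 1 / 2"
  using suminf_tail_le[OF W_summable W_nonneg, of n] small unfolding tail_def W_def by linarith

lemma source_bound:
  assumes f: "\<And>n. wiener_norm_le j (f n) b"
  shows "wiener_norm_le j (source f n) (3 ^ j * \<kappa> n * b)"
proof -
  have b: "0 \<le> b" by (rule wn.bounded_by_nonneg[OF f])
  have "wiener_norm_le j (\<lambda>z. of_real (\<alpha> n) * f n z) (3 ^ j * \<bar>\<alpha> n\<bar> * b)"
    by (rule wn.bounded_by_mono[OF wn.bounded_by_cmult[OF f]])
       (use b in \<open>simp add: mult_right_mono mult_left_le_one_le mult_le_cancel_right1\<close>)
  moreover have "wiener_norm_le j (\<lambda>z. 2 * of_real (\<beta> n) * (z ^ 1 * f (Suc n) z)) (3 ^ j * (2 * \<bar>\<beta> n\<bar>) * b)"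
  proof (rule wn.bounded_by_mono[OF wn.bounded_by_cmult[OF wiener_norm_le_power_mult[OF f]]])
    have "(2::real) ^ j \<le> 3 ^ j" by (rule power_mono) auto
    then have "(2::real) ^ j * (\<bar>\<beta> n\<bar> * b) \<le> 3 ^ j * (\<bar>\<beta> n\<bar> * b)" using b by (intro mult_right_mono) auto
    then show "pweight j 0 * norm (2 * complex_of_real (\<beta> n)) * ((1 + real 1) ^ j * b) \<le> 3 ^ j * (2 * \<bar>\<beta> n\<bar>) * b"
      by (simp add: norm_mult mult_ac)
  qed
  moreover have "wiener_norm_le j (\<lambda>z. of_real (\<alpha> (Suc n)) * (z ^ 2 * f (Suc (Suc n)) z)) (3 ^ j * \<bar>\<alpha> (Suc n)\<bar> * b)"
    by (rule wn.bounded_by_mono[OF wn.bounded_by_cmult[OF wiener_norm_le_power_mult[OF f]]])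
       (simp add: mult_ac)
  ultimately have "wiener_norm_le j (\<lambda>z. of_real (\<alpha> n) * f n z + 2 * of_real (\<beta> n) * (z ^ 1 * f (Suc n) z)
      + of_real (\<alpha> (Suc n)) * (z ^ 2 * f (Suc (Suc n)) z))
      (3 ^ j * \<bar>\<alpha> n\<bar> * b + 3 ^ j * (2 * \<bar>\<beta> n\<bar>) * b + 3 ^ j * \<bar>\<alpha> (Suc n)\<bar> * b)"
    by (intro wn.bounded_by_add)
  then have "wiener_norm_le j (source f n) (3 ^ j * \<bar>\<alpha> n\<bar> * b + 3 ^ j * (2 * \<bar>\<beta> n\<bar>) * b + 3 ^ j * \<bar>\<alpha> (Suc n)\<bar> * b)"
    by (rule wn.bounded_by_cong) (simp add: volterra_source_def mult_ac)
  then show ?thesis by (simp add: perturbation_def algebra_simps)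
qed

definition kernel :: "nat \<Rightarrow> complex \<Rightarrow> complex" where
  "kernel k z = (\<Sum>l\<le>k. z ^ (2 * l))"

text \<open>
The terms of the Neumann series, not its partial sums.
\<close>
primrec iterate :: "nat \<Rightarrow> nat \<Rightarrow> complex \<Rightarrow> complex" where
  "iterate 0 = (\<lambda>n z. 1)"
| "iterate (Suc i) = (\<lambda>n z. - (\<Sum>k. kernel k z * source (iterate i) (k + n) z))"

lemma kernel_bound: "wiener_norm_le j (kernel k) ((real k + 1) * (1 + 2 * real k) ^ j)"
proof -
  have "wiener_norm_le j (\<lambda>z. z ^ (2 * l)) ((1 + 2 * real k) ^ j)" if "l \<le> k" for l
  proof -
    have "wiener_norm_le j (\<lambda>z. z ^ (2 * l)) ((1 + real (2 * l)) ^ j)"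
      using wiener_norm_le_power_mult[OF wn.bounded_by_const[of j 1], of "2 * l"] by simp
    then show ?thesis by (rule wn.bounded_by_mono) (use that in \<open>auto intro!: power_mono\<close>)
  qed
  then have "wiener_norm_le j (\<lambda>z. \<Sum>l\<le>k. z ^ (2 * l)) (\<Sum>l\<le>k. (1 + 2 * real k) ^ j)"
    by (intro wn.bounded_by_sum) auto
  then show ?thesis by (simp add: kernel_def[abs_def] add.commute)
qed

lemma weights_shift: "(real k + 1) * (1 + 2 * real k) ^ j * (3 ^ j * \<kappa> (k + n)) \<le> W (k + n)"
  unfolding W_def weighted_perturbation_def mult.assoc
  by (intro mult_mono mult_right_mono power_mono) (auto simp: kappa_nonneg)

lemma term_bound:
  assumes "\<And>n. wiener_norm_le j (iterate i n) ((1 / 2) ^ i)"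
  shows "wiener_norm_le j (\<lambda>z. kernel k z * source (iterate i) (k + n) z) (W (k + n) * (1 / 2) ^ i)"
proof (rule wn.bounded_by_mono[OF wn.bounded_by_mult[OF kernel_bound source_bound[OF assms]]])
  show "(real k + 1) * (1 + 2 * real k) ^ j * (3 ^ j * \<kappa> (k + n) * (1 / 2) ^ i) \<le> W (k + n) * (1 / 2) ^ i"
    using mult_right_mono[OF weights_shift[of k n], of "(1 / 2) ^ i"] by (simp add: mult_ac)
qed

lemma tail_term_summable: "summable (\<lambda>k. W (k + n) * (1 / 2) ^ i)"
  by (intro summable_mult2) (simp add: W_summable)

text \<open>
Besides the factor 1/2 per iteration, which the contraction provides, one factor tail n is kept: it yields the
normalisation h_n \<rightarrow> 1.
\<close>
lemma iterate_Suc_bound_aux: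
  assumes "\<And>n. wiener_norm_le j (iterate i n) ((1 / 2) ^ i)"
  shows "wiener_norm_le j (iterate (Suc i) n) (tail n * (1 / 2) ^ i)"
proof -
  have "wiener_norm_le j (\<lambda>z. (-1) * (\<Sum>k. kernel k z * source (iterate i) (k + n) z))
      (pweight j 0 * norm (-1 :: complex) * (\<Sum>k. W (k + n) * (1 / 2) ^ i))"
    by (rule wn.bounded_by_cmult[OF wn.bounded_by_suminf(1)[OF term_bound[OF assms] tail_term_summable]])
  moreover have "(\<Sum>k. W (k + n) * (1 / 2) ^ i) = tail n * (1 / 2) ^ i"
    unfolding tail_def by (rule suminf_mult2[symmetric]) (simp add: W_summable)
  ultimately show ?thesis by simp
qed

lemma iterate_bound: "wiener_norm_le j (iterate i n) ((1 / 2) ^ i)"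
proof (induction i arbitrary: n)
  case 0 show ?case using wn.bounded_by_const[of j 1] by simp
next
  case (Suc i)
  show ?case
    by (rule wn.bounded_by_mono[OF iterate_Suc_bound_aux[OF Suc]]) (use tail_le_half[of n] in simp)
qed

lemmas iterate_Suc_bound = iterate_Suc_bound_aux[OF iterate_bound]
lemmas iterate_source_bound = source_bound[OF iterate_bound]

lemma source_terms_summable:
  assumes "z \<in> sphere 0 1"
  shows "summable (\<lambda>k. norm (source (iterate i) (k + n) z))"
proof (rule summable_comparison_test'[of "\<lambda>k. W (k + n) * (1 / 2) ^ i" 0])
  fix k :: nat
  have "norm (source (iterate i) (k + n) z) \<le> 3 ^ j * \<kappa> (k + n) * (1 / 2) ^ i"
    by (rule wn.norm_le_bound[OF iterate_source_bound assms])
  also have "\<dots> \<le> W (k + n) * (1 / 2) ^ i"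
  proof (rule mult_right_mono)
    have "1 \<le> (real (k + n) + 1) * (1 + 2 * real (k + n)) ^ j"
      by (rule mult_ge1_I) (auto intro: one_le_power)
    then have "1 * (3 ^ j * \<kappa> (k + n)) \<le> (real (k + n) + 1) * (1 + 2 * real (k + n)) ^ j * (3 ^ j * \<kappa> (k + n))"
      by (rule mult_right_mono) (simp add: kappa_nonneg)
    then show "3 ^ j * \<kappa> (k + n) \<le> W (k + n)" by (simp add: W_def weighted_perturbation_def mult_ac)
  qed simp
  finally show "norm (norm (source (iterate i) (k + n) z)) \<le> W (k + n) * (1 / 2) ^ i" by simp
qed (rule tail_term_summable)

text \<open>
Consecutive kernels differ by a single power of z, so differences in n lose the factor k + 1 in the kernel
bound. This gain is what makes the differences of h summable over n.
\<close>
lemma iterate_diff: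
  assumes z: "z \<in> sphere 0 1"
  shows "iterate (Suc i) n z - iterate (Suc i) (Suc n) z = - (\<Sum>k. z ^ (2 * k) * source (iterate i) (k + n) z)"
    and "summable (\<lambda>k. norm (z ^ (2 * k) * source (iterate i) (k + n) z))"
proof -
  define s where "s k = source (iterate i) (k + n) z" for k
  have nz: "norm (z ^ m) = 1" for m using z by (simp add: norm_power)
  show sn: "summable (\<lambda>k. norm (z ^ (2 * k) * source (iterate i) (k + n) z))"
    using source_terms_summable[OF z] by (simp add: norm_mult nz)
  have K: "summable (\<lambda>k. kernel k z * source (iterate i) (k + m) z)" for m
    by (rule summable_norm_cancel, rule wn.bounded_by_suminf(2)[OF term_bound[OF iterate_bound] tail_term_summable z])
  have Ks: "summable (\<lambda>k. kernel k z * s k)" using K[of n] by (simp add: s_def)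
  have Ks': "summable (\<lambda>k. kernel k z * s (Suc k))" using K[of "Suc n"] by (simp add: s_def)
  have Zs: "summable (\<lambda>k. z ^ (2 * k) * s k)" unfolding s_def by (rule summable_norm_cancel[OF sn])
  have "(\<Sum>k. kernel k z * s k) = kernel 0 z * s 0 + (\<Sum>k. kernel (Suc k) z * s (Suc k))"
    using suminf_split_head[OF Ks] by simp
  moreover have "(\<Sum>k. kernel (Suc k) z * s (Suc k)) - (\<Sum>k. kernel k z * s (Suc k)) = (\<Sum>k. z ^ (2 * Suc k) * s (Suc k))"
  proof (subst suminf_diff)
    show "summable (\<lambda>k. kernel (Suc k) z * s (Suc k))" using Ks by (subst summable_Suc_iff)
    show "(\<Sum>k. kernel (Suc k) z * s (Suc k) - kernel k z * s (Suc k)) = (\<Sum>k. z ^ (2 * Suc k) * s (Suc k))"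
      by (simp add: kernel_def algebra_simps)
  qed (rule Ks')
  moreover have "(\<Sum>k. z ^ (2 * k) * s k) = s 0 + (\<Sum>k. z ^ (2 * Suc k) * s (Suc k))"
    using suminf_split_head[OF Zs] by simp
  ultimately have "(\<Sum>k. kernel k z * s k) - (\<Sum>k. kernel k z * s (Suc k)) = (\<Sum>k. z ^ (2 * k) * s k)"
    by (simp add: kernel_def)
  from arg_cong[OF this, of uminus]
  show "iterate (Suc i) n z - iterate (Suc i) (Suc n) z = - (\<Sum>k. z ^ (2 * k) * source (iterate i) (k + n) z)"
    by (simp add: s_def)
qed

definition h :: "nat \<Rightarrow> complex \<Rightarrow> complex" where
  "h n z = (\<Sum>i. iterate i n z)"

lemma halves_summable: "summable (\<lambda>i. (1 / 2 :: real) ^ i)" by (rule summable_geometric) simp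

lemma halves_sum: "(\<Sum>i. (1 / 2 :: real) ^ i) = 2" by (subst suminf_geometric) auto

lemma h_bound: "wiener_norm_le j (h n) 2"
  using wn.bounded_by_suminf(1)[OF iterate_bound halves_summable] unfolding halves_sum h_def[abs_def] .

lemma iterate_summable: "z \<in> sphere 0 1 \<Longrightarrow> summable (\<lambda>i. iterate i n z)"
  by (rule summable_norm_cancel, rule wn.bounded_by_suminf(2)[OF iterate_bound halves_summable])

lemma h_diff:
  assumes z: "z \<in> sphere 0 1"
  shows "(\<lambda>i. iterate (Suc i) n z - iterate (Suc i) (Suc n) z) sums (h n z - h (Suc n) z)"
proof -
  have "(\<lambda>i. iterate i n z - iterate i (Suc n) z) sums (h n z - h (Suc n) z)"
    unfolding h_def by (intro sums_diff summable_sums iterate_summable z)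
  from sums_Suc_iff[of "\<lambda>i. iterate i n z - iterate i (Suc n) z" "h n z - h (Suc n) z"] this
  show ?thesis by simp
qed

lemma h_recurrence:
  assumes z: "z \<in> sphere 0 1"
  shows "h n z - h (Suc n) z = z ^ 2 * (h (Suc n) z - h (Suc (Suc n)) z) - source h n z"
proof -
  define D where "D i n = iterate (Suc i) n z - iterate (Suc i) (Suc n) z" for i n
  have step: "D i n = z ^ 2 * D i (Suc n) - source (iterate i) n z" for i
  proof -
    have "summable (\<lambda>k. z ^ (2 * k) * source (iterate i) (k + n) z)"
      by (rule summable_norm_cancel[OF iterate_diff(2)[OF z]])
    from suminf_split_head[OF this]
    have "(\<Sum>k. z ^ (2 * k) * source (iterate i) (k + n) z)
        = source (iterate i) n z + (\<Sum>k. z ^ 2 * (z ^ (2 * k) * source (iterate i) (k + Suc n) z))"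
      by (simp add: power_add power2_eq_square mult_ac)
    also have "(\<Sum>k. z ^ 2 * (z ^ (2 * k) * source (iterate i) (k + Suc n) z))
        = z ^ 2 * (\<Sum>k. z ^ (2 * k) * source (iterate i) (k + Suc n) z)"
      by (rule suminf_mult[OF summable_norm_cancel[OF iterate_diff(2)[OF z]]])
    finally show ?thesis unfolding D_def iterate_diff(1)[OF z] by simp
  qed
  have "(\<lambda>i. source (iterate i) n z) sums source h n z"
    unfolding volterra_source_def h_def
    by (intro sums_add sums_mult summable_sums iterate_summable z)
  then have "(\<lambda>i. z ^ 2 * D i (Suc n) - source (iterate i) n z) sums
      (z ^ 2 * (h (Suc n) z - h (Suc (Suc n)) z) - source h n z)"
    unfolding D_def by (intro sums_diff sums_mult h_diff z)
  moreover have "(\<lambda>i. z ^ 2 * D i (Suc n) - source (iterate i) n z) sums (h n z - h (Suc n) z)"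
    unfolding step[symmetric] unfolding D_def by (rule h_diff[OF z])
  ultimately show ?thesis by (rule sums_unique2[symmetric])
qed

lemma h_tendsto:
  assumes z: "z \<in> sphere 0 1" shows "(\<lambda>n. h n z) \<longlonglongrightarrow> 1"
proof -
  have le: "norm (h n z - 1) \<le> 2 * tail n" for n
  proof -
    have b: "norm (iterate (Suc i) n z) \<le> tail n * (1 / 2) ^ i" for i
      by (rule wn.norm_le_bound[OF iterate_Suc_bound z])
    have s: "summable (\<lambda>i. tail n * (1 / 2) ^ i)" by (rule summable_mult[OF halves_summable])
    have "h n z - 1 = (\<Sum>i. iterate (Suc i) n z)"
      unfolding h_def using suminf_split_head[OF iterate_summable[OF z], of n] by simp
    also have "norm \<dots> \<le> (\<Sum>i. tail n * (1 / 2) ^ i)"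
      by (rule norm_suminf_le[OF b s])
    also have "\<dots> = tail n * 2" unfolding suminf_mult[OF halves_summable] halves_sum ..
    finally show ?thesis by simp
  qed
  have "tail \<longlonglongrightarrow> 0" using suminf_tail_tendsto_0[OF W_summable] unfolding tail_def[abs_def] .
  then have "(\<lambda>n. 2 * tail n) \<longlonglongrightarrow> 2 * 0" by (intro tendsto_intros)
  then have "(\<lambda>n. h n z - 1) \<longlonglongrightarrow> 0"
    by (intro Lim_null_comparison[of "\<lambda>n. h n z - 1" "\<lambda>n. 2 * tail n"] always_eventually allI le) simp
  then show ?thesis by (rule LIM_zero_cancel)
qed

text \<open>
Up to a factor 2, this bounds z^n (h_n - h_(n+1)) in norm. It is summable over n by the moment hypothesis, one
power of the weight being spent on the summation.
\<close>
definition V where "V n = (\<Sum>k. v (k + n))" for n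

lemma v_summable: "summable v" and V_summable: "summable V"
  using summable_tails[OF v_nonneg moment] unfolding V_def[abs_def] by auto

text \<open>
The factor z^n is part of the statement because it is what occurs in the Wronskian, and because it combines
well: the power z^(n+2k) in front of source_(n+k) has a weight of order (n+k)^j, whereas bounding z^n and the
difference separately would multiply two such weights.
\<close>
lemma h_diff_bound: "wiener_norm_le j (\<lambda>z. z ^ n * (h n z - h (Suc n) z)) (2 * V n)"
proof -
  have b1: "wiener_norm_le j (\<lambda>z. z ^ (n + 2 * k) * source (iterate i) (k + n) z) (v (k + n) * (1 / 2) ^ i)" for k i
  proof (rule wn.bounded_by_mono[OF wiener_norm_le_power_mult[OF iterate_source_bound]])
    have "(1 + real (n + 2 * k)) ^ j \<le> (1 + 2 * real (k + n)) ^ j" by (rule power_mono) auto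
    then show "(1 + real (n + 2 * k)) ^ j * (3 ^ j * \<kappa> (k + n) * (1 / 2) ^ i) \<le> v (k + n) * (1 / 2) ^ i"
      unfolding weighted_perturbation_def mult.assoc by (intro mult_right_mono) (auto simp: kappa_nonneg)
  qed
  have s1: "summable (\<lambda>k. v (k + n) * (1 / 2) ^ i)" for i by (intro summable_mult2) (simp add: v_summable)
  have V: "(\<Sum>k. v (k + n) * (1 / 2) ^ i) = V n * (1 / 2) ^ i" for i
    unfolding V_def by (rule suminf_mult2[symmetric]) (simp add: v_summable)
  have "wiener_norm_le j (\<lambda>z. \<Sum>k. z ^ (n + 2 * k) * source (iterate i) (k + n) z) (V n * (1 / 2) ^ i)" for i
    using wn.bounded_by_suminf(1)[OF b1 s1, of i] unfolding V .
  moreover have "summable (\<lambda>i. V n * (1 / 2) ^ i)" by (rule summable_mult[OF halves_summable])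
  ultimately have "wiener_norm_le j (\<lambda>z. \<Sum>i. \<Sum>k. z ^ (n + 2 * k) * source (iterate i) (k + n) z) (\<Sum>i. V n * (1 / 2) ^ i)"
    by (rule wn.bounded_by_suminf(1))
  from wn.bounded_by_cmult[OF this, of "-1"]
  have "wiener_norm_le j (\<lambda>z. - (\<Sum>i. \<Sum>k. z ^ (n + 2 * k) * source (iterate i) (k + n) z)) (2 * V n)"
    by (simp add: suminf_mult[OF halves_summable] halves_sum mult.commute)
  then show ?thesis
  proof (rule wn.bounded_by_cong)
    fix z :: complex assume z: "z \<in> sphere 0 1"
    have "(\<Sum>k. z ^ (n + 2 * k) * source (iterate i) (k + n) z)
        = - (z ^ n * (iterate (Suc i) n z - iterate (Suc i) (Suc n) z))" for i
    proof -
      have "(\<Sum>k. z ^ (n + 2 * k) * source (iterate i) (k + n) z)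
          = (\<Sum>k. z ^ n * (z ^ (2 * k) * source (iterate i) (k + n) z))"
        by (simp add: power_add mult.assoc)
      also have "\<dots> = z ^ n * (\<Sum>k. z ^ (2 * k) * source (iterate i) (k + n) z)"
        by (rule suminf_mult[OF summable_norm_cancel[OF iterate_diff(2)[OF z]]])
      finally show ?thesis unfolding iterate_diff(1)[OF z] by simp
    qed
    moreover have "(\<lambda>i. - (z ^ n * (iterate (Suc i) n z - iterate (Suc i) (Suc n) z))) sums (- (z ^ n * (h n z - h (Suc n) z)))"
      by (intro sums_minus sums_mult h_diff z)
    ultimately show "- (\<Sum>i. \<Sum>k. z ^ (n + 2 * k) * source (iterate i) (k + n) z) = z ^ n * (h n z - h (Suc n) z)"
      by (simp add: sums_iff)
  qed
qed

lemma h_diff_pointwise: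
  assumes z: "z \<in> sphere 0 1"
  shows "(1 + real n) ^ j * norm (h n z - h (Suc n) z) \<le> 2 * V n"
proof -
  have it: "(1 + real n) ^ j * norm (iterate (Suc i) n z - iterate (Suc i) (Suc n) z) \<le> V n * (1 / 2) ^ i" for i
  proof -
    have "norm (iterate (Suc i) n z - iterate (Suc i) (Suc n) z) \<le> (\<Sum>k. norm (z ^ (2 * k) * source (iterate i) (k + n) z))"
      unfolding iterate_diff(1)[OF z] norm_minus_cancel by (rule summable_norm[OF iterate_diff(2)[OF z]])
    then have "(1 + real n) ^ j * norm (iterate (Suc i) n z - iterate (Suc i) (Suc n) z)
        \<le> (1 + real n) ^ j * (\<Sum>k. norm (z ^ (2 * k) * source (iterate i) (k + n) z))"
      by (rule mult_left_mono) simp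
    also have "\<dots> = (\<Sum>k. (1 + real n) ^ j * norm (z ^ (2 * k) * source (iterate i) (k + n) z))"
      by (rule suminf_mult[symmetric, OF iterate_diff(2)[OF z]])
    also have "\<dots> \<le> (\<Sum>k. v (k + n) * (1 / 2) ^ i)"
    proof (rule suminf_le)
      show "summable (\<lambda>k. (1 + real n) ^ j * norm (z ^ (2 * k) * source (iterate i) (k + n) z))"
        by (rule summable_mult[OF iterate_diff(2)[OF z]])
      show "summable (\<lambda>k. v (k + n) * (1 / 2) ^ i)" by (intro summable_mult2) (simp add: v_summable)
      fix k
      have "norm (z ^ (2 * k) * source (iterate i) (k + n) z) = norm (source (iterate i) (k + n) z)"
        using z by (simp add: norm_mult norm_power)
      moreover have "\<dots> \<le> 3 ^ j * \<kappa> (k + n) * (1 / 2) ^ i" by (rule wn.norm_le_bound[OF iterate_source_bound z])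
      moreover have "(1 + real n) ^ j \<le> (1 + 2 * real (k + n)) ^ j" by (rule power_mono) auto
      ultimately show "(1 + real n) ^ j * norm (z ^ (2 * k) * source (iterate i) (k + n) z) \<le> v (k + n) * (1 / 2) ^ i"
        unfolding weighted_perturbation_def mult.assoc by (intro mult_mono) auto
    qed
    also have "\<dots> = V n * (1 / 2) ^ i"
      unfolding V_def by (rule suminf_mult2[symmetric]) (simp add: v_summable)
    finally show ?thesis .
  qed
  have c: "norm (of_real ((1 + real n) ^ j) :: complex) = (1 + real n) ^ j"
    unfolding norm_of_real by simp
  have "of_real ((1 + real n) ^ j) * (h n z - h (Suc n) z)
      = (\<Sum>i. of_real ((1 + real n) ^ j) * (iterate (Suc i) n z - iterate (Suc i) (Suc n) z))"
    by (rule sums_unique[OF sums_mult[OF h_diff[OF z]]])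
  also have "norm \<dots> \<le> (\<Sum>i. V n * (1 / 2) ^ i)"
    by (rule norm_suminf_le[OF _ summable_mult[OF halves_summable]]) (simp only: norm_mult c it)
  also have "\<dots> = 2 * V n" by (simp add: suminf_mult[OF halves_summable] halves_sum)
  finally show ?thesis by (simp only: norm_mult c)
qed

end

section \<open>Closure properties of the weighted Wiener algebra\<close>

lemma weighted_wiener_add: "weighted_wiener j f \<Longrightarrow> weighted_wiener j g \<Longrightarrow> weighted_wiener j (\<lambda>z. f z + g z)"
  unfolding weighted_wiener_def using wn.bounded_by_add by blast

lemma weighted_wiener_mult: "weighted_wiener j f \<Longrightarrow> weighted_wiener j g \<Longrightarrow> weighted_wiener j (\<lambda>z. f z * g z)"
  unfolding weighted_wiener_def using wn.bounded_by_mult by blast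

lemma weighted_wiener_const: "weighted_wiener j (\<lambda>z. c)"
  unfolding weighted_wiener_def using wn.bounded_by_const by blast

lemma weighted_wiener_powi: "weighted_wiener j (\<lambda>z. z powi k)"
  unfolding weighted_wiener_def using wn.bounded_by_powi[of j 1 k] by auto

lemma weighted_wiener_ident: "weighted_wiener j (\<lambda>z. z)"
  using weighted_wiener_powi[of j 1] by simp

lemma weighted_wiener_power: "weighted_wiener j (\<lambda>z. z ^ n)"
  using weighted_wiener_powi[of j "int n"] by (simp add: power_int_of_nat)

lemma weighted_wiener_inverse_ident: "weighted_wiener j inverse"
  using weighted_wiener_powi[of j "-1"] by (simp add: power_int_minus)

lemma weighted_wiener_diff: "weighted_wiener j f \<Longrightarrow> weighted_wiener j g \<Longrightarrow> weighted_wiener j (\<lambda>z. f z - g z)"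
  using weighted_wiener_add[OF _ weighted_wiener_mult[OF weighted_wiener_const[of j "-1"]], of f g] by simp

lemma weighted_wiener_uminus: "weighted_wiener j f \<Longrightarrow> weighted_wiener j (\<lambda>z. - f z)"
  using weighted_wiener_diff[OF weighted_wiener_const[of j 0], of f] by simp

lemma circle_inverse_cnj:
  assumes "z \<in> sphere 0 1" shows "inverse z = cnj z"
proof (rule inverse_unique)
  show "z * cnj z = 1" using assms by (simp add: complex_norm_square[symmetric])
qed

lemma weighted_wiener_cnj:
  assumes "weighted_wiener j f" shows "weighted_wiener j (\<lambda>z. cnj (f z))"
proof -
  obtain c where c: "(\<lambda>m. pweight j m * norm (c m)) summable_on UNIV"
    "\<And>z. z \<in> sphere 0 1 \<Longrightarrow> f z = (\<Sum>\<^sub>\<infinity>m. c m * z powi m)"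
    using assms unfolding weighted_wiener_def laurent_norm_le_def by blast
  have bij: "bij_betw uminus (UNIV :: int set) UNIV"
    by (rule bij_betwI[of _ _ _ uminus]) auto
  have "(\<lambda>m. pweight j (- m) * norm (c (- m))) summable_on UNIV"
    by (subst summable_on_reindex_bij_betw[OF bij, where f = "\<lambda>m. pweight j m * norm (c m)"]) (rule c(1))
  then have "(\<lambda>m. pweight j m * norm (cnj (c (- m)))) summable_on UNIV"
    by (simp add: pweight_def)
  moreover have "cnj (f z) = (\<Sum>\<^sub>\<infinity>m. cnj (c (- m)) * z powi m)" if z: "z \<in> sphere 0 1" for z
  proof -
    have zc: "cnj z = inverse z" using circle_inverse_cnj[OF z] by simp
    have "cnj (f z) = (\<Sum>\<^sub>\<infinity>m. cnj (c m) * cnj z powi m)"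
      unfolding c(2)[OF z] infsum_cnj[symmetric] by (simp add: complex_cnj_power_int)
    also have "\<dots> = (\<Sum>\<^sub>\<infinity>m. cnj (c (- m)) * cnj z powi (- m))"
      by (rule infsum_reindex_bij_betw[OF bij, symmetric])
    also have "\<dots> = (\<Sum>\<^sub>\<infinity>m. cnj (c (- m)) * z powi m)"
      by (simp add: zc power_int_minus power_int_inverse)
    finally show ?thesis .
  qed
  ultimately show ?thesis unfolding weighted_wiener_def laurent_norm_le_def
    by (intro exI[of _ "\<Sum>\<^sub>\<infinity>m. pweight j m * norm (cnj (c (- m)))"] exI[of _ "\<lambda>m. cnj (c (- m))"]) simp
qed

lemmas weighted_wiener_intros = weighted_wiener_add weighted_wiener_mult weighted_wiener_const
  weighted_wiener_powi weighted_wiener_ident weighted_wiener_power weighted_wiener_inverse_ident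
  weighted_wiener_diff weighted_wiener_uminus weighted_wiener_cnj

section \<open>Wronskians and Jacobi solutions\<close>

definition wronskian :: "(int \<Rightarrow> real) \<Rightarrow> (int \<Rightarrow> complex) \<Rightarrow> (int \<Rightarrow> complex) \<Rightarrow> int \<Rightarrow> complex" where
  "wronskian a u v n = of_real (a n) * (u n * v (n + 1) - u (n + 1) * v n)"

text \<open>
Green's formula for solutions at two energies. For equal energies it shows that the Wronskian is constant; for
the energies at z and at e with e^2 = 1 the difference of the energies is (z - e)^2 / (2z).
\<close>
lemma wronskian_step:
  assumes "jacobi_solution a b z u" "jacobi_solution a b w v"
  shows "wronskian a u v (n - 1) = wronskian a u v n
    + ((z + inverse z) / 2 - (w + inverse w) / 2) * u n * v n"
proof -
  have u: "of_real (a (n - 1)) * u (n - 1) = (z + inverse z) / 2 * u n - of_real (b n) * u n - of_real (a n) * u (n + 1)"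
    unfolding assms(1)[unfolded jacobi_solution_def jacobi_op_def, rule_format, symmetric] by simp
  have v: "of_real (a (n - 1)) * v (n - 1) = (w + inverse w) / 2 * v n - of_real (b n) * v n - of_real (a n) * v (n + 1)"
    unfolding assms(2)[unfolded jacobi_solution_def jacobi_op_def, rule_format, symmetric] by simp
  have "wronskian a u v (n - 1) = (of_real (a (n - 1)) * u (n - 1)) * v n - u n * (of_real (a (n - 1)) * v (n - 1))"
    by (simp add: wronskian_def algebra_simps)
  also have "\<dots> = wronskian a u v n + ((z + inverse z) / 2 - (w + inverse w) / 2) * u n * v n"
    unfolding u v by (simp add: wronskian_def algebra_simps)
  finally show ?thesis .
qed

lemma wronskian_const:
  assumes "jacobi_solution a b z u" "jacobi_solution a b z v"
  shows "wronskian a u v n = wronskian a u v m"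
proof (induction n rule: int_induct[of _ m])
  case (step1 i) then show ?case using wronskian_step[OF assms, of "i + 1"] by simp
next
  case (step2 i) then show ?case using wronskian_step[OF assms, of i] by simp
qed simp

lemma jacobi_solution_eq_0:
  assumes a: "\<And>n. a n > 0" and u: "jacobi_solution a b z u" and "u N = 0" "u (N + 1) = 0"
  shows "u n = 0"
proof -
  have "u n = 0 \<and> u (n + 1) = 0"
  proof (induction n rule: int_induct[of _ N])
    case (step1 i)
    then show ?case using u[unfolded jacobi_solution_def jacobi_op_def, rule_format, of "i + 1"] a[of "i + 1"]
      by (simp add: add.assoc)
  next
    case (step2 i)
    then show ?case using u[unfolded jacobi_solution_def jacobi_op_def, rule_format, of i] a[of "i - 1"] by simp
  qed (use assms in simp)
  then show ?thesis ..
qed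

lemma jacobi_solution_diff:
  "jacobi_solution a b z u \<Longrightarrow> jacobi_solution a b z v \<Longrightarrow> jacobi_solution a b z (\<lambda>n. u n - v n)"
  unfolding jacobi_solution_def
proof
  fix n
  assume E: "\<forall>n. jacobi_op a b u n = (z + inverse z) / 2 * u n" "\<forall>n. jacobi_op a b v n = (z + inverse z) / 2 * v n"
  have "jacobi_op a b (\<lambda>n. u n - v n) n = jacobi_op a b u n - jacobi_op a b v n"
    by (simp add: jacobi_op_def algebra_simps)
  then show "jacobi_op a b (\<lambda>n. u n - v n) n = (z + inverse z) / 2 * (u n - v n)"
    unfolding E[rule_format] by (simp only: right_diff_distrib)
qed

text \<open>
As a(n-1) does not vanish, the recurrence can be solved for the leftmost value.
\<close>
lemma jacobi_solution_extend_left: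
  assumes a: "\<And>n. a n > 0"
    and v: "\<And>n. n > N \<Longrightarrow> jacobi_op a b v n = (z + inverse z) / 2 * v n"
  obtains u where "jacobi_solution a b z u" "\<And>n. n \<ge> N \<Longrightarrow> u n = v n"
proof -
  define L where "L = (z + inverse z) / 2"
  define st where "st k p = (((L - of_real (b (N - int k))) * fst p - of_real (a (N - int k)) * snd p) / of_real (a (N - int k - 1)), fst p)"
    for k and p :: "complex \<times> complex"
  define G where "G = rec_nat (v N, v (N + 1)) st"
  have G0: "G 0 = (v N, v (N + 1))" by (simp add: G_def)
  have GS: "G (Suc k) = st k (G k)" for k by (simp add: G_def)
  define u where "u n = (if n \<ge> N then v n else fst (G (nat (N - n))))" for n
  have F: "fst (G k) = u (N - int k)" for k by (cases "k = 0") (auto simp: G0 u_def)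
  have G: "G k = (u (N - int k), u (N - int k + 1))" for k
  proof (cases k)
    case 0 then show ?thesis by (simp add: G0 u_def)
  next
    case (Suc i)
    then have "snd (G k) = u (N - int i)" by (simp add: GS st_def F)
    then show ?thesis using F[of k] Suc by (simp add: prod_eq_iff)
  qed
  have "jacobi_op a b u n = L * u n" for n
  proof (cases "n > N")
    case True
    then have "jacobi_op a b u n = jacobi_op a b v n" by (simp add: jacobi_op_def u_def)
    then show ?thesis using v[OF True] True by (simp add: L_def u_def)
  next
    case False
    define k where "k = nat (N - n)"
    have n: "n = N - int k" using False by (simp add: k_def)
    have "u (n - 1) = fst (G (Suc k))" using G[of "Suc k"] by (simp add: n algebra_simps)
    also have "\<dots> = ((L - of_real (b n)) * u n - of_real (a n) * u (n + 1)) / of_real (a (n - 1))"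
      by (simp add: GS st_def G[of k] n)
    finally show ?thesis using a[of "n - 1"] by (simp add: jacobi_op_def field_simps)
  qed
  then have "jacobi_solution a b z u" by (simp add: jacobi_solution_def L_def)
  then show thesis by (rule that) (simp add: u_def)
qed

section \<open>Existence and uniqueness of Jost solutions\<close>

text \<open>
The existence of the Jost solution at +\<infinity> only depends on the decay of the coefficients to the right;
the one at -\<infinity> is treated by reflection.
\<close>
definition right_moment :: "nat \<Rightarrow> (int \<Rightarrow> real) \<Rightarrow> (int \<Rightarrow> real) \<Rightarrow> bool" where
  "right_moment j a b \<longleftrightarrow> summable (\<lambda>n. (1 + real n) ^ (j + 1) * (\<bar>a (int n) - 1 / 2\<bar> + \<bar>b (int n)\<bar>))"

lemma right_moment_tendsto:
  assumes "right_moment j a b"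
  shows "(\<lambda>n. a (int n)) \<longlonglongrightarrow> 1 / 2"
proof -
  have "(\<lambda>n. (1 + real n) ^ (j + 1) * (\<bar>a (int n) - 1 / 2\<bar> + \<bar>b (int n)\<bar>)) \<longlonglongrightarrow> 0"
    using assms unfolding right_moment_def by (rule summable_LIMSEQ_zero)
  then have "(\<lambda>n. a (int n) - 1 / 2) \<longlonglongrightarrow> 0"
  proof (rule Lim_null_comparison[rotated], intro always_eventually allI)
    fix n
    have "1 * (\<bar>a (int n) - 1 / 2\<bar> + \<bar>b (int n)\<bar>) \<le> (1 + real n) ^ (j + 1) * (\<bar>a (int n) - 1 / 2\<bar> + \<bar>b (int n)\<bar>)"
      by (intro mult_right_mono one_le_power) auto
    then show "norm (a (int n) - 1 / 2) \<le> (1 + real n) ^ (j + 1) * (\<bar>a (int n) - 1 / 2\<bar> + \<bar>b (int n)\<bar>)" by simp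
  qed
  then show ?thesis by (rule LIM_zero_cancel)
qed

lemma half_line_shift:
  assumes "right_moment j a b"
  obtains N :: nat where "half_line (\<lambda>n. 2 * a (int (N + n)) - 1) (\<lambda>n. b (int (N + n + 1))) j"
proof -
  (* 6^j = 2^j * 3^j absorbs the constants of the weighted perturbation; the factor 2 turns a - 1/2 into 2a - 1. *)
  define p where "p m = 2 * 6 ^ j * ((1 + real m) ^ (j + 1) * (\<bar>a (int m) - 1 / 2\<bar> + \<bar>b (int m)\<bar>))" for m
  have p: "summable p" unfolding p_def using assms unfolding right_moment_def by (rule summable_mult)
  have p0: "0 \<le> p m" for m by (simp add: p_def)
  have "eventually (\<lambda>n. (\<Sum>k. p (k + n)) < 1 / 4) sequentially"
    by (rule order_tendstoD(2)[OF suminf_tail_tendsto_0[OF p]]) simp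
  then obtain N where N: "(\<Sum>k. p (k + N)) < 1 / 4" by (auto simp: eventually_sequentially)
  define \<alpha> where "\<alpha> n = 2 * a (int (N + n)) - 1" for n
  define \<beta> where "\<beta> n = b (int (N + n + 1))" for n
  define W where "W n = (real n + 1) * ((1 + 2 * real n) ^ j * (3 ^ j * (\<bar>\<alpha> n\<bar> + 2 * \<bar>\<beta> n\<bar> + \<bar>\<alpha> (Suc n)\<bar>)))" for n
  have W0: "0 \<le> W n" for n by (simp add: W_def)
  have W: "W n \<le> p (n + N) + p (Suc n + N)" for n
  proof -
    have c: "(real n + 1) * ((1 + 2 * real n) ^ j * 3 ^ j) \<le> 6 ^ j * (1 + real m) ^ (j + 1)" if "n \<le> m" for m
    proof -
      have "(1 + 2 * real n) ^ j \<le> (2 * (1 + real m)) ^ j" using that by (intro power_mono) auto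
      then have "(1 + 2 * real n) ^ j * 3 ^ j \<le> (2 * (1 + real m)) ^ j * 3 ^ j" by (rule mult_right_mono) simp
      also have "\<dots> = 6 ^ j * (1 + real m) ^ j"
        by (simp add: power_mult_distrib[symmetric])
      finally have pre: "(1 + 2 * real n) ^ j * 3 ^ j \<le> 6 ^ j * (1 + real m) ^ j" .
      have "(real n + 1) * ((1 + 2 * real n) ^ j * 3 ^ j) \<le> (1 + real m) * (6 ^ j * (1 + real m) ^ j)"
        by (rule mult_mono[OF _ pre]) (use that in auto)
      then show ?thesis by (simp add: mult_ac)
    qed
    have al: "\<bar>\<alpha> n\<bar> = 2 * \<bar>a (int (n + N)) - 1 / 2\<bar>" for n
      by (simp add: \<alpha>_def add.commute abs_if)
    have be: "\<beta> n = b (int (Suc n + N))"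
      by (simp add: \<beta>_def add_ac)
    define C where "C = (real n + 1) * ((1 + 2 * real n) ^ j * 3 ^ j)"
    have "C * \<bar>\<alpha> n\<bar> \<le> p (n + N)"
    proof -
      have "C * \<bar>\<alpha> n\<bar> \<le> (6 ^ j * (1 + real (n + N)) ^ (j + 1)) * (2 * (\<bar>a (int (n + N)) - 1 / 2\<bar> + \<bar>b (int (n + N))\<bar>))"
        unfolding C_def al by (rule mult_mono[OF c]) auto
      then show ?thesis by (simp only: p_def mult_ac)
    qed
    moreover have "C * (2 * \<bar>\<beta> n\<bar> + \<bar>\<alpha> (Suc n)\<bar>) \<le> p (Suc n + N)"
    proof -
      have "C * (2 * \<bar>\<beta> n\<bar> + \<bar>\<alpha> (Suc n)\<bar>) \<le> (6 ^ j * (1 + real (Suc n + N)) ^ (j + 1)) * (2 * (\<bar>a (int (Suc n + N)) - 1 / 2\<bar> + \<bar>b (int (Suc n + N))\<bar>))"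
        unfolding C_def al be by (rule mult_mono[OF c]) auto
      then show ?thesis by (simp only: p_def mult_ac)
    qed
    moreover have "W n = C * \<bar>\<alpha> n\<bar> + C * (2 * \<bar>\<beta> n\<bar> + \<bar>\<alpha> (Suc n)\<bar>)"
      by (simp add: W_def C_def algebra_simps)
    ultimately show ?thesis by linarith
  qed
  have pN: "summable (\<lambda>n. p (n + N))" using p by simp
  have pS: "summable (\<lambda>n. p (Suc n + N))" using pN by (subst summable_Suc_iff[of "\<lambda>n. p (n + N)"])
  have ps: "summable (\<lambda>n. p (n + N) + p (Suc n + N))" by (rule summable_add[OF pN pS])
  have Ws: "summable W" by (rule summable_comparison_test'[OF ps, of 0]) (use W W0 in simp)
  have "suminf W \<le> (\<Sum>n. p (n + N) + p (Suc n + N))" by (rule suminf_le[OF W Ws ps])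
  also have "\<dots> = (\<Sum>n. p (n + N)) + (\<Sum>n. p (Suc n + N))" by (rule suminf_add[symmetric, OF pN pS])
  also have "(\<Sum>n. p (Suc n + N)) \<le> (\<Sum>n. p (n + N))"
    using suminf_split_head[OF pN] p0[of N] by simp
  finally have "suminf W \<le> 1 / 2" using N by simp
  with Ws have "half_line \<alpha> \<beta> j"
    unfolding half_line_def weighted_perturbation_def perturbation_def W_def by simp
  then show thesis unfolding \<alpha>_def \<beta>_def by (rule that)
qed

definition is_jost_plus :: "(int \<Rightarrow> real) \<Rightarrow> (int \<Rightarrow> real) \<Rightarrow> complex \<Rightarrow> (int \<Rightarrow> complex) \<Rightarrow> bool" where
  "is_jost_plus a b z u \<longleftrightarrow> jacobi_solution a b z u \<and> ((\<lambda>n. z powi (- n) * u n) \<longlongrightarrow> 1) at_top"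

lemma is_jost_plus_seq:
  assumes "is_jost_plus a b z u"
  shows "(\<lambda>k. z powi (- int k) * u (int k)) \<longlonglongrightarrow> 1"
  using assms filterlim_compose[OF _ filterlim_int_sequentially, of "\<lambda>n. z powi (- n) * u n"]
  unfolding is_jost_plus_def by blast

text \<open>
The difference d of two candidates tends to 0 while v stays bounded, so their Wronskian vanishes and d is a
multiple of v near infinity; the multiple must be 0. This argument works on the whole circle, the points z = 1
and z = -1 included.
\<close>
lemma is_jost_plus_unique:
  assumes a: "\<And>n. a n > 0" and m: "right_moment j a b" and z: "z \<in> sphere 0 1"
    and u: "is_jost_plus a b z u" and v: "is_jost_plus a b z v"
  shows "u = v"
proof -
  define d where "d n = u n - v n" for n
  have sol: "jacobi_solution a b z d" "jacobi_solution a b z v"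
    using u v jacobi_solution_diff unfolding is_jost_plus_def d_def by blast+
  have z0: "z \<noteq> 0" using z by auto
  have nz: "norm (z powi k) = 1" for k using z by (simp add: norm_power_int)
  define s where "s k = z powi (- int k) * v (int k)" for k
  define t where "t k = z powi (- int k) * d (int k)" for k
  have s: "s \<longlonglongrightarrow> 1" unfolding s_def using is_jost_plus_seq[OF v] .
  have t: "t \<longlonglongrightarrow> 0" using tendsto_diff[OF is_jost_plus_seq[OF u] is_jost_plus_seq[OF v]]
    by (simp add: t_def[abs_def] d_def algebra_simps)
  have vs: "v (int k) = z powi (int k) * s k" and dt: "d (int k) = z powi (int k) * t k" for k
    using z0 by (simp_all add: s_def t_def power_int_minus)
  have wr: "wronskian a d v (int k) = z powi (2 * int k + 1) * (of_real (a (int k)) * (t k * s (Suc k) - t (Suc k) * s k))" for k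
    using vs[of "Suc k"] dt[of "Suc k"] z0
    by (simp add: wronskian_def vs[of k] dt[of k] power_int_add power_int_mult algebra_simps power2_eq_square)
  have "(\<lambda>k. of_real (a (int k)) * (t k * s (Suc k) - t (Suc k) * s k)) \<longlonglongrightarrow> of_real (1 / 2) * (0 * 1 - 0 * 1)"
    using right_moment_tendsto[OF m] s t LIMSEQ_Suc[OF s] LIMSEQ_Suc[OF t]
    by (intro tendsto_intros)
  then have "(\<lambda>k. norm (wronskian a d v (int k))) \<longlonglongrightarrow> 0"
    unfolding wr norm_mult[of "_ powi _"] nz by (simp add: tendsto_norm_zero)
  moreover have "wronskian a d v (int k) = wronskian a d v 0" for k by (rule wronskian_const[OF sol])
  ultimately have w0: "wronskian a d v 0 = 0" by (simp add: LIMSEQ_const_iff)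
  have step: "t k * s (Suc k) = t (Suc k) * s k" for k
  proof -
    have "wronskian a d v (int k) = 0" using w0 wronskian_const[OF sol] by metis
    then show ?thesis unfolding wr using a[of "int k"] z0 by simp
  qed
  have "eventually (\<lambda>k. s k \<noteq> 0) sequentially" by (rule tendsto_imp_eventually_ne[OF s]) simp
  then obtain K where K: "\<And>k. k \<ge> K \<Longrightarrow> s k \<noteq> 0" by (auto simp: eventually_sequentially)
  have const: "t (K + i) / s (K + i) = t K / s K" for i
  proof (induction i)
    case (Suc i)
    have "t (Suc (K + i)) / s (Suc (K + i)) = t (K + i) / s (K + i)"
      using step[of "K + i"] K[of "K + i"] K[of "Suc (K + i)"] by (simp add: field_simps)
    then show ?case using Suc by simp
  qed simp
  have "(\<lambda>k. t k / s k) \<longlonglongrightarrow> 0 / 1" by (intro tendsto_divide t s) simp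
  then have "(\<lambda>i. t (i + K) / s (i + K)) \<longlonglongrightarrow> 0" using LIMSEQ_ignore_initial_segment[of "\<lambda>k. t k / s k" 0 K] by simp
  then have "t K / s K = 0" using const by (simp add: add.commute LIMSEQ_const_iff)
  then have "t K = 0" using K[of K] by simp
  then have "t (Suc K) = 0" using step[of K] K[of K] by simp
  have "d (int K) = 0" "d (int K + 1) = 0"
    using dt[of K] dt[of "Suc K"] \<open>t K = 0\<close> \<open>t (Suc K) = 0\<close> by (simp_all add: add.commute)
  then have "d n = 0" for n using jacobi_solution_eq_0[OF a sol(1)] by blast
  then show ?thesis by (auto simp: d_def fun_eq_iff)
qed

lemma jost_plus_eqI:
  assumes "\<And>n. a n > 0" "right_moment j a b" "z \<in> sphere 0 1" "is_jost_plus a b z u"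
  shows "jost_plus a b z = u"
  unfolding jost_plus_def is_jost_plus_def[symmetric]
  by (rule the_equality) (use assms is_jost_plus_unique in blast)+

lemma filterlim_nat_minus_at_top: "filterlim (\<lambda>n. nat (n - N)) at_top at_top"
  unfolding filterlim_at_top
proof
  fix Z
  show "\<forall>\<^sub>F n in at_top. Z \<le> nat (n - N)"
    using eventually_ge_at_top[of "N + int Z"] by eventually_elim auto
qed

text \<open>
The interface to the half-line problem: beyond some N the Jost solution is z^n times a function h that is
bounded in A_j, tends to 1, and has summable differences.
\<close>
lemma jost_plus_representation:
  assumes a: "\<And>n. a n > 0" and m: "right_moment j a b"
  obtains N :: nat and h :: "nat \<Rightarrow> complex \<Rightarrow> complex" and V :: "nat \<Rightarrow> real"
  where "\<And>n. wiener_norm_le j (h n) 2"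
    and "\<And>z. z \<in> sphere 0 1 \<Longrightarrow> (\<lambda>n. h n z) \<longlonglongrightarrow> 1"
    and "summable V"
    and "\<And>n. wiener_norm_le j (\<lambda>z. z ^ n * (h n z - h (Suc n) z)) (V n)"
    and "\<And>n z. z \<in> sphere 0 1 \<Longrightarrow> (1 + real n) ^ j * norm (h n z - h (Suc n) z) \<le> V n"
    and "\<And>z. z \<in> sphere 0 1 \<Longrightarrow> is_jost_plus a b z (jost_plus a b z)"
    and "\<And>n z. z \<in> sphere 0 1 \<Longrightarrow> jost_plus a b z (int (N + n)) = z ^ (N + n) * h n z"
proof -
  obtain N where "half_line (\<lambda>n. 2 * a (int (N + n)) - 1) (\<lambda>n. b (int (N + n + 1))) j"
    by (rule half_line_shift[OF m])
  then interpret half_line "\<lambda>n. 2 * a (int (N + n)) - 1" "\<lambda>n. b (int (N + n + 1))" j .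
  have "is_jost_plus a b z (jost_plus a b z) \<and> (\<forall>n. jost_plus a b z (int (N + n)) = z ^ (N + n) * h n z)"
    if z: "z \<in> sphere 0 1" for z
  proof -
    have z0: "z \<noteq> 0" using z by auto
    define v where "v n = z powi n * h (nat (n - int N)) z" for n
    have vN: "v (int (N + k)) = z ^ (N + k) * h k z" for k by (simp add: v_def flip: power_int_of_nat)
    have "jacobi_op a b v n = (z + inverse z) / 2 * v n" if n: "n > int N" for n
    proof -
      define k where "k = nat (n - int N - 1)"
      have k: "n = int (N + k + 1)" using n by (simp add: k_def)
      have "(1 + (2 * a (int (N + k)) - 1)) * h k z + 2 * b (int (N + k + 1)) * z * h (Suc k) z
          + (1 + (2 * a (int (N + Suc k)) - 1)) * z ^ 2 * h (Suc (Suc k)) z = (z ^ 2 + 1) * h (Suc k) z"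
        using h_recurrence[OF z, of k] by (simp add: volterra_source_def algebra_simps)
      then have "z ^ (N + k) * (2 * a (int (N + k)) * h k z + 2 * b (int (N + k + 1)) * z * h (Suc k) z
          + 2 * a (int (N + Suc k)) * z ^ 2 * h (Suc (Suc k)) z) = z ^ (N + k) * ((z ^ 2 + 1) * h (Suc k) z)"
        by simp
      moreover have "(z + inverse z) / 2 * (z ^ (N + Suc k) * h (Suc k) z) = z ^ (N + k) * ((z ^ 2 + 1) * h (Suc k) z) / 2"
        using z0 by (simp add: field_simps power2_eq_square)
      ultimately have "of_real (a (int (N + k))) * (z ^ (N + k) * h k z) + of_real (b (int (N + Suc k))) * (z ^ (N + Suc k) * h (Suc k) z)
          + of_real (a (int (N + Suc k))) * (z ^ (N + Suc (Suc k)) * h (Suc (Suc k)) z)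
          = (z + inverse z) / 2 * (z ^ (N + Suc k) * h (Suc k) z)"
        by (simp add: algebra_simps power2_eq_square)
      moreover have "n = int (N + Suc k)" "n - 1 = int (N + k)" "n + 1 = int (N + Suc (Suc k))" using k by auto
      ultimately show ?thesis unfolding jacobi_op_def by (simp only: vN)
    qed
    from jacobi_solution_extend_left[OF a this] obtain u where
      u: "jacobi_solution a b z u" "\<And>n. n \<ge> int N \<Longrightarrow> u n = v n" by blast
    have "((\<lambda>n. h (nat (n - int N)) z) \<longlongrightarrow> 1) at_top"
      by (rule filterlim_compose[OF h_tendsto[OF z] filterlim_nat_minus_at_top])
    moreover have "\<forall>\<^sub>F n in at_top. h (nat (n - int N)) z = z powi (- n) * u n"
      using eventually_ge_at_top[of "int N"]
      by eventually_elim (use u(2) z0 in \<open>simp add: v_def power_int_minus\<close>)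
    ultimately have "((\<lambda>n. z powi (- n) * u n) \<longlongrightarrow> 1) at_top"
      by (rule Lim_transform_eventually)
    then have ju: "is_jost_plus a b z u" using u(1) by (simp add: is_jost_plus_def)
    moreover have "jost_plus a b z = u" by (rule jost_plus_eqI[OF a m z ju])
    moreover have "u (int (N + n)) = z ^ (N + n) * h n z" for n using u(2)[of "int (N + n)"] vN by simp
    ultimately show ?thesis by simp
  qed
  then show thesis
    using that[of h "\<lambda>n. 2 * V n" N] h_bound h_tendsto summable_mult[OF V_summable] h_diff_bound h_diff_pointwise
    by blast
qed

lemma jost_plus_is_jost_plus:
  assumes a: "\<And>n. a n > 0" and m: "right_moment j a b" and z: "z \<in> sphere 0 1"
  shows "is_jost_plus a b z (jost_plus a b z)"
  using jost_plus_representation[OF a m] z by metis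

lemma jost_plus_inverse:
  assumes a: "\<And>n. a n > 0" and m: "right_moment j a b" and z: "z \<in> sphere 0 1"
  shows "jost_plus a b (inverse z) = (\<lambda>n. cnj (jost_plus a b z n))"
proof (rule jost_plus_eqI[OF a m])
  have c: "inverse z = cnj z" by (rule circle_inverse_cnj[OF z])
  show "inverse z \<in> sphere 0 1" using z by (simp add: norm_inverse)
  have J: "is_jost_plus a b z (jost_plus a b z)" by (rule jost_plus_is_jost_plus[OF a m z])
  show "is_jost_plus a b (inverse z) (\<lambda>n. cnj (jost_plus a b z n))"
    unfolding is_jost_plus_def
  proof
    show "jacobi_solution a b (inverse z) (\<lambda>n. cnj (jost_plus a b z n))"
      unfolding jacobi_solution_def
    proof
      fix n
      have "jacobi_op a b (jost_plus a b z) n = (z + inverse z) / 2 * jost_plus a b z n"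
        using J by (simp add: is_jost_plus_def jacobi_solution_def)
      from arg_cong[OF this, of cnj]
      show "jacobi_op a b (\<lambda>n. cnj (jost_plus a b z n)) n = (inverse z + inverse (inverse z)) / 2 * cnj (jost_plus a b z n)"
        by (simp add: jacobi_op_def c[symmetric])
    qed
    have "((\<lambda>n. cnj (z powi (- n) * jost_plus a b z n)) \<longlongrightarrow> cnj 1) at_top"
      using J unfolding is_jost_plus_def by (intro tendsto_cnj) blast
    then show "((\<lambda>n. inverse z powi (- n) * cnj (jost_plus a b z n)) \<longlongrightarrow> 1) at_top"
      unfolding c by (simp add: complex_cnj_power_int)
  qed
qed

lemma jost_plus_weighted_wiener:
  assumes a: "\<And>n. a n > 0" and m: "right_moment j a b"
  shows "weighted_wiener j (\<lambda>z. jost_plus a b z n)"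
proof -
  obtain N h where h: "\<And>n. wiener_norm_le j (h n) 2"
    "\<And>n z. z \<in> sphere 0 1 \<Longrightarrow> jost_plus a b z (int (N + n)) = z ^ (N + n) * h n z"
    using jost_plus_representation[OF a m] by metis
  have hi: "weighted_wiener j (\<lambda>z. jost_plus a b z (int (N + k)))" for k
  proof (rule weighted_wiener_cong)
    show "weighted_wiener j (\<lambda>z. z ^ (N + k) * h k z)"
      by (intro weighted_wiener_intros) (use h(1) in \<open>auto simp: weighted_wiener_def\<close>)
  qed (rule h(2)[symmetric])
  have "weighted_wiener j (\<lambda>z. jost_plus a b z n) \<and> weighted_wiener j (\<lambda>z. jost_plus a b z (n + 1))"
  proof (induction n rule: int_induct[of _ "int N"])
    case base show ?case using hi[of 0] hi[of 1] by (simp add: add.commute)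
  next
    case (step1 i)
    then have "i + 1 = int (N + nat (i + 1 - int N))" "i + 1 + 1 = int (N + nat (i + 1 + 1 - int N))" by auto
    then show ?case using hi by metis
  next
    case (step2 i)
    have "weighted_wiener j (\<lambda>z. jost_plus a b z (i - 1))"
    proof (rule weighted_wiener_cong)
      show "weighted_wiener j (\<lambda>z. of_real (1 / a (i - 1)) * (((z + inverse z) * (1 / 2) - of_real (b i)) * jost_plus a b z i
          - of_real (a i) * jost_plus a b z (i + 1)))"
        using step2 by (intro weighted_wiener_intros) auto
      fix z :: complex assume z: "z \<in> sphere 0 1"
      have eq: "jacobi_op a b (jost_plus a b z) i = (z + inverse z) / 2 * jost_plus a b z i"
        using jost_plus_is_jost_plus[OF a m z] by (simp add: is_jost_plus_def jacobi_solution_def)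
      have E: "((z + inverse z) * (1 / 2) - of_real (b i)) * jost_plus a b z i
          - of_real (a i) * jost_plus a b z (i + 1) = of_real (a (i - 1)) * jost_plus a b z (i - 1)"
        unfolding left_diff_distrib times_divide_eq_right mult_1_right eq[symmetric] by (simp add: jacobi_op_def)
      show "of_real (1 / a (i - 1)) * (((z + inverse z) * (1 / 2) - of_real (b i)) * jost_plus a b z i
          - of_real (a i) * jost_plus a b z (i + 1)) = jost_plus a b z (i - 1)"
        unfolding E using a[of "i - 1"] by simp
    qed
    then show ?case using step2 by simp
  qed
  then show ?thesis ..
qed

section \<open>Wronskians at the spectral edges\<close>

text \<open>
The division by z - e costs no moment. With y = ze and g_k = h_k(z) h_k(e), Green's formula says that the
Wronskian drops by (z - e)^2 / (2z) y^(N+k) g_k on passing to the site N + k. Since e(y - 1) = z - e, summing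
this by parts absorbs one factor z - e into the powers of y and leaves, apart from a boundary term, the
differences of g, which are summable in A_j. In the proof the result Y of this summation is simply written
down, with Y k belonging to the site N + k: the Wronskian and (z - e) e Y / (2z) satisfy the same first-order
recurrence, hence differ by a constant E, and E is 0 because both sides, divided by y^(N+k), have the same
limit (e - z)/2.
\<close>
lemma jost_plus_wronskian_quotient_far:
  assumes a: "\<And>n. a n > 0" and m: "right_moment j a b" and e: "e = 1 \<or> e = -1"
  obtains N X where "weighted_wiener j X"
    "\<And>z. z \<in> sphere 0 1 \<Longrightarrow> wronskian a (jost_plus a b z) (jost_plus a b e) (int N) = (z - e) * X z"
proof -
  obtain N h V where hb: "\<And>n. wiener_norm_le j (h n) 2"
    and ht: "\<And>z. z \<in> sphere 0 1 \<Longrightarrow> (\<lambda>n. h n z) \<longlonglongrightarrow> 1"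
    and V: "summable V"
    and hd: "\<And>n. wiener_norm_le j (\<lambda>z. z ^ n * (h n z - h (Suc n) z)) (V n)"
    and hp: "\<And>n z. z \<in> sphere 0 1 \<Longrightarrow> (1 + real n) ^ j * norm (h n z - h (Suc n) z) \<le> V n"
    and J: "\<And>z. z \<in> sphere 0 1 \<Longrightarrow> is_jost_plus a b z (jost_plus a b z)"
    and Jh: "\<And>n z. z \<in> sphere 0 1 \<Longrightarrow> jost_plus a b z (int (N + n)) = z ^ (N + n) * h n z"
    by (rule jost_plus_representation[OF a m]) blast
  have eS: "e \<in> sphere 0 1" and e2: "e * e = 1" and ne: "norm e = 1" and e0: "e \<noteq> 0"
    using e by auto
  define g where "g k z = h k z * h k e" for k z
  (* The term of the summation by parts that belongs to the site N + i. *)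
  define T where "T i z = (z * e) ^ (N + i + 1) * (g i z - g (Suc i) z)" for i z
  have Tb: "wiener_norm_le j (T i) ((1 + real (N + 1)) ^ j * (4 * V i))" for i
  proof -
    have he: "norm (h i e) \<le> 2" for i by (rule wn.norm_le_bound[OF hb eS])
    have V0: "0 \<le> V i" by (rule wn.bounded_by_nonneg[OF hd])
    have b1: "wiener_norm_le j (\<lambda>z. h i e * (z ^ i * (h i z - h (Suc i) z))) (2 * V i)"
      by (rule wn.bounded_by_mono[OF wn.bounded_by_cmult[OF hd]]) (use he[of i] V0 in \<open>simp add: mult_right_mono\<close>)
    have b2: "wiener_norm_le j (\<lambda>z. (h i e - h (Suc i) e) * (z ^ i * h (Suc i) z)) (2 * V i)"
      by (rule wn.bounded_by_mono[OF wn.bounded_by_cmult[OF wiener_norm_le_power_mult[OF hb]]])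
         (use hp[OF eS, of i] in \<open>simp add: mult_ac\<close>)
    have "wiener_norm_le j (\<lambda>z. h i e * (z ^ i * (h i z - h (Suc i) z)) + (h i e - h (Suc i) e) * (z ^ i * h (Suc i) z)) (4 * V i)"
      by (rule wn.bounded_by_mono[OF wn.bounded_by_add[OF b1 b2]]) simp
    from wn.bounded_by_cmult[OF wiener_norm_le_power_mult[OF this, of "N + 1"], of "e ^ (N + i + 1)"]
    have "wiener_norm_le j (\<lambda>z. e ^ (N + i + 1) * (z ^ (N + 1) * (h i e * (z ^ i * (h i z - h (Suc i) z))
        + (h i e - h (Suc i) e) * (z ^ i * h (Suc i) z)))) ((1 + real (N + 1)) ^ j * (4 * V i))"
      by (simp only: pweight_0 norm_power ne power_one mult_1_left)
    then show ?thesis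
      by (rule wn.bounded_by_cong) (simp add: T_def g_def power_mult_distrib power_add algebra_simps)
  qed
  have TV: "summable (\<lambda>i. (1 + real (N + 1)) ^ j * (4 * V i))" by (intro summable_mult V)
  have TV1: "summable (\<lambda>i. (1 + real (N + 1)) ^ j * (4 * V (Suc i)))"
    using TV by (subst summable_Suc_iff[of "\<lambda>i. (1 + real (N + 1)) ^ j * (4 * V i)"])
  define D where "D k z = (\<Sum>i. T (i + Suc k) z)" for k z
  define Y where "Y k z = D k z - (z * e) ^ (N + k + 1) * g (Suc k) z" for k z
  define X where "X z = e * (1 / 2) * inverse z * Y 0 z" for z
  have "weighted_wiener j (\<lambda>z. \<Sum>i. T (Suc i) z)"
    unfolding weighted_wiener_def using wn.bounded_by_suminf(1)[OF Tb TV1] by blast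
  then have "weighted_wiener j (D 0)" by (simp add: D_def[abs_def])
  moreover have "weighted_wiener j (h (Suc 0))" using hb weighted_wiener_def by blast
  ultimately have XW: "weighted_wiener j X"
    unfolding X_def Y_def g_def power_mult_distrib by (intro weighted_wiener_intros)
  have "wronskian a (jost_plus a b z) (jost_plus a b e) (int N) = (z - e) * X z" if z: "z \<in> sphere 0 1" for z
  proof -
    have z0: "z \<noteq> 0" and nz: "norm z = 1" using z by auto
    define y where "y = z * e"
    have ny: "norm (y ^ k) = 1" and y0: "y \<noteq> 0" for k using nz ne e0 z0 by (simp_all add: y_def norm_mult norm_power)
    have Ts: "summable (\<lambda>i. T i z)" by (rule summable_norm_cancel, rule wn.bounded_by_suminf(2)[OF Tb TV z])
    have D0: "(\<lambda>k. D k z) \<longlonglongrightarrow> 0"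
      unfolding D_def using LIMSEQ_Suc[OF suminf_tail_tendsto_0[OF Ts]] .
    have DS: "D k z = T (Suc k) z + D (Suc k) z" for k
    proof -
      have "summable (\<lambda>i. T (i + Suc k) z)" using Ts by (subst summable_iff_shift)
      from suminf_split_head[OF this] show ?thesis by (simp add: D_def)
    qed
    have Ty: "T i z = y ^ (N + i + 1) * (g i z - g (Suc i) z)"
      and Yy: "Y i z = D i z - y ^ (N + i + 1) * g (Suc i) z" for i
      by (simp_all only: T_def Y_def y_def)
    have YS: "Y k z - Y (Suc k) z = (y - 1) * (y ^ (N + k + 1) * g (Suc k) z)" for k
      unfolding Yy DS[of k] Ty by (simp add: algebra_simps)
    (* With this c the energy difference is c (y - 1). *)
    define c where "c = (z - e) * (e / (2 * z))"
    have cy: "((z + inverse z) / 2 - (e + inverse e) / 2) = c * (y - 1)"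
    proof -
      have "inverse e = e" using e by auto
      moreover have "e * (y - 1) = z - e" using e by (auto simp: y_def)
      then have "c * (y - 1) = (z - e) * (z - e) / (2 * z)" by (simp add: c_def)
      moreover have "(z - e) * (z - e) = z * z - 2 * (z * e) + 1" using e2 by (simp add: algebra_simps)
      ultimately show ?thesis using z0 by (simp add: field_simps)
    qed
    define Wk where "Wk k = wronskian a (jost_plus a b z) (jost_plus a b e) (int (N + k))" for k
    have uv: "jost_plus a b z (int (N + k)) * jost_plus a b e (int (N + k)) = y ^ (N + k) * g k z" for k
      unfolding Jh[OF z] Jh[OF eS] by (simp add: y_def g_def power_mult_distrib)
    have WS: "Wk k = Wk (Suc k) + c * (y - 1) * (y ^ (N + Suc k) * g (Suc k) z)" for k
    proof -
      have "jacobi_solution a b z (jost_plus a b z)" "jacobi_solution a b e (jost_plus a b e)"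
        using J[OF z] J[OF eS] by (auto simp: is_jost_plus_def)
      from wronskian_step[OF this, of "int (N + Suc k)"]
      show ?thesis unfolding cy mult.assoc uv by (simp add: Wk_def mult.assoc)
    qed
    define E where "E k = Wk k - c * Y k z" for k
    have ES: "E (Suc k) = E k" for k
    proof -
      have cY: "c * Y k z - c * Y (Suc k) z = c * (y - 1) * (y ^ (N + Suc k) * g (Suc k) z)"
        unfolding right_diff_distrib[symmetric] YS by (simp add: mult.assoc)
      show ?thesis unfolding E_def WS[of k] cY[symmetric] by simp
    qed
    have Econst: "E k = E 0" for k by (induction k) (simp_all add: ES)
    have Wy: "Wk k = y ^ (N + k) * (of_real (a (int (N + k))) * (e * h k z * h (Suc k) e - z * h (Suc k) z * h k e))" for k
    proof -
      have i: "int (N + k) + 1 = int (N + Suc k)" by simp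
      show ?thesis unfolding Wk_def wronskian_def i Jh[OF z] Jh[OF eS]
        by (simp add: y_def power_mult_distrib algebra_simps)
    qed
    have Ey: "inverse (y ^ (N + k)) * E k = of_real (a (int (N + k))) * (e * h k z * h (Suc k) e - z * h (Suc k) z * h k e)
        - c * (inverse (y ^ (N + k)) * D k z - y * g (Suc k) z)" for k
      unfolding E_def Wy Yy using y0 by (simp add: field_simps)
    have "(\<lambda>k. norm (inverse (y ^ (N + k)) * D k z)) \<longlonglongrightarrow> 0"
      using tendsto_norm_zero[OF D0] by (simp add: norm_mult norm_inverse ny)
    then have yD: "(\<lambda>k. inverse (y ^ (N + k)) * D k z) \<longlonglongrightarrow> 0" by (rule tendsto_norm_zero_cancel)
    have hz: "(\<lambda>k. h k z) \<longlonglongrightarrow> 1" "(\<lambda>k. h (Suc k) z) \<longlonglongrightarrow> 1"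
      and he: "(\<lambda>k. h k e) \<longlonglongrightarrow> 1" "(\<lambda>k. h (Suc k) e) \<longlonglongrightarrow> 1"
      using ht[OF z] ht[OF eS] LIMSEQ_Suc by auto
    have gl: "(\<lambda>k. g (Suc k) z) \<longlonglongrightarrow> 1" unfolding g_def using tendsto_mult[OF hz(2) he(2)] by simp
    have al: "(\<lambda>k. a (int (N + k))) \<longlonglongrightarrow> 1 / 2"
      using LIMSEQ_ignore_initial_segment[OF right_moment_tendsto[OF m], of N] by (simp add: add.commute)
    have "(\<lambda>k. inverse (y ^ (N + k)) * E k) \<longlonglongrightarrow>
        of_real (1 / 2) * (e * 1 * 1 - z * 1 * 1) - c * (0 - y * 1)"
      unfolding Ey by (intro tendsto_intros al hz he yD gl)
    moreover have "of_real (1 / 2) * (e * 1 * 1 - z * 1 * 1) - c * (0 - y * 1) = 0"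
    proof -
      have "e * y = z" using e by (auto simp: y_def)
      moreover have "c * y = (z - e) * (e * y) / (2 * z)" by (simp add: c_def mult.assoc)
      ultimately have "c * y = (z - e) / 2" using z0 by simp
      then show ?thesis by (simp add: field_simps)
    qed
    ultimately have "(\<lambda>k. norm (inverse (y ^ (N + k)) * E k)) \<longlonglongrightarrow> 0" by (simp add: tendsto_norm_zero)
    moreover have "norm (inverse (y ^ (N + k)) * E k) = norm (E 0)" for k
      using Econst[of k] by (simp add: norm_mult norm_inverse ny)
    ultimately have "(\<lambda>k. norm (E 0)) \<longlonglongrightarrow> 0" by simp
    then have "E 0 = 0" by (simp add: LIMSEQ_const_iff)
    moreover have "c = (z - e) * (e * (1 / 2) * inverse z)"
      by (simp add: c_def inverse_eq_divide)
    then have "c * Y 0 z = (z - e) * X z" by (simp only: X_def mult.assoc)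
    ultimately show ?thesis unfolding E_def Wk_def add_0_right right_minus_eq by (rule trans)
  qed
  with XW show thesis by (rule that)
qed

text \<open>
What the final argument uses of a Jost solution; the property passes to complex conjugates and to the mirror
image.
\<close>
definition regular_family ::
  "nat \<Rightarrow> (int \<Rightarrow> real) \<Rightarrow> (int \<Rightarrow> real) \<Rightarrow> (complex \<Rightarrow> int \<Rightarrow> complex) \<Rightarrow> bool" where
  "regular_family j a b u \<longleftrightarrow>
     (\<forall>z\<in>sphere 0 1. jacobi_solution a b z (u z) \<and> (\<exists>n. u z n \<noteq> 0)) \<and>
     (\<forall>n. weighted_wiener j (\<lambda>z. u z n)) \<and>
     (\<forall>e\<in>{1,-1}. \<forall>n. \<exists>X. weighted_wiener j X \<and> (\<forall>z\<in>sphere 0 1. wronskian a (u z) (u e) n = (z - e) * X z))"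

text \<open>
By Green's formula, moving the Wronskian by one site changes the quotient by an element of A_j, so
divisibility at a single site N suffices.
\<close>
lemma regular_familyI:
  assumes sol: "\<And>z. z \<in> sphere 0 1 \<Longrightarrow> jacobi_solution a b z (u z)"
    and nontriv: "\<And>z. z \<in> sphere 0 1 \<Longrightarrow> \<exists>n. u z n \<noteq> 0"
    and W: "\<And>n. weighted_wiener j (\<lambda>z. u z n)"
    and Q: "\<And>e. e = 1 \<or> e = -1 \<Longrightarrow> \<exists>N X. weighted_wiener j X \<and> (\<forall>z\<in>sphere 0 1. wronskian a (u z) (u e) N = (z - e) * X z)"
  shows "regular_family j a b u"
proof -
  have "\<exists>X. weighted_wiener j X \<and> (\<forall>z\<in>sphere 0 1. wronskian a (u z) (u e) n = (z - e) * X z)"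
    if e: "e = 1 \<or> e = -1" for e n
  proof -
    have eS: "e \<in> sphere 0 1" using e by auto
    define dX where "dX n z = (z - e) * ((1 / 2) * inverse z * u z n * u e n)" for n z
    have dXW: "weighted_wiener j (dX n)" for n unfolding dX_def by (intro weighted_wiener_intros W)
    have step: "wronskian a (u z) (u e) (n - 1) = wronskian a (u z) (u e) n + (z - e) * dX n z"
      if z: "z \<in> sphere 0 1" for z n
    proof -
      have z0: "z \<noteq> 0" using z by auto
      have "(z + inverse z) / 2 - (e + inverse e) / 2 = (z - e) * (z - e) * ((1 / 2) * inverse z)"
        using e z0 by (auto simp: field_simps)
      then show ?thesis unfolding wronskian_step[OF sol[OF z] sol[OF eS]] dX_def by (simp add: mult_ac)
    qed
    obtain N X where X: "weighted_wiener j X" "\<And>z. z \<in> sphere 0 1 \<Longrightarrow> wronskian a (u z) (u e) N = (z - e) * X z"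
      using Q[OF e] by blast
    show ?thesis
    proof (induction n rule: int_induct[of _ N])
      case base show ?case using X by blast
    next
      case (step1 i)
      then obtain X where X: "weighted_wiener j X" "\<And>z. z \<in> sphere 0 1 \<Longrightarrow> wronskian a (u z) (u e) i = (z - e) * X z"
        by blast
      show ?case
      proof (intro exI conjI ballI)
        show "weighted_wiener j (\<lambda>z. X z - dX (i + 1) z)" by (intro weighted_wiener_intros X dXW)
        show "wronskian a (u z) (u e) (i + 1) = (z - e) * (X z - dX (i + 1) z)" if "z \<in> sphere 0 1" for z
          using step[OF that, of "i + 1"] X(2)[OF that] by (simp add: algebra_simps)
      qed
    next
      case (step2 i)
      then obtain X where X: "weighted_wiener j X" "\<And>z. z \<in> sphere 0 1 \<Longrightarrow> wronskian a (u z) (u e) i = (z - e) * X z"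
        by blast
      show ?case
      proof (intro exI conjI ballI)
        show "weighted_wiener j (\<lambda>z. X z + dX i z)" by (intro weighted_wiener_intros X dXW)
        show "wronskian a (u z) (u e) (i - 1) = (z - e) * (X z + dX i z)" if "z \<in> sphere 0 1" for z
          using step[OF that, of i] X(2)[OF that] by (simp add: algebra_simps)
      qed
    qed
  qed
  with sol nontriv W show ?thesis unfolding regular_family_def by simp
qed

lemma is_jost_plus_nontrivial:
  assumes "is_jost_plus a b z u" shows "\<exists>n. u n \<noteq> 0"
proof (rule ccontr)
  assume "\<not> ?thesis"
  then have "(\<lambda>k. 0 :: complex) \<longlonglongrightarrow> 1" using is_jost_plus_seq[OF assms] by simp
  then show False by (simp add: LIMSEQ_const_iff)
qed

lemma regular_family_jost_plus:
  assumes a: "\<And>n. a n > 0" and m: "right_moment j a b"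
  shows "regular_family j a b (jost_plus a b)"
proof (rule regular_familyI)
  show "weighted_wiener j (\<lambda>z. jost_plus a b z n)" for n by (rule jost_plus_weighted_wiener[OF a m])
  show "jacobi_solution a b z (jost_plus a b z)" "\<exists>n. jost_plus a b z n \<noteq> 0" if "z \<in> sphere 0 1" for z
    using jost_plus_is_jost_plus[OF a m that] is_jost_plus_nontrivial[OF jost_plus_is_jost_plus[OF a m that]]
    by (simp_all add: is_jost_plus_def)
  show "\<exists>N X. weighted_wiener j X \<and> (\<forall>z\<in>sphere 0 1. wronskian a (jost_plus a b z) (jost_plus a b e) N = (z - e) * X z)"
    if "e = 1 \<or> e = -1" for e
    by (rule jost_plus_wronskian_quotient_far[OF a m that]) (intro exI conjI ballI)
qed

lemma jacobi_solution_cnj: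
  assumes z: "z \<in> sphere 0 1" and u: "jacobi_solution a b z u"
  shows "jacobi_solution a b z (\<lambda>n. cnj (u n))"
  unfolding jacobi_solution_def
proof
  fix n
  have c: "cnj z = inverse z" using circle_inverse_cnj[OF z] by simp
  have "jacobi_op a b u n = (z + inverse z) / 2 * u n" using u by (simp add: jacobi_solution_def)
  from arg_cong[OF this, of cnj]
  show "jacobi_op a b (\<lambda>n. cnj (u n)) n = (z + inverse z) / 2 * cnj (u n)"
    by (simp add: jacobi_op_def c add.commute)
qed

lemma wronskian_cnj: "wronskian a (\<lambda>n. cnj (u n)) (\<lambda>n. cnj (v n)) n = cnj (wronskian a u v n)"
  by (simp add: wronskian_def)

lemma regular_family_cnj:
  assumes u: "regular_family j a b u"
  shows "regular_family j a b (\<lambda>z n. cnj (u z n))"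
proof (rule regular_familyI)
  show "weighted_wiener j (\<lambda>z. cnj (u z n))" for n
    using u unfolding regular_family_def by (intro weighted_wiener_cnj) blast
  show "jacobi_solution a b z (\<lambda>n. cnj (u z n))" "\<exists>n. cnj (u z n) \<noteq> 0" if "z \<in> sphere 0 1" for z
    using u that jacobi_solution_cnj[OF that] unfolding regular_family_def by auto
  fix e :: complex assume e: "e = 1 \<or> e = -1"
  then obtain X where X: "weighted_wiener j X" "\<And>z. z \<in> sphere 0 1 \<Longrightarrow> wronskian a (u z) (u e) 0 = (z - e) * X z"
    using u unfolding regular_family_def by blast
  have "wronskian a (\<lambda>n. cnj (u z n)) (\<lambda>n. cnj (u e n)) 0 = (z - e) * (- e * inverse z * cnj (X z))"
    if z: "z \<in> sphere 0 1" for z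
  proof -
    have "z \<noteq> 0" using z by auto
    then have "cnj (z - e) = (z - e) * (- e * inverse z)"
      using e circle_inverse_cnj[OF z] by (auto simp: field_simps)
    then show ?thesis unfolding wronskian_cnj X(2)[OF z] by simp
  qed
  moreover have "weighted_wiener j (\<lambda>z. - e * inverse z * cnj (X z))" by (intro weighted_wiener_intros X)
  ultimately show "\<exists>N X. weighted_wiener j X \<and> (\<forall>z\<in>sphere 0 1. wronskian a (\<lambda>n. cnj (u z n)) (\<lambda>n. cnj (u e n)) N = (z - e) * X z)"
    by blast
qed

section \<open>The mirror image of the lattice\<close>

text \<open>
The reflection n \<mapsto> -n exchanges the two Jost solutions. The weight a(n) belongs to the edge between n
and n+1, whence the shift by one.
\<close>
definition reflect_a :: "(int \<Rightarrow> real) \<Rightarrow> int \<Rightarrow> real" where "reflect_a a n = a (- n - 1)"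

definition reflect_b :: "(int \<Rightarrow> real) \<Rightarrow> int \<Rightarrow> real" where "reflect_b b n = b (- n)"

lemma reflect_reflect: "reflect_a (reflect_a a) = a" "reflect_b (reflect_b b) = b"
  by (auto simp: reflect_a_def reflect_b_def fun_eq_iff)

lemma jacobi_solution_reflect:
  assumes "jacobi_solution a b z u"
  shows "jacobi_solution (reflect_a a) (reflect_b b) z (\<lambda>n. u (- n))"
  unfolding jacobi_solution_def
proof
  fix n
  have "jacobi_op (reflect_a a) (reflect_b b) (\<lambda>n. u (- n)) n = jacobi_op a b u (- n)"
  proof -
    have "- (n - 1) - 1 = - n" "- (n - 1) = - n + 1" "- (n + 1) = - n - 1" by auto
    then show ?thesis by (simp only: jacobi_op_def reflect_a_def reflect_b_def add_ac)
  qed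
  then show "jacobi_op (reflect_a a) (reflect_b b) (\<lambda>n. u (- n)) n = (z + inverse z) / 2 * u (- n)"
    using assms by (simp add: jacobi_solution_def)
qed

lemma wronskian_reflect: "wronskian (reflect_a a) (\<lambda>n. u (- n)) (\<lambda>n. v (- n)) n = - wronskian a u v (- n - 1)"
proof -
  have "- (n + 1) = - n - 1" "- n - 1 + 1 = - n" by auto
  then show ?thesis by (simp only: wronskian_def reflect_a_def) (simp add: right_diff_distrib)
qed

lemma jost_minus_reflect:
  assumes a: "\<And>n. a n > 0" and m: "right_moment j (reflect_a a) (reflect_b b)" and z: "z \<in> sphere 0 1"
  shows "jost_minus a b z = (\<lambda>n. jost_plus (reflect_a a) (reflect_b b) z (- n))"
proof -
  have a': "\<And>n. reflect_a a n > 0" by (simp add: reflect_a_def a)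
  have iff: "jacobi_solution a b z u \<and> ((\<lambda>n. z powi n * u n) \<longlongrightarrow> 1) at_bot
      \<longleftrightarrow> is_jost_plus (reflect_a a) (reflect_b b) z (\<lambda>n. u (- n))" for u
  proof -
    have "((\<lambda>n. z powi n * u n) \<longlongrightarrow> 1) at_bot \<longleftrightarrow> ((\<lambda>n. z powi (- n) * u (- n)) \<longlongrightarrow> 1) at_top"
      by (simp add: filterlim_def at_bot_mirror filtermap_filtermap)
    moreover have "jacobi_solution a b z u \<longleftrightarrow> jacobi_solution (reflect_a a) (reflect_b b) z (\<lambda>n. u (- n))"
      using jacobi_solution_reflect[of a b z u] jacobi_solution_reflect[of "reflect_a a" "reflect_b b" z "\<lambda>n. u (- n)"]
      by (auto simp: reflect_reflect)
    ultimately show ?thesis by (simp add: is_jost_plus_def)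
  qed
  have J: "is_jost_plus (reflect_a a) (reflect_b b) z (jost_plus (reflect_a a) (reflect_b b) z)"
    by (rule jost_plus_is_jost_plus[OF a' m z])
  show ?thesis unfolding jost_minus_def
  proof (rule the_equality)
    show "jacobi_solution a b z (\<lambda>n. jost_plus (reflect_a a) (reflect_b b) z (- n)) \<and>
        ((\<lambda>n. z powi n * jost_plus (reflect_a a) (reflect_b b) z (- n)) \<longlongrightarrow> 1) at_bot"
      unfolding iff using J by simp
    fix u assume "jacobi_solution a b z u \<and> ((\<lambda>n. z powi n * u n) \<longlongrightarrow> 1) at_bot"
    then have "jost_plus (reflect_a a) (reflect_b b) z = (\<lambda>n. u (- n))"
      unfolding iff by (rule jost_plus_eqI[OF a' m z])
    then show "u = (\<lambda>n. jost_plus (reflect_a a) (reflect_b b) z (- n))" by simp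
  qed
qed

lemma regular_family_jost_minus:
  assumes a: "\<And>n. a n > 0" and m: "right_moment j (reflect_a a) (reflect_b b)"
  shows "regular_family j a b (jost_minus a b)"
proof (rule regular_familyI)
  let ?u = "jost_plus (reflect_a a) (reflect_b b)"
  have a': "\<And>n. reflect_a a n > 0" by (simp add: reflect_a_def a)
  have r: "regular_family j (reflect_a a) (reflect_b b) ?u" by (rule regular_family_jost_plus[OF a' m])
  note jm = jost_minus_reflect[OF a m]
  show "weighted_wiener j (\<lambda>z. jost_minus a b z n)" for n
    by (rule weighted_wiener_cong[of j "\<lambda>z. ?u z (- n)"]) (use r jm in \<open>auto simp: regular_family_def\<close>)
  show "jacobi_solution a b z (jost_minus a b z)" "\<exists>n. jost_minus a b z n \<noteq> 0" if z: "z \<in> sphere 0 1" for z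
  proof -
    have *: "jacobi_solution (reflect_a a) (reflect_b b) z (?u z)" "\<exists>n. ?u z n \<noteq> 0"
      using r z unfolding regular_family_def by blast+
    show "jacobi_solution a b z (jost_minus a b z)"
      using jacobi_solution_reflect[OF *(1)] by (simp add: jm[OF z] reflect_reflect)
    show "\<exists>n. jost_minus a b z n \<noteq> 0" using *(2) unfolding jm[OF z] by (metis minus_minus)
  qed
  fix e :: complex assume e: "e = 1 \<or> e = -1"
  then have eS: "e \<in> sphere 0 1" by auto
  obtain X where X: "weighted_wiener j X"
    "\<And>z. z \<in> sphere 0 1 \<Longrightarrow> wronskian (reflect_a a) (?u z) (?u e) 0 = (z - e) * X z"
    using r e unfolding regular_family_def by blast
  have "wronskian a (jost_minus a b z) (jost_minus a b e) (-1) = (z - e) * (- X z)" if z: "z \<in> sphere 0 1" for z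
    using wronskian_reflect[of a "jost_minus a b z" "jost_minus a b e" 0] X(2)[OF z]
    by (simp add: jm[OF z] jm[OF eS])
  moreover have "weighted_wiener j (\<lambda>z. - X z)" by (intro weighted_wiener_intros X)
  ultimately show "\<exists>N X. weighted_wiener j X \<and> (\<forall>z\<in>sphere 0 1. wronskian a (jost_minus a b z) (jost_minus a b e) N = (z - e) * X z)"
    by blast
qed

section \<open>Resonances\<close>

text \<open>
At a resonance v(e) = \<kappa> u(e), and the Pluecker relation among u(z), v(z) and u(e) expresses [u(z),v(z)]
by [u(z),u(e)] and [v(z),v(e)], which are divisible by z - e in A_j. The relation is a vector identity; it is
evaluated at a site i where u(e) does not vanish, and one of 0 and 1 will do.
\<close>
lemma regular_family_resonance:
  assumes a: "\<And>n. a n > 0" and u: "regular_family j a b u" and v: "regular_family j a b v"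
    and e: "e = 1 \<or> e = -1" and res: "wronskian a (u e) (v e) 0 = 0"
  obtains X where "weighted_wiener j X"
    "\<And>z. z \<in> sphere 0 1 \<Longrightarrow> wronskian a (u z) (v z) 0 = (z - e) * X z"
proof -
  have eS: "e \<in> sphere 0 1" using e by auto
  have nt: "u e 0 \<noteq> 0 \<or> u e 1 \<noteq> 0" "v e 0 \<noteq> 0 \<or> v e 1 \<noteq> 0"
    using u v eS jacobi_solution_eq_0[OF a, where u = "u e" and N = 0]
      jacobi_solution_eq_0[OF a, where u = "v e" and N = 0]
    unfolding regular_family_def by fastforce+
  have det: "u e 0 * v e 1 = u e 1 * v e 0" using res a[of 0] by (simp add: wronskian_def)
  obtain i where i: "i = 0 \<or> i = 1" "u e i \<noteq> 0" using nt(1) by blast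
  define \<kappa> where "\<kappa> = v e i / u e i"
  have v0: "v e 0 = \<kappa> * u e 0" and v1: "v e 1 = \<kappa> * u e 1"
    using i det by (auto simp: \<kappa>_def field_simps)
  then have k0: "\<kappa> \<noteq> 0" using nt(2) by auto
  obtain Xu Xv where Xu: "weighted_wiener j Xu" "\<And>z. z \<in> sphere 0 1 \<Longrightarrow> wronskian a (u z) (u e) 0 = (z - e) * Xu z"
    and Xv: "weighted_wiener j Xv" "\<And>z. z \<in> sphere 0 1 \<Longrightarrow> wronskian a (v z) (v e) 0 = (z - e) * Xv z"
    using u v e unfolding regular_family_def by (metis insert_iff)
  define X where "X z = inverse (u e i) * (Xu z * v z i - inverse \<kappa> * Xv z * u z i)" for z
  have uW: "weighted_wiener j (\<lambda>z. u z i)" and vW: "weighted_wiener j (\<lambda>z. v z i)"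
    using u v unfolding regular_family_def by blast+
  have XW: "weighted_wiener j X" unfolding X_def by (intro weighted_wiener_intros Xu Xv uW vW)
  have "wronskian a (u z) (v z) 0 = (z - e) * X z" if z: "z \<in> sphere 0 1" for z
  proof -
    have A: "wronskian a (u z) (v z) 0 * u e i = wronskian a (u z) (u e) 0 * v z i - wronskian a (v z) (u e) 0 * u z i"
      using i(1) by (auto simp: wronskian_def algebra_simps)
    have "wronskian a (v z) (v e) 0 = \<kappa> * wronskian a (v z) (u e) 0"
      using v0 v1 by (simp add: wronskian_def algebra_simps)
    then have B: "wronskian a (v z) (u e) 0 = inverse \<kappa> * ((z - e) * Xv z)"
      using Xv(2)[OF z] k0 by (simp add: field_simps)
    have C: "X z * u e i = Xu z * v z i - inverse \<kappa> * Xv z * u z i"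
      using i(2) by (simp add: X_def)
    have "wronskian a (u z) (v z) 0 * u e i = (z - e) * (X z * u e i)"
      unfolding A B C Xu(2)[OF z] by (simp add: algebra_simps)
    then show ?thesis using i(2) by simp
  qed
  with XW show thesis by (rule that)
qed

section \<open>The scattering coefficients\<close>

text \<open>
The constant Wronskian is read off at infinity, where the solution behaves like z^n.
\<close>
lemma wronskian_jost_plus_cnj:
  assumes a: "\<And>n. a n > 0" and m: "right_moment j a b" and z: "z \<in> sphere 0 1"
  shows "wronskian a (jost_plus a b z) (\<lambda>n. cnj (jost_plus a b z n)) n = (inverse z - z) / 2"
proof -
  let ?f = "jost_plus a b z"
  have J: "is_jost_plus a b z ?f" by (rule jost_plus_is_jost_plus[OF a m z])
  then have sol: "jacobi_solution a b z ?f" by (simp add: is_jost_plus_def)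
  define s where "s k = z powi (- int k) * ?f (int k)" for k
  have s: "s \<longlonglongrightarrow> 1" unfolding s_def by (rule is_jost_plus_seq[OF J])
  have z0: "z \<noteq> 0" and zc: "cnj z = inverse z" using z circle_inverse_cnj[OF z] by auto
  have f: "?f (int k) = z ^ k * s k" for k using z0 by (simp add: s_def power_int_minus power_int_of_nat)
  have W: "wronskian a ?f (\<lambda>n. cnj (?f n)) (int k)
      = of_real (a (int k)) * (inverse z * (s k * cnj (s (Suc k))) - z * (s (Suc k) * cnj (s k)))" for k
  proof -
    have i: "int k + 1 = int (Suc k)" by simp
    have zz: "z ^ k * inverse z ^ k = 1" using z0 by (simp add: power_inverse)
    have "?f (int k) * cnj (?f (int (Suc k))) = (z ^ k * inverse z ^ k) * (inverse z * (s k * cnj (s (Suc k))))"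
      unfolding f by (simp add: zc)
    moreover have "?f (int (Suc k)) * cnj (?f (int k)) = (z ^ k * inverse z ^ k) * (z * (s (Suc k) * cnj (s k)))"
      unfolding f by (simp add: zc)
    ultimately show ?thesis unfolding wronskian_def i zz by simp
  qed
  have "(\<lambda>k. of_real (a (int k)) * (inverse z * (s k * cnj (s (Suc k))) - z * (s (Suc k) * cnj (s k))))
      \<longlonglongrightarrow> of_real (1 / 2) * (inverse z * (1 * cnj 1) - z * (1 * cnj 1))"
    using LIMSEQ_Suc[OF s] by (intro tendsto_intros right_moment_tendsto[OF m] s)
  moreover have "wronskian a ?f (\<lambda>n. cnj (?f n)) (int k) = wronskian a ?f (\<lambda>n. cnj (?f n)) n" for k
    by (rule wronskian_const[OF sol jacobi_solution_cnj[OF z sol]])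
  ultimately show ?thesis unfolding W[symmetric] by (simp add: LIMSEQ_const_iff)
qed

lemma weighted_l1_right_moments:
  assumes "(\<lambda>n. \<bar>a n - 1 / 2\<bar> + \<bar>b n\<bar>) \<in> weighted_l1 (j + 1)"
  shows "right_moment j a b" "right_moment j (reflect_a a) (reflect_b b)"
proof -
  define q where "q n = (1 + \<bar>real_of_int n\<bar>) ^ (j + 1) * (\<bar>a n - 1 / 2\<bar> + \<bar>b n\<bar>)" for n
  have q: "q summable_on UNIV"
    using assms by (simp add: weighted_l1_def q_def[abs_def] abs_of_nonneg)
  have sub: "summable (\<lambda>n::nat. q (f n))" if "inj f" for f :: "nat \<Rightarrow> int"
  proof -
    have "q summable_on range f" by (rule summable_on_subset[OF q]) auto
    then have "(q \<circ> f) summable_on UNIV" using that by (simp add: summable_on_reindex)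
    then show ?thesis by (simp add: o_def summable_on_imp_summable)
  qed
  have "summable (\<lambda>n. q (int n))" by (rule sub) (simp add: inj_def)
  then show "right_moment j a b" by (simp add: right_moment_def q_def)
  have s1: "summable (\<lambda>n. q (- int n - 1))" by (rule sub) (simp add: inj_def)
  have s2: "summable (\<lambda>n. q (- int n))" by (rule sub) (simp add: inj_def)
  show "right_moment j (reflect_a a) (reflect_b b)"
    unfolding right_moment_def
  proof (rule summable_comparison_test'[OF summable_add[OF s1 s2], of 0])
    fix n :: nat
    have "(1 + real n) ^ (j + 1) * \<bar>a (- int n - 1) - 1 / 2\<bar>
        \<le> (1 + \<bar>real_of_int (- int n - 1)\<bar>) ^ (j + 1) * (\<bar>a (- int n - 1) - 1 / 2\<bar> + \<bar>b (- int n - 1)\<bar>)"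
      by (rule mult_mono[OF power_mono]) auto
    moreover have "(1 + real n) ^ (j + 1) * \<bar>b (- int n)\<bar>
        \<le> (1 + \<bar>real_of_int (- int n)\<bar>) ^ (j + 1) * (\<bar>a (- int n) - 1 / 2\<bar> + \<bar>b (- int n)\<bar>)"
      by (rule mult_mono[OF power_mono]) auto
    moreover have "norm ((1 + real n) ^ (j + 1) * (\<bar>reflect_a a (int n) - 1 / 2\<bar> + \<bar>reflect_b b (int n)\<bar>))
        = (1 + real n) ^ (j + 1) * \<bar>a (- int n - 1) - 1 / 2\<bar> + (1 + real n) ^ (j + 1) * \<bar>b (- int n)\<bar>"
      by (simp only: reflect_a_def reflect_b_def distrib_left[symmetric]) (simp add: abs_mult)
    ultimately show "norm ((1 + real n) ^ (j + 1) * (\<bar>reflect_a a (int n) - 1 / 2\<bar> + \<bar>reflect_b b (int n)\<bar>))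
        \<le> q (- int n - 1) + q (- int n)"
      unfolding q_def by linarith
  qed
qed

lemma circle_point_cluster:
  assumes "z \<in> sphere (0::complex) 1" shows "at z within sphere 0 1 \<noteq> bot"
proof -
  have "connected (sphere (0::complex) 1)" by (rule connected_sphere) simp
  moreover have "\<nexists>a. sphere (0::complex) 1 = {a}"
  proof
    assume "\<exists>a. sphere (0::complex) 1 = {a}"
    then obtain a where "sphere (0::complex) 1 = {a}" ..
    moreover have "(1::complex) \<in> sphere 0 1" "(-1::complex) \<in> sphere 0 1" by auto
    ultimately have "(1::complex) = -1" by auto
    then show False by simp
  qed
  ultimately show ?thesis using connected_imp_perfect[of "sphere 0 1" z] assms
    by (simp add: trivial_limit_within)
qed

lemma eventually_nonexceptional: "eventually (\<lambda>z::complex. z\<^sup>2 \<noteq> 1) (at e within S)"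
proof -
  have "eventually (\<lambda>z. z \<noteq> 1) (at e within S)" "eventually (\<lambda>z. z \<noteq> -1) (at e within S)"
    using eventually_neq_at_within[of 1 e S] eventually_neq_at_within[of "-1" e S] by auto
  then show ?thesis by eventually_elim (simp add: power2_eq_1_iff)
qed

lemma circle_extend_eq:
  assumes F: "continuous_on (sphere 0 1) F"
    and f: "\<And>z. z \<in> sphere 0 1 \<Longrightarrow> z\<^sup>2 \<noteq> 1 \<Longrightarrow> f z = F z"
    and z: "z \<in> sphere 0 1"
  shows "circle_extend f z = F z"
proof (cases "z\<^sup>2 = 1")
  case True
  have "(F \<longlongrightarrow> F z) (at z within sphere 0 1)" using F z by (simp add: continuous_on_def)
  moreover have "eventually (\<lambda>w. F w = f w) (at z within sphere 0 1)"
    using eventually_nonexceptional[of z "sphere 0 1"]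
    by (auto simp: eventually_at_filter elim!: eventually_mono intro: f[symmetric])
  ultimately have "(f \<longlongrightarrow> F z) (at z within sphere 0 1)" by (rule Lim_transform_eventually)
  then show ?thesis using True circle_point_cluster[OF z] by (simp add: circle_extend_def tendsto_Lim)
qed (use f z in \<open>simp add: circle_extend_def\<close>)

lemma wronskian_pluecker:
  "wronskian a u v n * w n + wronskian a v w n * u n + wronskian a w u n * v n = 0"
  by (simp add: wronskian_def algebra_simps)

lemma wronskian_swap: "wronskian a v u n = - wronskian a u v n"
  by (simp add: wronskian_def algebra_simps)

text \<open>
Both scattering relations are the Pluecker relation among g, f and one of the conjugates. The lower bound for
W comes from the quadratic Pluecker relation [f,f*][g,g*] = [f,g][f*,g*] - [f,g*][f*,g]. Its right-hand side
is |W|^2 - |[f,g*]|^2, and its left-hand side is |z - 1/z|^2 / 4 because z - 1/z is purely imaginary on the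
circle; where W does not vanish, this is |T|^2 + |R|^2 = 1.
\<close>
lemma scattering_coeffs_formula:
  assumes a: "\<And>n. a n > 0" and m: "right_moment j a b" "right_moment j (reflect_a a) (reflect_b b)"
    and z: "z \<in> sphere 0 1"
  defines "f \<equiv> jost_plus a b z" and "g \<equiv> jost_minus a b z"
  defines "W \<equiv> wronskian a g f 0"
  shows "norm ((z - inverse z) / 2) \<le> norm W"
    and "z\<^sup>2 \<noteq> 1 \<Longrightarrow> scattering_coeffs a b z =
           ((z - inverse z) / 2 / W, wronskian a (\<lambda>n. cnj (f n)) g 0 / W, wronskian a f (\<lambda>n. cnj (g n)) 0 / W)"
proof -
  let ?fc = "\<lambda>n. cnj (f n)" and ?gc = "\<lambda>n. cnj (g n)"
  let ?n0 = "(z - inverse z) / 2"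
  have a': "\<And>n. reflect_a a n > 0" by (simp add: reflect_a_def a)
  have zi: "inverse z \<in> sphere 0 1" using z by (simp add: norm_inverse)
  have z0: "z \<noteq> 0" using z by auto
  have zc: "cnj z = inverse z" using circle_inverse_cnj[OF z] by simp
  have solf: "jacobi_solution a b z f" and solg: "jacobi_solution a b z g"
    using regular_family_jost_plus[OF a m(1)] regular_family_jost_minus[OF a m(2)] z
    unfolding regular_family_def f_def g_def by blast+
  note solfc = jacobi_solution_cnj[OF z solf] and solgc = jacobi_solution_cnj[OF z solg]
  have fi: "jost_plus a b (inverse z) = ?fc" unfolding f_def by (rule jost_plus_inverse[OF a m(1) z])
  have gi: "jost_minus a b (inverse z) = ?gc"
    unfolding g_def jost_minus_reflect[OF a m(2) z] jost_minus_reflect[OF a m(2) zi] jost_plus_inverse[OF a' m(2) z] ..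
  have ff: "wronskian a f ?fc n = - ?n0" for n
    unfolding f_def wronskian_jost_plus_cnj[OF a m(1) z] by (simp add: field_simps)
  have gg: "wronskian a g ?gc n = ?n0" for n
  proof -
    define u where "u = jost_plus (reflect_a a) (reflect_b b) z"
    have gu: "g = (\<lambda>n. u (- n))" unfolding g_def u_def by (rule jost_minus_reflect[OF a m(2) z])
    have "wronskian (reflect_a (reflect_a a)) (\<lambda>n. u (- n)) (\<lambda>n. cnj (u (- n))) n
        = - wronskian (reflect_a a) u (\<lambda>n. cnj (u n)) (- n - 1)"
      by (rule wronskian_reflect)
    then show ?thesis
      unfolding gu reflect_reflect u_def wronskian_jost_plus_cnj[OF a' m(2) z] by (simp add: field_simps)
  qed
  have Wn: "wronskian a g f n = W" for n unfolding W_def by (rule wronskian_const[OF solg solf])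
  have fgc: "wronskian a f ?gc n = wronskian a f ?gc 0" for n by (rule wronskian_const[OF solf solgc])
  have fcg: "wronskian a ?fc g n = wronskian a ?fc g 0" for n by (rule wronskian_const[OF solfc solg])
  show le: "norm ?n0 \<le> norm W"
  proof -
    have "wronskian a f ?fc 0 * wronskian a g ?gc 0
        = wronskian a f g 0 * wronskian a ?fc ?gc 0 - wronskian a f ?gc 0 * wronskian a ?fc g 0"
      by (simp add: wronskian_def algebra_simps)
    moreover have "wronskian a ?fc ?gc 0 = cnj (wronskian a f g 0)" by (rule wronskian_cnj)
    moreover have "wronskian a ?fc g 0 = cnj (wronskian a f ?gc 0)" using wronskian_cnj[of a f ?gc 0] by simp
    moreover have "wronskian a f g 0 = - W" unfolding W_def by (rule wronskian_swap)
    ultimately have "- ?n0 * ?n0 = W * cnj W - wronskian a f ?gc 0 * cnj (wronskian a f ?gc 0)"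
      unfolding ff gg by simp
    moreover have "cnj ?n0 = - ?n0" by (simp add: zc field_simps)
    then have "- ?n0 * ?n0 = ?n0 * cnj ?n0" by (metis minus_mult_commute)
    ultimately have "of_real ((norm ?n0)\<^sup>2) = complex_of_real ((norm W)\<^sup>2 - (norm (wronskian a f ?gc 0))\<^sup>2)"
      by (simp only: of_real_diff complex_norm_square[symmetric])
    then have "(norm ?n0)\<^sup>2 = (norm W)\<^sup>2 - (norm (wronskian a f ?gc 0))\<^sup>2" by (simp only: of_real_eq_iff)
    then have "(norm ?n0)\<^sup>2 \<le> (norm W)\<^sup>2" by simp
    then show ?thesis by (rule power2_le_imp_le) simp
  qed
  assume z2: "z\<^sup>2 \<noteq> 1"
  have n0: "?n0 \<noteq> 0" using z2 z0 by (auto simp: field_simps power2_eq_square)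
  then have W0: "W \<noteq> 0" using le by auto
  have quotient: "n / W * u = R / W * y + x" if "W * x + R * y - n * u = 0" for n R u x y
    using that W0 by (simp add: field_simps)
  have 1: "?n0 / W * f n = wronskian a f ?gc 0 / W * g n + ?gc n" for n
    by (rule quotient) (use wronskian_pluecker[of a g f n ?gc] wronskian_swap[of a ?gc g n] in
      \<open>simp only: Wn gg fgc[of n]\<close>, simp)
  have 2: "?n0 / W * g n = wronskian a ?fc g 0 / W * f n + ?fc n" for n
    by (rule quotient) (use wronskian_pluecker[of a g f n ?fc] in
      \<open>simp only: Wn ff fcg[of n]\<close>, simp add: algebra_simps)
  (* As W does not vanish, f and g are linearly independent, which determines the coefficients. *)
  have indep: "t = 0 \<and> r = 0" if "t * f 0 = r * g 0" "t * f 1 = r * g 1" for t r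
  proof -
    have W': "W = of_real (a 0) * (g 0 * f 1 - g 1 * f 0)" by (simp add: W_def wronskian_def)
    have "t * W = of_real (a 0) * (g 0 * (t * f 1) - g 1 * (t * f 0))" by (simp add: W' algebra_simps)
    also have "\<dots> = 0" unfolding that by (simp add: algebra_simps)
    finally have "t = 0" using W0 by simp
    have "r * W = of_real (a 0) * ((r * g 0) * f 1 - (r * g 1) * f 0)" by (simp add: W' algebra_simps)
    also have "\<dots> = 0" unfolding that[symmetric] by (simp add: algebra_simps)
    finally show ?thesis using W0 \<open>t = 0\<close> by simp
  qed
  show "scattering_coeffs a b z = (?n0 / W, wronskian a ?fc g 0 / W, wronskian a f ?gc 0 / W)"
    unfolding scattering_coeffs_def fi gi unfolding f_def[symmetric] g_def[symmetric]
  proof (rule the_equality)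
    show "case (?n0 / W, wronskian a ?fc g 0 / W, wronskian a f ?gc 0 / W) of (T, Rp, Rm) \<Rightarrow>
        \<forall>n. T * f n = Rm * g n + cnj (g n) \<and> T * g n = Rp * f n + cnj (f n)"
      unfolding prod.case using 1 2 by blast
    fix p assume p: "case p of (T, Rp, Rm) \<Rightarrow> \<forall>n. T * f n = Rm * g n + cnj (g n) \<and> T * g n = Rp * f n + cnj (f n)"
    obtain T Rp Rm where pe: "p = (T, Rp, Rm)" by (cases p)
    have e1: "T * f n = Rm * g n + cnj (g n)" and e2: "T * g n = Rp * f n + cnj (f n)" for n
      using p unfolding pe by auto
    have "(T - ?n0 / W) * f n = (Rm - wronskian a f ?gc 0 / W) * g n" for n
      unfolding left_diff_distrib e1 1 by simp
    then have "T - ?n0 / W = 0" "Rm - wronskian a f ?gc 0 / W = 0" using indep by blast+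
    moreover have "(Rp - wronskian a ?fc g 0 / W) * f n = (T - ?n0 / W) * g n" for n
      unfolding left_diff_distrib e2 2 by simp
    then have "Rp - wronskian a ?fc g 0 / W = 0" using indep by blast
    ultimately show "p = (?n0 / W, wronskian a ?fc g 0 / W, wronskian a f ?gc 0 / W)" by (simp add: pe)
  qed
qed

definition resonance_factor :: "(complex \<Rightarrow> complex) \<Rightarrow> complex \<Rightarrow> complex" where
  "resonance_factor W z = (if W 1 = 0 then z - 1 else 1) * (if W (- 1) = 0 then z + 1 else 1)"

text \<open>
If both points are resonant, the two divisions must not be performed in succession, as the first quotient is
not known to be divisible again. Partial fractions, 1/((z-1)(z+1)) = (1/(z-1) - 1/(z+1))/2, avoid this.
\<close>
lemma divide_resonance_factor:
  assumes F: "weighted_wiener j F"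
    and res: "\<And>e. e = 1 \<or> e = -1 \<Longrightarrow> W e = 0 \<Longrightarrow> \<exists>X. weighted_wiener j X \<and> (\<forall>z\<in>sphere 0 1. F z = (z - e) * X z)"
  obtains Q where "weighted_wiener j Q" "\<And>z. z \<in> sphere 0 1 \<Longrightarrow> F z = resonance_factor W z * Q z"
proof -
  consider "W 1 \<noteq> 0" "W (-1) \<noteq> 0" | "W 1 = 0" "W (-1) \<noteq> 0" | "W 1 \<noteq> 0" "W (-1) = 0" | "W 1 = 0" "W (-1) = 0" by blast
  then show thesis
  proof cases
    case 1 then show thesis using that[OF F] by (simp add: resonance_factor_def)
  next
    case 2 then show thesis using res[of 1] that by (auto simp: resonance_factor_def)
  next
    case 3 then show thesis using res[of "-1"] that by (auto simp: resonance_factor_def)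
  next
    case 4
    obtain X where X: "weighted_wiener j X" "\<And>z. z \<in> sphere 0 1 \<Longrightarrow> F z = (z - 1) * X z"
      using res[of 1] 4 by blast
    obtain Y where Y: "weighted_wiener j Y" "\<And>z. z \<in> sphere 0 1 \<Longrightarrow> F z = (z - (-1)) * Y z"
      using res[of "-1"] 4 by blast
    show thesis
    proof (rule that)
      show "weighted_wiener j (\<lambda>z. (1 / 2) * (X z - Y z))" by (intro weighted_wiener_intros X Y)
      fix z :: complex assume z: "z \<in> sphere 0 1"
      have "resonance_factor W z * ((1 / 2) * (X z - Y z)) = (1 / 2) * ((z + 1) * ((z - 1) * X z) - (z - 1) * ((z - (-1)) * Y z))"
      proof -
        have "(z - 1) * (z + 1) * (c * (X z - Y z)) = c * ((z + 1) * ((z - 1) * X z) - (z - 1) * ((z - (-1)) * Y z))" for c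
          by (simp add: algebra_simps)
        then show ?thesis unfolding resonance_factor_def if_P[OF 4(1)] if_P[OF 4(2)] .
      qed
      also have "\<dots> = (1 / 2) * ((z + 1) * F z - (z - 1) * F z)" unfolding X(2)[OF z, symmetric] Y(2)[OF z, symmetric] ..
      also have "\<dots> = F z" by (simp add: algebra_simps)
      finally show "F z = resonance_factor W z * ((1 / 2) * (X z - Y z))" ..
    qed
  qed
qed

text \<open>
The resonance factor is cancelled from W and from the three numerators. The reduced Wronskian Q has no zeros:
at points where W does not vanish, and in particular away from z = 1 and z = -1 by the lower bound for W, this
is clear. At a resonant point, the bound |Q0| \<le> |Q| for the reduced numerator Q0 of T, which extends there
by continuity, prevents a second zero because Q0 does not vanish there.
\<close>
lemma scattering_data_weighted_wiener:
  assumes a: "\<And>n. a n > 0" and l1: "(\<lambda>n. \<bar>a n - 1 / 2\<bar> + \<bar>b n\<bar>) \<in> weighted_l1 (j + 1)"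
  shows "weighted_wiener j (transmission a b)" "weighted_wiener j (reflection_plus a b)"
    "weighted_wiener j (reflection_minus a b)"
proof -
  note m = weighted_l1_right_moments[OF l1]
  define f where "f = jost_plus a b"
  define g where "g = jost_minus a b"
  define fc where "fc z n = cnj (f z n)" for z n
  define gc where "gc z n = cnj (g z n)" for z n
  have rf: "regular_family j a b f" and rg: "regular_family j a b g"
    unfolding f_def g_def by (rule regular_family_jost_plus[OF a m(1)], rule regular_family_jost_minus[OF a m(2)])
  have rfc: "regular_family j a b fc" and rgc: "regular_family j a b gc"
    using regular_family_cnj[OF rf] regular_family_cnj[OF rg] by (simp_all add: fc_def[abs_def] gc_def[abs_def])
  have real: "fc e = f e" "gc e = g e" if e: "e = 1 \<or> e = -1" for e
  proof -
    have eS: "e \<in> sphere 0 1" and ei: "inverse e = e" using e by auto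
    have a': "\<And>n. reflect_a a n > 0" by (simp add: reflect_a_def a)
    show "fc e = f e" using jost_plus_inverse[OF a m(1) eS] by (simp add: ei fc_def[abs_def] f_def)
    show "gc e = g e" using jost_plus_inverse[OF a' m(2) eS]
      by (simp add: ei gc_def[abs_def] g_def jost_minus_reflect[OF a m(2) eS]) (metis)
  qed
  define W where "W z = wronskian a (g z) (f z) 0" for z
  define Np where "Np z = wronskian a (fc z) (g z) 0" for z
  define Nm where "Nm z = wronskian a (f z) (gc z) 0" for z
  have WW: "weighted_wiener j (\<lambda>z. wronskian a (u z) (v z) 0)"
    if "regular_family j a b u" "regular_family j a b v" for u v
    unfolding wronskian_def
    by (intro weighted_wiener_intros) (use that in \<open>auto simp: regular_family_def\<close>)
  have res: "\<exists>X. weighted_wiener j X \<and> (\<forall>z\<in>sphere 0 1. wronskian a (u z) (v z) 0 = (z - e) * X z)"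
    if "regular_family j a b u" "regular_family j a b v" "e = 1 \<or> e = -1" "wronskian a (u e) (v e) 0 = 0" for u v e
    by (rule regular_family_resonance[OF a that]) blast
  have Np0: "Np e = 0" and Nm0: "Nm e = 0" if "e = 1 \<or> e = -1" "W e = 0" for e
    using that(2) wronskian_swap[of a "f e" "g e" 0] unfolding W_def Np_def Nm_def real[OF that(1)] by auto
  obtain Q where Q: "weighted_wiener j Q" "\<And>z. z \<in> sphere 0 1 \<Longrightarrow> W z = resonance_factor W z * Q z"
    by (rule divide_resonance_factor[of j W W]) (use WW[OF rg rf] res[OF rg rf] in \<open>auto simp: W_def[abs_def]\<close>)
  obtain Qp where Qp: "weighted_wiener j Qp" "\<And>z. z \<in> sphere 0 1 \<Longrightarrow> Np z = resonance_factor W z * Qp z"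
  proof (rule divide_resonance_factor[of j Np W])
    show "weighted_wiener j Np" unfolding Np_def by (rule WW[OF rfc rg])
    show "\<exists>X. weighted_wiener j X \<and> (\<forall>z\<in>sphere 0 1. Np z = (z - e) * X z)" if "e = 1 \<or> e = -1" "W e = 0" for e
      unfolding Np_def by (rule res[OF rfc rg that(1)]) (use Np0[OF that] in \<open>simp add: Np_def\<close>)
  qed blast
  obtain Qm where Qm: "weighted_wiener j Qm" "\<And>z. z \<in> sphere 0 1 \<Longrightarrow> Nm z = resonance_factor W z * Qm z"
  proof (rule divide_resonance_factor[of j Nm W])
    show "weighted_wiener j Nm" unfolding Nm_def by (rule WW[OF rf rgc])
    show "\<exists>X. weighted_wiener j X \<and> (\<forall>z\<in>sphere 0 1. Nm z = (z - e) * X z)" if "e = 1 \<or> e = -1" "W e = 0" for e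
      unfolding Nm_def by (rule res[OF rf rgc that(1)]) (use Nm0[OF that] in \<open>simp add: Nm_def\<close>)
  qed blast
  (* For c = 0 and c = 1 the factor 1 + c (z - 2) of Q0 is 1 and z - 1, and likewise 1 + c z is 1 and z + 1. *)
  define c1 where "c1 = (if W 1 = 0 then 0 else 1 :: complex)"
  define c2 where "c2 = (if W (-1) = 0 then 0 else 1 :: complex)"
  define Q0 where "Q0 z = (1 + c1 * (z - 2)) * (1 + c2 * z) * ((1 / 2) * inverse z)" for z
  have Q0W: "weighted_wiener j Q0" unfolding Q0_def by (intro weighted_wiener_intros)
  have Q0: "(z - inverse z) / 2 = resonance_factor W z * Q0 z" if "z \<in> sphere 0 1" for z
  proof -
    have "z \<noteq> 0" using that by auto
    then have "(z - inverse z) / 2 = (z - 1) * (z + 1) * ((1 / 2) * inverse z)" by (simp add: field_simps)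
    also have "\<dots> = resonance_factor W z * Q0 z"
      by (simp add: resonance_factor_def Q0_def c1_def c2_def mult_ac)
    finally show ?thesis .
  qed
  have pne: "resonance_factor W z \<noteq> 0" if "z\<^sup>2 \<noteq> 1" for z
    using that by (auto simp: resonance_factor_def power2_eq_1_iff eq_neg_iff_add_eq_0)
  have le: "norm (Q0 z) \<le> norm (Q z)" if z: "z \<in> sphere 0 1" for z
  proof (cases "z\<^sup>2 = 1")
    case False
    have "norm (resonance_factor W z * Q0 z) \<le> norm (resonance_factor W z * Q z)"
      using scattering_coeffs_formula(1)[OF a m z] unfolding Q0[OF z] Q(2)[OF z, symmetric]
      by (simp add: W_def f_def g_def)
    then show ?thesis using pne[OF False] by (simp add: norm_mult)
  next
    case True
    have lim: "((\<lambda>w. norm (Q w) - norm (Q0 w)) \<longlongrightarrow> norm (Q z) - norm (Q0 z)) (at z within sphere 0 1)"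
      using weighted_wiener_continuous[OF Q(1)] weighted_wiener_continuous[OF Q0W] z
      by (intro tendsto_intros) (auto simp: continuous_on_def)
    have "eventually (\<lambda>w. w \<in> sphere 0 1) (at z within sphere 0 1)" by (simp add: eventually_at_filter)
    with eventually_nonexceptional[of z "sphere 0 1"]
    have "eventually (\<lambda>w. 0 \<le> norm (Q w) - norm (Q0 w)) (at z within sphere 0 1)"
    proof eventually_elim
      case (elim w)
      have "norm (resonance_factor W w * Q0 w) \<le> norm (resonance_factor W w * Q w)"
        using scattering_coeffs_formula(1)[OF a m elim(2)] unfolding Q0[OF elim(2)] Q(2)[OF elim(2), symmetric]
        by (simp add: W_def f_def g_def)
      then show ?case using pne[OF elim(1)] by (simp add: norm_mult)
    qed
    from tendsto_lowerbound[OF lim this circle_point_cluster[OF z]] show ?thesis by simp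
  qed
  have Qne: "Q z \<noteq> 0" if z: "z \<in> sphere 0 1" for z
  proof (cases "W z = 0")
    case False then show ?thesis using Q(2)[OF z] by auto
  next
    case True
    have z0: "z \<noteq> 0" using z by auto
    have "Q0 z \<noteq> 0"
    proof (cases "z\<^sup>2 = 1")
      case True
      then have "z = 1 \<or> z = -1" by (simp add: power2_eq_1_iff)
      then show ?thesis using \<open>W z = 0\<close> by (auto simp: Q0_def c1_def c2_def)
    next
      case False
      then have "z - inverse z \<noteq> 0" using z0 by (auto simp: field_simps power2_eq_square)
      then show ?thesis using Q0[OF z] by auto
    qed
    then show ?thesis using le[OF z] by auto
  qed
  have QW: "weighted_wiener j (\<lambda>z. inverse (Q z))" by (rule weighted_wiener_inverse[OF Q(1) Qne])
  have final: "weighted_wiener j (circle_extend F)"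
    if P: "weighted_wiener j P" and F: "\<And>z. z \<in> sphere 0 1 \<Longrightarrow> z\<^sup>2 \<noteq> 1 \<Longrightarrow> F z = resonance_factor W z * P z / W z" for F P
  proof (rule weighted_wiener_cong)
    show PW: "weighted_wiener j (\<lambda>z. P z * inverse (Q z))" by (intro weighted_wiener_intros P QW)
    show "P z * inverse (Q z) = circle_extend F z" if z: "z \<in> sphere 0 1" for z
    proof (rule circle_extend_eq[OF weighted_wiener_continuous[OF PW] _ z, symmetric])
      fix z :: complex assume z: "z \<in> sphere 0 1" "z\<^sup>2 \<noteq> 1"
      show "F z = P z * inverse (Q z)"
        unfolding F[OF z] using Q(2)[OF z(1)] pne[OF z(2)] Qne[OF z(1)] by (simp add: field_simps)
    qed
  qed
  have sc: "scattering_coeffs a b z = ((z - inverse z) / 2 / W z, Np z / W z, Nm z / W z)"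
    if "z \<in> sphere 0 1" "z\<^sup>2 \<noteq> 1" for z
    using scattering_coeffs_formula(2)[OF a m that]
    by (simp add: W_def Np_def Nm_def f_def g_def fc_def[abs_def] gc_def[abs_def])
  show "weighted_wiener j (transmission a b)"
    unfolding transmission_def by (rule final[OF Q0W]) (simp add: sc Q0[symmetric])
  show "weighted_wiener j (reflection_plus a b)"
    unfolding reflection_plus_def by (rule final[OF Qp(1)]) (simp add: sc Qp(2)[symmetric])
  show "weighted_wiener j (reflection_minus a b)"
    unfolding reflection_minus_def by (rule final[OF Qm(1)]) (simp add: sc Qm(2)[symmetric])
qed

theorem theorem2p2:
  fixes a b :: "int \<Rightarrow> real" and j :: nat
  assumes "\<And>n. a n > 0"
    and "(\<lambda>n. \<bar>a n - 1 / 2\<bar> + \<bar>b n\<bar>) \<in> weighted_l1 (j + 1)"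
  shows "\<forall>f \<in> {transmission a b, reflection_plus a b, reflection_minus a b}.
           continuous_on (sphere 0 1) f \<and>
           (\<forall>l<j. circle_differentiable ((circle_deriv ^^ l) f)) \<and>
           (\<forall>l\<le>j. (circle_deriv ^^ l) f \<in> wiener_algebra)"
  using scattering_data_weighted_wiener[OF assms] weighted_wiener_derivatives by blast

end
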